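(* Let $L>0$ and let $\gamma:[0,L]\to\mathbf{R}^2$ be an arc-length parametrised elastica with non-constant and monotone signed curvature. Then $\gamma$ is the unique minimiser of the bending energy $\mathsf{B}$ in the set $\mathcal{A}(\gamma)$.
   Context: For $L>0$, $W^{2,2}_{\mathrm{arc}}(0,L;\mathbf{R}^2)$ denotes the set of $\gamma\in W^{2,2}(0,L;\mathbf{R}^2)$ with $|\gamma'|\equiv 1$ (arc-length parametrised curves of length $L$). The signed curvature $k$ is defined by $\gamma''=kN$, where $N$ is the counterclockwise rotation of $T=\gamma'$ by $\pi/2$. The bending energy is $\mathsf{B}[\gamma]=\int_0^L k^2\,ds$. An arc-length parametrised curve $\gamma:[0,L]\to\mathbf{R}^2$ is an elastica if $\gamma\in W^{2,2}_{\mathrm{arc}}(0,L;\mathbf{R}^2)$ and for some $\lambda\in\mathbf{R}$ its signed curvature satisfies $2k''+k^3-\lambda k=0$ in the distributional sense (this implies that $\gamma$ is smooth). For $\gamma\in W^{2,2}_{\mathrm{arc}}(0,L;\mathbf{R}^2)$, $\mathcal{A}(\gamma)$ is the set of all $\tilde\gamma\in W^{2,2}_{\mathrm{arc}}(0,L;\mathbf{R}^2)$ (same length $L$) such that $\tilde\gamma(0)=\gamma(0)$, $\tilde\gamma(L)=\gamma(L)$, $\tilde\gamma'(0)=\gamma'(0)$, $\tilde\gamma'(L)=\gamma'(L)$. *)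

theory Defs
  imports "HOL-Analysis.Analysis"
begin

definition locally_integrable :: "real \<Rightarrow> (real \<Rightarrow> 'a::euclidean_space) \<Rightarrow> bool" where
  "locally_integrable L f \<longleftrightarrow>
     (\<forall>K. compact K \<and> K \<subseteq> {0<..<L} \<longrightarrow> f absolutely_integrable_on K)"

definition square_integrable :: "real \<Rightarrow> (real \<Rightarrow> 'a::euclidean_space) \<Rightarrow> bool" where
  "square_integrable L f \<longleftrightarrow>
     f \<in> borel_measurable (lebesgue_on {0<..<L}) \<and>
     (\<lambda>s. (norm (f s))\<^sup>2) absolutely_integrable_on {0<..<L}"

text \<open>$C_c^\infty(0,L)$, with the functions extended by zero to the real line.\<close>

definition test_functions :: "real \<Rightarrow> (real \<Rightarrow> real) set" where
  "test_functions L =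
     {\<phi>. (\<forall>n s. ((deriv ^^ n) \<phi>) field_differentiable (at s)) \<and>
         (\<exists>K. compact K \<and> K \<subseteq> {0<..<L} \<and> (\<forall>s. s \<notin> K \<longrightarrow> \<phi> s = 0))}"

definition weak_derivative ::
    "nat \<Rightarrow> real \<Rightarrow> (real \<Rightarrow> 'a::euclidean_space) \<Rightarrow> (real \<Rightarrow> 'a) \<Rightarrow> bool" where
  "weak_derivative n L f g \<longleftrightarrow>
     locally_integrable L f \<and> locally_integrable L g \<and>
     (\<forall>\<phi>\<in>test_functions L.
        (LINT s:{0<..<L}|lebesgue. (deriv ^^ n) \<phi> s *\<^sub>R f s) =
        (-1) ^ n *\<^sub>R (LINT s:{0<..<L}|lebesgue. \<phi> s *\<^sub>R g s))"

text \<open>Every class in $W^{2,2}(0,L;\mathbf{R}^2)$ has exactly one representative that is continuous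
  on the closed interval, and this representative is $C^1$ there (with one-sided derivatives at
  the end points). A curve is given by this representative, so that boundary values make sense;
  its values outside the closed interval are irrelevant.\<close>

definition W22 :: "real \<Rightarrow> (real \<Rightarrow> real^2) set" where
  "W22 L = {\<gamma>. continuous_on {0..L} \<gamma> \<and> square_integrable L \<gamma> \<and>
     (\<exists>g. weak_derivative 1 L \<gamma> g \<and> square_integrable L g) \<and>
     (\<exists>h. weak_derivative 2 L \<gamma> h \<and> square_integrable L h)}"

definition tangent :: "real \<Rightarrow> (real \<Rightarrow> real^2) \<Rightarrow> real \<Rightarrow> real^2" where
  "tangent L \<gamma> s = vector_derivative \<gamma> (at s within {0..L})"

definition normal_vec :: "real \<Rightarrow> (real \<Rightarrow> real^2) \<Rightarrow> real \<Rightarrow> real^2" where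
  "normal_vec L \<gamma> s = vector [- (tangent L \<gamma> s $ 2), tangent L \<gamma> s $ 1]"

definition W22_arc :: "real \<Rightarrow> (real \<Rightarrow> real^2) set" where
  "W22_arc L = {\<gamma> \<in> W22 L. \<forall>s\<in>{0..L}. norm (tangent L \<gamma> s) = 1}"

text \<open>The second derivative of a $W^{2,2}$ curve is a weak one, so the signed curvature is
  determined only up to null sets: the predicate holds of all its representatives.\<close>

definition signed_curvature :: "real \<Rightarrow> (real \<Rightarrow> real^2) \<Rightarrow> (real \<Rightarrow> real) \<Rightarrow> bool" where
  "signed_curvature L \<gamma> k \<longleftrightarrow> weak_derivative 2 L \<gamma> (\<lambda>s. k s *\<^sub>R normal_vec L \<gamma> s)"

text \<open>On \<open>W22_arc L\<close> a signed curvature exists and is square integrable, and the integral does not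
  depend on the representative that is chosen.\<close>

definition bending_energy :: "real \<Rightarrow> (real \<Rightarrow> real^2) \<Rightarrow> real" where
  "bending_energy L \<gamma> =
     (LINT s:{0<..<L}|lebesgue. ((SOME k. signed_curvature L \<gamma> k) s)\<^sup>2)"

text \<open>The equation $2k'' + k^3 - \lambda k = 0$ in the sense of distributions; local integrability
  makes \<open>k\<close> and its cube distributions.\<close>

definition elastica_equation :: "real \<Rightarrow> real \<Rightarrow> (real \<Rightarrow> real) \<Rightarrow> bool" where
  "elastica_equation L lam k \<longleftrightarrow>
     locally_integrable L k \<and> locally_integrable L (\<lambda>s. k s ^ 3) \<and>
     (\<forall>\<phi>\<in>test_functions L.
        (LINT s:{0<..<L}|lebesgue.
           2 * k s * (deriv ^^ 2) \<phi> s + (k s ^ 3 - lam * k s) * \<phi> s) = 0)"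

definition elastica :: "real \<Rightarrow> (real \<Rightarrow> real^2) \<Rightarrow> bool" where
  "elastica L \<gamma> \<longleftrightarrow> \<gamma> \<in> W22_arc L \<and>
     (\<exists>lam k. signed_curvature L \<gamma> k \<and> elastica_equation L lam k)"

definition admissible :: "real \<Rightarrow> (real \<Rightarrow> real^2) \<Rightarrow> (real \<Rightarrow> real^2) set" where
  "admissible L \<gamma> = {c \<in> W22_arc L.
     c 0 = \<gamma> 0 \<and> c L = \<gamma> L \<and>
     tangent L c 0 = tangent L \<gamma> 0 \<and> tangent L c L = tangent L \<gamma> L}"

end

theory Submission
  imports Defs
begin

text \<open>Why an elastica with monotone curvature is the only minimiser. Write \<open>T\<close> and \<open>N\<close> for its
  tangent and normal. The equation \<open>2k'' + k\<^sup>3 - \<lambda>k = 0\<close> says that the vector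
  \<open>V = (k\<^sup>2 - \<lambda>) T + 2k' N\<close> is constant. It is not zero, since \<open>2k' = V \<bullet> N\<close> and \<open>k\<close> is not constant.
  Put \<open>c = norm V / 2\<close> and \<open>e = V / (2c)\<close>, and let \<open>u\<close> be the angle from \<open>e\<close> to \<open>T\<close>, measured with the
  orientation in which it satisfies \<open>u' = -k\<close> (for increasing \<open>k\<close>) or \<open>u' = k\<close> (for decreasing \<open>k\<close>).
  Then \<open>u'' = -c sin u\<close>. Monotonicity of \<open>k\<close> means that \<open>sin u\<close> never becomes negative, so the
  angle stays in \<open>[0, \<pi>]\<close>.

  Let \<open>S\<close> be the tangent of a competitor and \<open>\<psi> = arccos (e \<bullet> S)\<close>, again an angle in \<open>[0, \<pi>]\<close>. Folding
  the direction of \<open>S\<close> into \<open>[0, \<pi>]\<close> is 1-Lipschitz, so \<open>\<integral> \<psi>'\<^sup>2\<close> is at most the bending energy; it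
  also forgets winding numbers, so \<open>\<psi> = u\<close> at both end points. Finally \<open>\<integral> cos \<psi>\<close> is the \<open>e\<close>-component
  of the prescribed difference of the end points. Hence it is enough that \<open>u\<close> minimises
  \<open>\<integral> \<psi>'\<^sup>2 + 2c cos \<psi>\<close> among the \<open>[0, \<pi>]\<close>-valued functions with the same boundary values.

  This functional is not convex in \<open>\<psi>\<close>, but it is convex in \<open>\<psi>\<^sup>2\<close>. For the potential this is the
  strict convexity of \<open>t \<mapsto> cos (sqrt t)\<close> on \<open>[0, \<pi>\<^sup>2]\<close>, that is, the monotonicity of \<open>sin x / x\<close>
  (\<open>cos_sqrt_strictly_convex\<close>). For the kinetic term it is Picone's identity: with \<open>q = u' / u\<close>,
  \<open>\<psi>'\<^sup>2 = (\<psi>\<^sup>2 q)' + c (sin u / u) \<psi>\<^sup>2 + (\<psi>' - \<psi> q)\<^sup>2\<close>. Dropping the last square, integrating, and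
  using the tangent line of the convex potential gives the inequality (\<open>pendulum_minimises\<close>).
  Equality forces \<open>\<psi> = u\<close>. Then the components of \<open>S\<close> and \<open>T\<close> along \<open>e\<close> agree, and the other component
  of \<open>S\<close> is at most that of \<open>T\<close>, which is \<open>sin u \<ge> 0\<close>; as both have the same integral, they agree too.

  The function \<open>\<psi>\<close> is only as regular as a folded \<open>W\<^sup>1\<^sup>,\<^sup>2\<close> function, so \<open>\<psi>'\<close> is never formed. Picone's
  inequality is proved for its increments over short intervals, with linear interpolation in between, and is
  then summed (\<open>Picone_inequality\<close>). At an end point where \<open>u\<close> vanishes, \<open>q\<close> is singular, and the
  boundary term is controlled by the finite energy of \<open>\<psi>\<close> and by the nonzero slope of \<open>u\<close> there.

  It remains to pass from weak derivatives to classical ones. Testing \<open>f'' = h\<close> with smooth functions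
  whose second derivatives approximate a combination of three point masses expresses \<open>f\<close> through the
  integral of \<open>h\<close> against a tent function (\<open>three_point_formula\<close>). This gives the \<open>C\<^sup>1\<close> regularity of curves, the uniqueness of
  the weak second derivative, and the smoothness of the curvature.\<close>


section \<open>Smooth approximation of the positive part\<close>

text \<open>Test functions are smooth functions of compact support; naming the first condition lets it be
  propagated on its own.\<close>

definition smooth :: "(real \<Rightarrow> real) \<Rightarrow> bool" where
  "smooth f \<longleftrightarrow> (\<forall>n s. ((deriv ^^ n) f) field_differentiable (at s))"

text \<open>A class of differentiable functions that is closed under differentiation consists of smooth
  functions. All closure properties below exhibit such a class.\<close>

lemma smooth_coinduct:
  assumes "f \<in> S"
    and "\<And>g s. g \<in> S \<Longrightarrow> g field_differentiable (at s)"
    and "\<And>g. g \<in> S \<Longrightarrow> deriv g \<in> S"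
  shows "smooth f"
proof -
  have "(deriv ^^ n) f \<in> S" for n
    by (induction n) (use assms in auto)
  then show ?thesis
    unfolding smooth_def using assms(2) by blast
qed

lemma smooth_differentiable: "smooth f \<Longrightarrow> f field_differentiable (at s)"
  unfolding smooth_def by (metis funpow_0)

lemma smooth_deriv: "smooth f \<Longrightarrow> smooth (deriv f)"
  unfolding smooth_def by (metis funpow_Suc_right o_apply)

lemma smooth_if_deriv_smooth:
  assumes "smooth f'" "\<And>s. (f has_real_derivative f' s) (at s)"
  shows "smooth f"
proof (rule smooth_coinduct[where S = "insert f {g. smooth g}"])
  have "deriv f = f'"
    using assms(2) by (auto intro: DERIV_imp_deriv)
  then show "deriv g \<in> insert f {g. smooth g}" if "g \<in> insert f {g. smooth g}" for g
    using that assms(1) smooth_deriv by auto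
  show "g field_differentiable at s" if "g \<in> insert f {g. smooth g}" for g s
    using that assms(2) smooth_differentiable field_differentiable_def by blast
qed simp

lemma smooth_add:
  assumes "smooth f" "smooth g"
  shows "smooth (\<lambda>x. f x + g x)"
proof (rule smooth_coinduct[where S = "{(\<lambda>x. f x + g x) | f g. smooth f \<and> smooth g}"])
  fix h assume "h \<in> {(\<lambda>x. f x + g x) | f g. smooth f \<and> smooth g}"
  then obtain f g where h: "h = (\<lambda>x. f x + g x)" and fg: "smooth f" "smooth g"
    by blast
  show "h field_differentiable at s" for s
    unfolding h by (intro derivative_intros smooth_differentiable fg)
  have "deriv h = (\<lambda>x. deriv f x + deriv g x)"
    unfolding h using smooth_differentiable fg by fastforce
  then show "deriv h \<in> {(\<lambda>x. f x + g x) | f g. smooth f \<and> smooth g}"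
    using fg smooth_deriv by blast
qed (use assms in blast)

lemma smooth_scale_affine:
  assumes "smooth f"
  shows "smooth (\<lambda>x. a * f (p * x + q))"
proof (rule smooth_coinduct[where S = "{(\<lambda>x. a * f (p * x + q)) | a f. smooth f}"])
  fix h assume "h \<in> {(\<lambda>x. a * f (p * x + q)) | a f. smooth f}"
  then obtain a f where h: "h = (\<lambda>x. a * f (p * x + q))" and f: "smooth f"
    by blast
  have d: "(h has_real_derivative (a * p) * deriv f (p * x + q)) (at x)" for x
  proof -
    have "((\<lambda>x. p * x + q) has_real_derivative p) (at x)"
      by (auto intro!: derivative_eq_intros)
    moreover have "(f has_real_derivative deriv f (p * x + q)) (at (p * x + q))"
      using smooth_differentiable[OF f] by (simp add: DERIV_deriv_iff_field_differentiable)
    ultimately show ?thesis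
      unfolding h using DERIV_cmult[OF DERIV_chain2, of f _ "\<lambda>x. p * x + q" x p UNIV a]
      by (metis mult.assoc mult.commute)
  qed
  then show "h field_differentiable at s" for s
    using field_differentiable_def by blast
  have "deriv h = (\<lambda>x. (a * p) * deriv f (p * x + q))"
    using d DERIV_imp_deriv by blast
  then show "deriv h \<in> {(\<lambda>x. a * f (p * x + q)) | a f. smooth f}"
    using f smooth_deriv by blast
qed (use assms in blast)

text \<open>Products of two smooth functions are not closed under differentiation, but their finite sums are,
  by the Leibniz rule.\<close>

inductive_set product_sums :: "(real \<Rightarrow> real) set" where
  prod: "smooth f \<Longrightarrow> smooth g \<Longrightarrow> (\<lambda>x. f x * g x) \<in> product_sums"
| sum: "p \<in> product_sums \<Longrightarrow> q \<in> product_sums \<Longrightarrow> (\<lambda>x. p x + q x) \<in> product_sums"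

lemma smooth_mult:
  assumes "smooth f" "smooth g"
  shows "smooth (\<lambda>x. f x * g x)"
proof -
  have *: "(\<forall>s. p field_differentiable at s) \<and> deriv p \<in> product_sums"
    if "p \<in> product_sums" for p
    using that
  proof induction
    case (prod f g)
    have "deriv (\<lambda>x. f x * g x) = (\<lambda>x. f x * deriv g x + deriv f x * g x)"
      using smooth_differentiable prod by fastforce
    moreover have "(\<lambda>x. f x * deriv g x + deriv f x * g x) \<in> product_sums"
      by (intro product_sums.intros prod smooth_deriv)
    moreover have "(\<lambda>x. f x * g x) field_differentiable at s" for s
      by (intro derivative_intros smooth_differentiable prod)
    ultimately show ?case
      by simp
  next
    case (sum p q)
    then have "deriv (\<lambda>x. p x + q x) = (\<lambda>x. deriv p x + deriv q x)"
      by fastforce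
    then show ?case
      using sum product_sums.intros by (auto intro!: derivative_intros)
  qed
  show ?thesis
    by (rule smooth_coinduct[where S = product_sums])
      (use * assms product_sums.prod in blast)+
qed

text \<open>The derivatives of \<open>exp (-1/x)\<close>, extended by zero to \<open>x \<le> 0\<close>, are all of this form.\<close>

definition flat_exp :: "real poly \<Rightarrow> real \<Rightarrow> real" where
  "flat_exp p x = (if x > 0 then poly p (1 / x) * exp (- (1 / x)) else 0)"

lemma poly_over_exp_tendsto_0: "((\<lambda>y::real. poly p y * exp (- y)) \<longlongrightarrow> 0) at_top"
proof -
  have "((\<lambda>y::real. \<Sum>i\<le>degree p. coeff p i * (y ^ i / exp y)) \<longlongrightarrow> (\<Sum>i\<le>degree p. coeff p i * 0)) at_top"
    by (intro tendsto_intros tendsto_power_div_exp_0)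
  moreover have "poly p y * exp (- y) = (\<Sum>i\<le>degree p. coeff p i * (y ^ i / exp y))" for y
    by (simp add: poly_altdef sum_distrib_right exp_minus divide_inverse mult.assoc)
  ultimately show ?thesis
    by simp
qed

text \<open>For \<open>x > 0\<close> put \<open>y = 1/x\<close>: the derivative of \<open>p(y) exp (-y)\<close> in \<open>x\<close> is
  \<open>y\<^sup>2 (p(y) - p'(y)) exp (-y)\<close>, which explains the polynomial. At the origin exponential decay wins.\<close>

lemma flat_exp_has_derivative:
  "(flat_exp p has_real_derivative flat_exp ([:0,0,1:] * (p - pderiv p)) x) (at x)"
proof -
  consider "x > 0" | "x < 0" | "x = 0" by linarith
  then show ?thesis
  proof cases
    case 1
    have "((\<lambda>x. poly p (1 / x) * exp (- (1 / x))) has_real_derivative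
        flat_exp ([:0,0,1:] * (p - pderiv p)) x) (at x)"
      using 1
      by (auto intro!: derivative_eq_intros poly_DERIV[THEN DERIV_chain2] simp: flat_exp_def)
        (simp add: field_simps power2_eq_square)
    moreover have "\<forall>\<^sub>F y in nhds x. flat_exp p y = poly p (1 / y) * exp (- (1 / y))"
      using eventually_nhds_in_open[of "{0<..}" x] 1
      by (auto simp: flat_exp_def elim!: eventually_mono)
    ultimately show ?thesis
      by (rule DERIV_cong_ev[OF refl _ refl, THEN iffD2, rotated])
  next
    case 2
    have "((\<lambda>x. 0::real) has_real_derivative flat_exp ([:0,0,1:] * (p - pderiv p)) x) (at x)"
      using 2 by (simp add: flat_exp_def)
    moreover have "\<forall>\<^sub>F y in nhds x. flat_exp p y = 0"
      using eventually_nhds_in_open[of "{..<0}" x] 2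
      by (auto simp: flat_exp_def elim!: eventually_mono)
    ultimately show ?thesis
      by (rule DERIV_cong_ev[OF refl _ refl, THEN iffD2, rotated])
  next
    case 3
    have "((\<lambda>h. poly (pCons 0 p) (inverse h) * exp (- inverse h)) \<longlongrightarrow> 0) (at_right 0)"
      using filterlim_compose[OF poly_over_exp_tendsto_0 filterlim_inverse_at_top_right] .
    then have r: "((\<lambda>h. flat_exp p h / h) \<longlongrightarrow> 0) (at_right 0)"
      by (rule tendsto_cong[THEN iffD1, rotated])
        (auto simp: flat_exp_def eventually_at_filter field_simps)
    have l: "((\<lambda>h. flat_exp p h / h) \<longlongrightarrow> 0) (at_left 0)"
      by (rule tendsto_eventually) (auto simp: flat_exp_def eventually_at_filter)
    have "((\<lambda>h. flat_exp p h / h) \<longlongrightarrow> 0) (at 0)"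
      using l r by (simp add: filterlim_split_at_real)
    then show ?thesis
      unfolding 3 by (simp add: DERIV_def flat_exp_def)
  qed
qed

lemma smooth_flat_exp: "smooth (flat_exp p)"
proof (rule smooth_coinduct[where S = "range flat_exp"])
  have "deriv (flat_exp p) = flat_exp ([:0,0,1:] * (p - pderiv p))" for p
    using flat_exp_has_derivative DERIV_imp_deriv by blast
  then show "deriv g \<in> range flat_exp" if "g \<in> range flat_exp" for g
    using that by (metis imageE rangeI)
  show "g field_differentiable at s" if "g \<in> range flat_exp" for g s
    using that flat_exp_has_derivative field_differentiable_def by blast
qed simp

lemma smooth_isCont: "smooth f \<Longrightarrow> isCont f s"
  using smooth_differentiable field_differentiable_imp_continuous_at by blast

text \<open>The bump is the normalised product of \<open>exp (-1/x)\<close> and its reflection about \<open>1/2\<close>.\<close>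

lemma exists_bump:
  obtains \<eta> where "smooth \<eta>" "\<And>x. \<eta> x \<ge> 0" "\<And>x. x \<notin> {0<..<1} \<Longrightarrow> \<eta> x = 0"
    "integral {0..1} \<eta> = 1"
proof -
  define \<beta> where "\<beta> x = flat_exp 1 x * (1 * flat_exp 1 ((-1) * x + 1))" for x :: real
  have s: "smooth \<beta>"
    unfolding \<beta>_def by (intro smooth_mult smooth_scale_affine smooth_flat_exp)
  have nonneg: "\<beta> x \<ge> 0" for x
    by (simp add: \<beta>_def flat_exp_def)
  have zero: "\<beta> x = 0" if "x \<notin> {0<..<1}" for x
    using that by (auto simp: \<beta>_def flat_exp_def)
  have pos: "\<beta> (1/2) > 0"
    by (simp add: \<beta>_def flat_exp_def)
  have c: "continuous_on {0..1} \<beta>"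
    using smooth_isCont[OF s] continuous_at_imp_continuous_on by blast
  define I where "I = integral {0..1} \<beta>"
  have "I \<noteq> 0"
  proof
    assume "I = 0"
    then have "\<beta> (1/2) = 0"
      using integral_eq_0_iff[OF c] nonneg unfolding I_def by auto
    then show False using pos by simp
  qed
  moreover have "I \<ge> 0"
    unfolding I_def by (rule integral_nonneg) (use c nonneg integrable_continuous_real in auto)
  ultimately have I: "I > 0" by simp
  show thesis
  proof
    show "smooth (\<lambda>x. (1 / I) * \<beta> (1 * x + 0))"
      by (intro smooth_scale_affine s)
    show "integral {0..1} (\<lambda>x. (1 / I) * \<beta> (1 * x + 0)) = 1"
      using I by (simp add: I_def)
  qed (use nonneg zero I in auto)
qed

text \<open>Starting the integral at \<open>-1\<close>, to the left of the support, makes the formula differentiable at the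
  origin as well, and for \<open>x < -1\<close> the interval is empty and the value is still right.\<close>

lemma antiderivative_of_right_supported:
  fixes f :: "real \<Rightarrow> real"
  assumes f: "continuous_on UNIV f" and 0: "\<And>x. x \<le> 0 \<Longrightarrow> f x = 0"
  obtains F where "\<And>x. (F has_real_derivative f x) (at x)" "\<And>x. x \<le> 0 \<Longrightarrow> F x = 0"
    "F = (\<lambda>x. integral {-1..x} f)"
proof -
  define F where "F x = integral {-1..x} f" for x
  have F0: "F x = 0" if "x \<le> 0" for x
    unfolding F_def
    by (rule integral_unique, rule has_integral_eq[where f = "\<lambda>_. 0"]) (use 0 that in auto)
  have "(F has_real_derivative f x) (at x)" for x
  proof (cases "x < 0")
    case True
    have "((\<lambda>_. 0::real) has_real_derivative f x) (at x)"
      using 0 True by simp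
    moreover have "\<forall>\<^sub>F y in nhds x. F y = 0"
      using eventually_nhds_in_open[of "{..<0}" x] True F0 by (auto elim!: eventually_mono)
    ultimately show ?thesis
      by (rule DERIV_cong_ev[OF refl _ refl, THEN iffD2, rotated])
  next
    case False
    have "(F has_real_derivative f x) (at x within {-1..x+1})"
      unfolding F_def using False f
      by (intro integral_has_real_derivative) (auto intro: continuous_on_subset)
    then show ?thesis
      using False at_within_interior[of x "{-1..x+1}"] by simp
  qed
  then show thesis
    using that[of F] F0 F_def by blast
qed

text \<open>A smooth version of \<open>max x 0\<close>, obtained by integrating a bump \<open>\<eta>\<close> twice. Beyond the support of
  the bump it is affine of slope exactly one, so that suitable linear combinations of its translates
  have compact support.\<close>

lemma exists_smooth_ramp:
  assumes "\<epsilon> > 0"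
  obtains R \<eta> where "smooth R" "deriv (deriv R) = \<eta>" "\<And>x. \<eta> x \<ge> 0"
    "\<And>x. x \<notin> {0<..<\<epsilon>} \<Longrightarrow> \<eta> x = 0" "(\<eta> has_integral 1) {0..\<epsilon>}" "continuous_on UNIV \<eta>"
    "\<And>x. x \<le> 0 \<Longrightarrow> R x = 0"
    "\<And>x. \<bar>R x - max x 0\<bar> \<le> \<epsilon>" "\<And>x y. x \<ge> \<epsilon> \<Longrightarrow> y \<ge> \<epsilon> \<Longrightarrow> R y - R x = y - x"
proof -
  obtain \<beta> where b: "smooth \<beta>" "\<And>x. \<beta> x \<ge> 0" "\<And>x. x \<notin> {0<..<1} \<Longrightarrow> \<beta> x = 0"
    "integral {0..1} \<beta> = 1" using exists_bump by blast
  define \<eta> where "\<eta> x = (1/\<epsilon>) * \<beta> ((1/\<epsilon>) * x + 0)" for x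
  have s: "smooth \<eta>"
    unfolding \<eta>_def by (intro smooth_scale_affine b)
  have nonneg: "\<eta> x \<ge> 0" for x
    using b assms by (simp add: \<eta>_def)
  have zero: "\<eta> x = 0" if "x \<notin> {0<..<\<epsilon>}" for x
    using that b(3)[of "x / \<epsilon>"] assms by (auto simp: \<eta>_def field_simps)
  have cont: "continuous_on S \<eta>" for S
    using smooth_isCont[OF s] continuous_at_imp_continuous_on by blast
  have cb: "continuous_on S \<beta>" for S
    using smooth_isCont[OF b(1)] continuous_at_imp_continuous_on by blast
  have "(\<beta> has_integral 1) (cbox 0 1)"
    using integrable_integral[OF integrable_continuous_real[OF cb]] b(4) by (metis cbox_interval)
  then have int: "(\<eta> has_integral 1) {0..\<epsilon>}"
    using has_integral_affinity[of \<beta> 1 0 1 "1/\<epsilon>" 0] assms has_integral_mult_right[of _ \<epsilon> _ "1/\<epsilon>"]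
    by (auto simp: \<eta>_def[abs_def] image_affinity_atLeastAtMost)
  obtain A where A: "\<And>x. (A has_real_derivative \<eta> x) (at x)" "\<And>x. x \<le> 0 \<Longrightarrow> A x = 0"
    and A_int: "A = (\<lambda>x. integral {-1..x} \<eta>)"
    using antiderivative_of_right_supported[OF cont[of UNIV]] zero by auto
  have A_cont: "continuous_on UNIV A"
    using A(1) DERIV_isCont continuous_at_imp_continuous_on by blast
  have A_mono: "A x \<le> A y" if "x \<le> y" for x y
    using DERIV_nonneg_imp_nondecreasing[OF that] A(1) nonneg by blast
  have "A \<epsilon> = integral {-1..0} \<eta> + integral {0..\<epsilon>} \<eta>"
    unfolding A_int
    by (rule Henstock_Kurzweil_Integration.integral_combine[symmetric])
      (use assms cont integrable_continuous_real in auto)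
  also have "\<dots> = 1"
    using A(2)[of 0] int by (simp add: A_int integral_unique)
  finally have A_eps: "A \<epsilon> = 1" .
  have A_one: "A x = 1" if "x \<ge> \<epsilon>" for x
  proof (rule antisym)
    show "A x \<le> 1"
      using DERIV_nonpos_imp_nonincreasing[OF that, of A] A(1) zero A_eps by fastforce
    show "1 \<le> A x"
      using A_mono[OF that] A_eps by simp
  qed
  have A_le: "A x \<le> 1" for x
    using A_one[of "max x \<epsilon>"] A_mono[of x "max x \<epsilon>"] by simp
  have A_ge: "A x \<ge> 0" for x
    using A(2)[of "min x 0"] A_mono[of "min x 0" x] by simp
  obtain R where R: "\<And>x. (R has_real_derivative A x) (at x)" "\<And>x. x \<le> 0 \<Longrightarrow> R x = 0"
    using antiderivative_of_right_supported[OF A_cont] A(2) by metis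
  have up: "R y - R x \<ge> 0" if "x \<le> y" for x y
    using DERIV_nonneg_imp_nondecreasing[OF that, of R] R(1) A_ge by fastforce
  have up': "R y - R x \<le> y - x" if "x \<le> y" for x y
    using DERIV_nonneg_imp_nondecreasing[OF that, of "\<lambda>x. x - R x"] R(1) A_le
    by (force intro!: derivative_eq_intros)
  have eq: "R y - R x = y - x" if "\<epsilon> \<le> x" "x \<le> y" for x y
  proof (rule antisym[OF up'])
    have "\<exists>D. ((\<lambda>x. x - R x) has_real_derivative D) (at z) \<and> D \<le> 0" if "x \<le> z" for z
      using R(1)[of z] A_one[of z] that \<open>\<epsilon> \<le> x\<close> by (force intro!: derivative_eq_intros)
    then show "y - x \<le> R y - R x"
      using DERIV_nonpos_imp_nonincreasing[OF \<open>x \<le> y\<close>, of "\<lambda>x. x - R x"] by fastforce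
  qed (use that in simp)
  show thesis
  proof
    have "smooth A"
      using smooth_if_deriv_smooth[OF s A(1)] .
    then show "smooth R"
      using smooth_if_deriv_smooth R(1) by blast
    have "deriv R = A" "deriv A = \<eta>"
      using R(1) A(1) DERIV_imp_deriv by blast+
    then show "deriv (deriv R) = \<eta>" by simp
    show "\<bar>R x - max x 0\<bar> \<le> \<epsilon>" for x
    proof -
      consider "x \<le> 0" | "0 \<le> x" "x \<le> \<epsilon>" | "\<epsilon> \<le> x" by linarith
      then show ?thesis
        using R(2)[of 0] R(2)[of x] up[of 0 x] up'[of 0 x] up[of 0 \<epsilon>] up'[of 0 \<epsilon>] eq[of \<epsilon> x] assms
        by cases (auto simp: max_def)
    qed
    show "R y - R x = y - x" if "x \<ge> \<epsilon>" "y \<ge> \<epsilon>" for x y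
      using eq[of x y] eq[of y x] that by linarith
  qed (use nonneg zero int cont R(2) in auto)
qed


section \<open>Pairing a weak second derivative with tent functions\<close>

lemma absolutely_integrable_continuous_scaleR:
  fixes h :: "real \<Rightarrow> 'a::euclidean_space" and g :: "real \<Rightarrow> real"
  assumes "continuous_on {a..b} g" "h absolutely_integrable_on {a..b}"
  shows "(\<lambda>s. g s *\<^sub>R h s) absolutely_integrable_on {a..b}"
proof (rule absolutely_integrable_bounded_measurable_product[where h = scaleR])
  show "bilinear (\<lambda>x (y::'a). x *\<^sub>R y)"
    by (simp add: bilinear_conv_bounded_bilinear bounded_bilinear_scaleR)
  show "g \<in> borel_measurable (lebesgue_on {a..b})"
    using assms(1) by (intro continuous_imp_measurable_on_sets_lebesgue) auto
  show "bounded (g ` {a..b})"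
    using assms(1) compact_continuous_image compact_imp_bounded by blast
qed (use assms in auto)

lemma absolutely_integrable_on_superset:
  fixes g :: "'b::euclidean_space \<Rightarrow> 'a::euclidean_space"
  assumes "g absolutely_integrable_on S" "\<And>x. x \<notin> S \<Longrightarrow> g x = 0" "S \<subseteq> T"
  shows "g absolutely_integrable_on T"
proof -
  have "{x \<in> T - S. g x \<noteq> 0} = {}" "{x \<in> S - T. g x \<noteq> 0} = {}"
    using assms by auto
  then have "negligible {x \<in> T - S. g x \<noteq> 0}" "negligible {x \<in> S - T. g x \<noteq> 0}"
    by (metis negligible_empty)+
  then show ?thesis
    using absolutely_integrable_spike_set_eq assms(1) by blast
qed

lemma LINT_eq_integral_support:
  fixes g :: "real \<Rightarrow> 'a::euclidean_space"
  assumes g: "g absolutely_integrable_on {p..q}" and sub: "{p..q} \<subseteq> {0<..<L}"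
    and zero: "\<And>x. x \<notin> {p..q} \<Longrightarrow> g x = 0"
  shows "(LINT x:{0<..<L}|lebesgue. g x) = integral {p..q} g"
proof -
  have "g absolutely_integrable_on {0<..<L}"
    by (rule absolutely_integrable_on_superset[OF g zero sub])
  then have "(LINT x:{0<..<L}|lebesgue. g x) = integral {0<..<L} g"
    by (rule set_lebesgue_integral_eq_integral)
  also have "\<dots> = integral {p..q} g"
  proof (rule integral_unique, rule has_integral_on_superset)
    show "(g has_integral integral {p..q} g) {p..q}"
      using absolutely_integrable_on_def g by blast
  qed (use zero sub in auto)
  finally show ?thesis .
qed

text \<open>The bump lives to the right of the point, so only values of \<open>f\<close> on the right matter. This
  one-sidedness makes the lemma applicable to monotone functions before they are known to be continuous.\<close>

lemma mollified_right_limit: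
  fixes f :: "real \<Rightarrow> 'a::euclidean_space" and \<eta> :: "real \<Rightarrow> real"
  assumes f: "f absolutely_integrable_on {a..a+\<epsilon>}" and \<epsilon>: "\<epsilon> > 0"
    and \<eta>: "continuous_on UNIV \<eta>" "\<And>x. \<eta> x \<ge> 0" "\<And>x. x \<notin> {0<..<\<epsilon>} \<Longrightarrow> \<eta> x = 0"
    and int: "(\<eta> has_integral 1) {0..\<epsilon>}"
    and close: "\<And>s. a < s \<Longrightarrow> s < a + \<epsilon> \<Longrightarrow> norm (f s - v) \<le> \<delta>"
  shows "(\<lambda>s. \<eta> (s - a) *\<^sub>R f s) absolutely_integrable_on {a..a+\<epsilon>}"
    and "norm (integral {a..a+\<epsilon>} (\<lambda>s. \<eta> (s - a) *\<^sub>R f s) - v) \<le> \<delta>"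
proof -
  have cont: "continuous_on {a..a+\<epsilon>} (\<lambda>s. \<eta> (s - a))"
    by (rule continuous_on_compose2[OF \<eta>(1)]) (auto intro!: continuous_intros)
  show ai: "(\<lambda>s. \<eta> (s - a) *\<^sub>R f s) absolutely_integrable_on {a..a+\<epsilon>}"
    using absolutely_integrable_continuous_scaleR[OF cont f] .
  have int': "((\<lambda>s. \<eta> (s - a)) has_integral 1) {a..a+\<epsilon>}"
    using has_integral_affinity[of \<eta> 1 0 \<epsilon> 1 "- a"] int
    by (simp add: image_affinity_atLeastAtMost add.commute)
  have i1: "((\<lambda>s. \<eta> (s - a) *\<^sub>R f s - \<eta> (s - a) *\<^sub>R v) has_integral
      integral {a..a+\<epsilon>} (\<lambda>s. \<eta> (s - a) *\<^sub>R f s) - 1 *\<^sub>R v) {a..a+\<epsilon>}"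
    using ai absolutely_integrable_on_def int'
    by (intro has_integral_diff has_integral_scaleR_left) blast+
  have i2: "((\<lambda>s. \<eta> (s - a) * \<delta>) has_integral 1 * \<delta>) {a..a+\<epsilon>}"
    by (intro has_integral_mult_left int')
  have "norm (integral {a..a+\<epsilon>} (\<lambda>s. \<eta> (s - a) *\<^sub>R f s - \<eta> (s - a) *\<^sub>R v))
      \<le> integral {a..a+\<epsilon>} (\<lambda>s. \<eta> (s - a) * \<delta>)"
  proof (rule integral_norm_bound_integral)
    fix s assume "s \<in> {a..a+\<epsilon>}"
    show "norm (\<eta> (s - a) *\<^sub>R f s - \<eta> (s - a) *\<^sub>R v) \<le> \<eta> (s - a) * \<delta>"
    proof (cases "a < s \<and> s < a + \<epsilon>")
      case True
      then show ?thesis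
        using close[of s] \<eta>(2)[of "s - a"]
        by (simp flip: scaleR_diff_right add: mult_left_mono)
    next
      case False
      then have "s - a \<notin> {0<..<\<epsilon>}" by auto
      then show ?thesis
        using \<eta>(3) by simp
    qed
  qed (use i1 i2 in blast)+
  then show "norm (integral {a..a+\<epsilon>} (\<lambda>s. \<eta> (s - a) *\<^sub>R f s) - v) \<le> \<delta>"
    unfolding integral_unique[OF i1] integral_unique[OF i2] by simp
qed

text \<open>The combination of three ramps vanishes beyond \<open>c + \<epsilon>\<close> because the weights annihilate affine
  functions: this is what the two conditions on \<open>\<alpha>\<close> and \<open>\<beta>\<close> say.\<close>

lemma tent_test_function:
  fixes \<alpha> \<beta> :: real
  assumes R: "smooth R" "\<And>x. x \<le> 0 \<Longrightarrow> R x = 0"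
      "\<And>x y. x \<ge> \<epsilon> \<Longrightarrow> y \<ge> \<epsilon> \<Longrightarrow> R y - R x = y - x"
    and \<epsilon>: "\<epsilon> > 0" and ab: "0 < a" "a < b" "b < c" "c + \<epsilon> < L"
    and \<alpha>\<beta>: "\<alpha> + \<beta> = 1" "\<alpha> * a + \<beta> * c = b"
  defines "\<phi> \<equiv> \<lambda>x. \<alpha> * R (x - a) - R (x - b) + \<beta> * R (x - c)"
  shows "\<phi> \<in> test_functions L"
    and "(deriv ^^ 2) \<phi> = (\<lambda>x. \<alpha> * deriv (deriv R) (x - a) - deriv (deriv R) (x - b)
           + \<beta> * deriv (deriv R) (x - c))"
    and "\<And>x. x \<notin> {a..c+\<epsilon>} \<Longrightarrow> \<phi> x = 0"
    and "smooth \<phi>"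
proof -
  have R0: "(R has_real_derivative deriv R x) (at x)" for x
    using smooth_differentiable[OF R(1)] by (simp add: DERIV_deriv_iff_field_differentiable)
  have R1: "(deriv R has_real_derivative deriv (deriv R) x) (at x)" for x
    using smooth_differentiable[OF smooth_deriv[OF R(1)]]
    by (simp add: DERIV_deriv_iff_field_differentiable)
  have d: "((\<lambda>x. \<alpha> * f (x - a) - f (x - b) + \<beta> * f (x - c)) has_real_derivative
      \<alpha> * f' (x - a) - f' (x - b) + \<beta> * f' (x - c)) (at x)"
    if "\<And>x. (f has_real_derivative f' x) (at x)" for f f' x
  proof -
    have "((\<lambda>x. x - d) has_real_derivative 1) (at x)" for d :: real
      by (auto intro!: derivative_eq_intros)
    from DERIV_chain2[OF that this]
    have "((\<lambda>x. f (x - d)) has_real_derivative f' (x - d)) (at x)" for d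
      by simp
    then show ?thesis
      by (auto intro!: derivative_eq_intros)
  qed
  have "deriv \<phi> = (\<lambda>x. \<alpha> * deriv R (x - a) - deriv R (x - b) + \<beta> * deriv R (x - c))"
    unfolding \<phi>_def using d[OF R0] DERIV_imp_deriv by blast
  moreover have "deriv (\<lambda>x. \<alpha> * deriv R (x - a) - deriv R (x - b) + \<beta> * deriv R (x - c))
      = (\<lambda>x. \<alpha> * deriv (deriv R) (x - a) - deriv (deriv R) (x - b) + \<beta> * deriv (deriv R) (x - c))"
    using d[OF R1] DERIV_imp_deriv by blast
  ultimately show "(deriv ^^ 2) \<phi> = (\<lambda>x. \<alpha> * deriv (deriv R) (x - a) - deriv (deriv R) (x - b)
           + \<beta> * deriv (deriv R) (x - c))"
    by (simp add: numeral_2_eq_2)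
  show supp: "\<phi> x = 0" if "x \<notin> {a..c+\<epsilon>}" for x
  proof (cases "x < a")
    case True
    then show ?thesis
      using ab by (simp add: \<phi>_def R(2))
  next
    case False
    then have "x > c + \<epsilon>" using that by auto
    then have "R (x - a) = R \<epsilon> - \<epsilon> + (x - a)" "R (x - b) = R \<epsilon> - \<epsilon> + (x - b)"
      "R (x - c) = R \<epsilon> - \<epsilon> + (x - c)"
      using R(3)[of \<epsilon> "x - a"] R(3)[of \<epsilon> "x - b"] R(3)[of \<epsilon> "x - c"] ab by auto
    then have "\<phi> x = (\<alpha> + \<beta> - 1) * (R \<epsilon> - \<epsilon> + x) - (\<alpha> * a + \<beta> * c - b)"
      unfolding \<phi>_def by algebra
    then show ?thesis
      using \<alpha>\<beta> by simp
  qed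
  have "smooth (\<lambda>x. \<alpha> * R (1 * x + - a) + (-1) * R (1 * x + - b) + \<beta> * R (1 * x + - c))"
    by (intro smooth_add smooth_scale_affine R)
  then show "smooth \<phi>"
    by (simp add: \<phi>_def)
  moreover have "compact {a..c+\<epsilon>}" "{a..c+\<epsilon>} \<subseteq> {0<..<L}"
    using ab \<epsilon> by auto
  ultimately show "\<phi> \<in> test_functions L"
    unfolding test_functions_def smooth_def using supp by blast
qed

text \<open>The limiting tent function is the Green function of the second derivative on \<open>[a, c]\<close> with pole \<open>b\<close>,
  up to sign.\<close>

lemma tent_integral:
  fixes h :: "real \<Rightarrow> 'a::euclidean_space"
  assumes h: "h absolutely_integrable_on {a..d}" and ab: "a < b" "b < c" "c \<le> d"
    and \<alpha>\<beta>: "\<alpha> + \<beta> = 1" "\<alpha> * a + \<beta> * c = b"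
  shows "integral {a..d} (\<lambda>r. (\<alpha> * max (r - a) 0 - max (r - b) 0 + \<beta> * max (r - c) 0) *\<^sub>R h r)
    = \<alpha> *\<^sub>R integral {a..c} (\<lambda>r. (r - a) *\<^sub>R h r) - integral {b..c} (\<lambda>r. (r - b) *\<^sub>R h r)"
    (is "integral _ ?k = _")
proof -
  have k0: "?k r = 0" if "r \<ge> c" for r
  proof -
    have "\<alpha> * max (r - a) 0 - max (r - b) 0 + \<beta> * max (r - c) 0
        = (\<alpha> + \<beta> - 1) * r - (\<alpha> * a + \<beta> * c - b)"
      using that ab by (simp add: algebra_simps)
    then show ?thesis using \<alpha>\<beta> by simp
  qed
  have sub: "(\<lambda>r. (r - x) *\<^sub>R h r) integrable_on {x..c}" if "a \<le> x" for x
    using that absolutely_integrable_on_subinterval[OF h, of x c] ab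
    by (intro set_lebesgue_integral_eq_integral(1) absolutely_integrable_continuous_scaleR)
      (auto intro!: continuous_intros)
  have "((\<lambda>r. if r \<in> {b..c} then (r - b) *\<^sub>R h r else 0) has_integral
      integral {b..c} (\<lambda>r. (r - b) *\<^sub>R h r)) {a..c}"
    using sub[of b] ab by (subst has_integral_restrict) auto
  then have "((\<lambda>r. \<alpha> *\<^sub>R (r - a) *\<^sub>R h r - (if r \<in> {b..c} then (r - b) *\<^sub>R h r else 0)) has_integral
     \<alpha> *\<^sub>R integral {a..c} (\<lambda>r. (r - a) *\<^sub>R h r) - integral {b..c} (\<lambda>r. (r - b) *\<^sub>R h r)) {a..c}"
    using sub[of a] by (intro has_integral_diff has_integral_cmul) auto
  then have "(?k has_integral
     \<alpha> *\<^sub>R integral {a..c} (\<lambda>r. (r - a) *\<^sub>R h r) - integral {b..c} (\<lambda>r. (r - b) *\<^sub>R h r)) {a..c}"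
    by (rule has_integral_eq[rotated]) (auto simp: max_def scaleR_diff_left scaleR_diff_right algebra_simps)
  then have "((\<lambda>r. if r \<in> {a..c} then ?k r else 0) has_integral
     \<alpha> *\<^sub>R integral {a..c} (\<lambda>r. (r - a) *\<^sub>R h r) - integral {b..c} (\<lambda>r. (r - b) *\<^sub>R h r)) {a..d}"
    using ab by (subst has_integral_restrict) auto
  then have "(?k has_integral
     \<alpha> *\<^sub>R integral {a..c} (\<lambda>r. (r - a) *\<^sub>R h r) - integral {b..c} (\<lambda>r. (r - b) *\<^sub>R h r)) {a..d}"
  proof (rule has_integral_eq[rotated])
    fix r assume r: "r \<in> {a..d}"
    show "(if r \<in> {a..c} then ?k r else 0) = ?k r"
    proof (cases "r \<in> {a..c}")
      case False
      then have "c \<le> r" using r by auto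
      from k0[OF this] show ?thesis by (simp only: if_cancel)
    qed simp
  qed
  then show ?thesis
    by (rule integral_unique)
qed

text \<open>Testing with a smooth tent turns \<open>\<integral> \<phi>'' f\<close> into averages of \<open>f\<close> immediately to the right of
  \<open>a\<close>, \<open>b\<close>, \<open>c\<close>. Letting the width of the bumps shrink expresses \<open>F b\<close> through \<open>F a\<close>, \<open>F c\<close> and an
  integral of \<open>h\<close>.\<close>

lemma three_point_formula:
  fixes f h :: "real \<Rightarrow> 'a::euclidean_space"
  assumes weak: "weak_derivative 2 L f h"
    and lim: "\<And>t. 0 < t \<Longrightarrow> t < L \<Longrightarrow> (f \<longlongrightarrow> F t) (at_right t)"
    and ab: "0 < a" "a < b" "b < c" "c < L"
    and \<alpha>\<beta>: "\<alpha> + \<beta> = 1" "\<alpha> * a + \<beta> * c = b"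
  shows "\<alpha> *\<^sub>R F a - F b + \<beta> *\<^sub>R F c =
    \<alpha> *\<^sub>R integral {a..c} (\<lambda>r. (r - a) *\<^sub>R h r) - integral {b..c} (\<lambda>r. (r - b) *\<^sub>R h r)"
proof -
  define d where "d = (c + L) / 2"
  have d: "c < d" "d < L" using ab by (auto simp: d_def)
  have "compact {a..d}" "{a..d} \<subseteq> {0<..<L}" using ab d by auto
  then have "f absolutely_integrable_on {a..d}" and h: "h absolutely_integrable_on {a..d}"
    using weak unfolding weak_derivative_def locally_integrable_def by blast+
  then have fi: "f absolutely_integrable_on {x..y}" if "a \<le> x" "y \<le> d" for x y
    using absolutely_integrable_on_subinterval that by fastforce
  define T where "T r = \<alpha> * max (r - a) 0 - max (r - b) 0 + \<beta> * max (r - c) 0" for r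
  define X where "X = \<alpha> *\<^sub>R F a - F b + \<beta> *\<^sub>R F c"
  define Y where "Y = integral {a..d} (\<lambda>r. T r *\<^sub>R h r)"
  define C where "C = \<bar>\<alpha>\<bar> + 1 + \<bar>\<beta>\<bar>"
  define D where "D = integral {a..d} (\<lambda>r. norm (h r))"
  have C: "C > 0" by (simp add: C_def add_nonneg_pos add_pos_nonneg)
  have D: "D \<ge> 0" unfolding D_def by (rule Henstock_Kurzweil_Integration.integral_nonneg)
      (use h in \<open>auto simp: absolutely_integrable_on_def\<close>)
  (* The first error comes from replacing f near the three points by its right limits, the second from
     replacing the smooth tent by its limit T. *)
  have key: "norm (X - Y) \<le> C * \<delta> + C * \<delta> * D" if \<delta>: "\<delta> > 0" for \<delta>
  proof -
    have ev: "\<forall>\<^sub>F e in at_right 0. \<forall>s. t < s \<longrightarrow> s < t + e \<longrightarrow> norm (f s - F t) \<le> \<delta>"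
      if t: "0 < t" "t < L" for t
    proof -
      have "\<forall>\<^sub>F s in at_right t. dist (f s) (F t) < \<delta>"
        using lim[OF t] \<delta> tendstoD by blast
      then obtain u where u: "u > t" "\<And>s. t < s \<Longrightarrow> s < u \<Longrightarrow> dist (f s) (F t) < \<delta>"
        by (auto simp: eventually_at_right_field)
      have "\<forall>\<^sub>F e in at_right 0. e < u - t"
        using u(1) by (auto simp: eventually_at_right_field intro!: exI[of _ "u - t"])
      then show ?thesis
        by eventually_elim (use u(2) in \<open>fastforce simp: dist_norm\<close>)
    qed
    have "\<forall>\<^sub>F e in at_right 0. e < min \<delta> (d - c) \<and> 0 < (e::real)"
      using \<delta> d by (auto simp: eventually_at_right_field intro!: exI[of _ "min \<delta> (d - c)"])
    note small = this
    have "\<forall>\<^sub>F e in at_right 0. (e < min \<delta> (d - c) \<and> 0 < e) \<and>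
        (\<forall>s. a < s \<longrightarrow> s < a + e \<longrightarrow> norm (f s - F a) \<le> \<delta>) \<and>
        (\<forall>s. b < s \<longrightarrow> s < b + e \<longrightarrow> norm (f s - F b) \<le> \<delta>) \<and>
        (\<forall>s. c < s \<longrightarrow> s < c + e \<longrightarrow> norm (f s - F c) \<le> \<delta>)"
      by (intro small eventually_conj ev) (use ab in auto)
    from eventually_happens'[OF trivial_limit_at_right_real this]
    obtain \<epsilon> where 1: "\<epsilon> < min \<delta> (d - c)" "0 < \<epsilon>"
      and close: "\<forall>s. a < s \<longrightarrow> s < a + \<epsilon> \<longrightarrow> norm (f s - F a) \<le> \<delta>"
        "\<forall>s. b < s \<longrightarrow> s < b + \<epsilon> \<longrightarrow> norm (f s - F b) \<le> \<delta>"
        "\<forall>s. c < s \<longrightarrow> s < c + \<epsilon> \<longrightarrow> norm (f s - F c) \<le> \<delta>"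
      by (elim exE conjE)
    then have \<epsilon>: "\<epsilon> > 0" "\<epsilon> < \<delta>" "\<epsilon> < d - c"
      by auto
    obtain R \<eta> where R: "smooth R" and dR: "deriv (deriv R) = \<eta>"
      and \<eta>: "\<And>x. \<eta> x \<ge> 0" "\<And>x. x \<notin> {0<..<\<epsilon>} \<Longrightarrow> \<eta> x = 0" "(\<eta> has_integral 1) {0..\<epsilon>}"
        "continuous_on UNIV \<eta>"
      and R': "\<And>x. x \<le> 0 \<Longrightarrow> R x = 0" "\<And>x. \<bar>R x - max x 0\<bar> \<le> \<epsilon>"
        "\<And>x y. x \<ge> \<epsilon> \<Longrightarrow> y \<ge> \<epsilon> \<Longrightarrow> R y - R x = y - x"
      by (rule exists_smooth_ramp[OF \<epsilon>(1)]) (rule that)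
    define \<phi> where "\<phi> x = \<alpha> * R (x - a) - R (x - b) + \<beta> * R (x - c)" for x
    have "c + \<epsilon> < L" using \<epsilon> d by simp
    note tent = tent_test_function[OF R R'(1,3) \<epsilon>(1) ab(1-3) this \<alpha>\<beta>,
        folded \<phi>_def[abs_def], unfolded dR]
    have eq: "(LINT s:{0<..<L}|lebesgue. (deriv ^^ 2) \<phi> s *\<^sub>R f s) =
        (LINT s:{0<..<L}|lebesgue. \<phi> s *\<^sub>R h s)"
      using weak tent(1) by (auto simp: weak_derivative_def)
    define J where "J x = integral {x..x+\<epsilon>} (\<lambda>s. \<eta> (s - x) *\<^sub>R f s)" for x
    have bump: "(\<lambda>s. \<eta> (s - x) *\<^sub>R f s) absolutely_integrable_on {x..x+\<epsilon>}"
       "norm (J x - F x) \<le> \<delta>" if "x \<in> {a,b,c}" for x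
    proof -
      have "f absolutely_integrable_on {x..x+\<epsilon>}"
        using that ab \<epsilon> by (intro fi) auto
      from mollified_right_limit[OF this \<epsilon>(1) \<eta>(4,1-3), of "F x" \<delta>]
      show "(\<lambda>s. \<eta> (s - x) *\<^sub>R f s) absolutely_integrable_on {x..x+\<epsilon>}" "norm (J x - F x) \<le> \<delta>"
        using close that unfolding J_def by blast+
    qed
    have bump_int: "((\<lambda>s. \<eta> (s - x) *\<^sub>R f s) has_integral J x) {a..d}"
      "(\<lambda>s. \<eta> (s - x) *\<^sub>R f s) absolutely_integrable_on {a..d}"
       if x: "x \<in> {a,b,c}" for x
    proof -
      have 0: "\<eta> (s - x) *\<^sub>R f s = 0" if "s \<notin> {x..x+\<epsilon>}" for s
        using that \<eta>(2) by auto
      have sub: "{x..x+\<epsilon>} \<subseteq> {a..d}" using x ab \<epsilon> by auto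
      have "((\<lambda>s. \<eta> (s - x) *\<^sub>R f s) has_integral J x) {x..x+\<epsilon>}"
        using bump(1)[OF x] unfolding J_def absolutely_integrable_on_def by blast
      from has_integral_on_superset[OF this 0 sub]
      show "((\<lambda>s. \<eta> (s - x) *\<^sub>R f s) has_integral J x) {a..d}" by blast
      show "(\<lambda>s. \<eta> (s - x) *\<^sub>R f s) absolutely_integrable_on {a..d}"
        by (rule absolutely_integrable_on_superset[OF bump(1)[OF x] 0 sub])
    qed
    have expand: "(deriv ^^ 2) \<phi> s *\<^sub>R f s =
        \<alpha> *\<^sub>R \<eta> (s - a) *\<^sub>R f s - \<eta> (s - b) *\<^sub>R f s + \<beta> *\<^sub>R \<eta> (s - c) *\<^sub>R f s" for s
      by (simp add: tent(2) algebra_simps)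
    have L: "(LINT s:{0<..<L}|lebesgue. (deriv ^^ 2) \<phi> s *\<^sub>R f s) = \<alpha> *\<^sub>R J a - J b + \<beta> *\<^sub>R J c"
    proof -
      have "((\<lambda>s. (deriv ^^ 2) \<phi> s *\<^sub>R f s) has_integral \<alpha> *\<^sub>R J a - J b + \<beta> *\<^sub>R J c) {a..d}"
        unfolding expand
        by (intro has_integral_add has_integral_diff has_integral_cmul bump_int) auto
      moreover have "(\<lambda>s. (deriv ^^ 2) \<phi> s *\<^sub>R f s) absolutely_integrable_on {a..d}"
        unfolding expand
        by (intro set_integral_add(1) set_integral_diff(1) absolutely_integrable_scaleR_left bump_int) auto
      moreover have "(deriv ^^ 2) \<phi> s *\<^sub>R f s = 0" if "s \<notin> {a..d}" for s
        unfolding expand using that ab \<epsilon> \<eta>(2) by auto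
      ultimately show ?thesis
        using LINT_eq_integral_support[where g = "\<lambda>s. (deriv ^^ 2) \<phi> s *\<^sub>R f s" and p = a and q = d and L = L] ab d
        by (simp add: integral_unique subset_eq)
    qed
    have \<phi>_cont: "continuous_on {a..d} \<phi>"
      using smooth_isCont[OF tent(4)] continuous_at_imp_continuous_on by blast
    have T_cont: "continuous_on {a..d} T"
      unfolding T_def by (intro continuous_intros)
    have Rt: "(LINT s:{0<..<L}|lebesgue. \<phi> s *\<^sub>R h s) = integral {a..d} (\<lambda>s. \<phi> s *\<^sub>R h s)"
    proof (rule LINT_eq_integral_support)
      show "(\<lambda>s. \<phi> s *\<^sub>R h s) absolutely_integrable_on {a..d}"
        by (intro absolutely_integrable_continuous_scaleR \<phi>_cont h)
      show "\<phi> s *\<^sub>R h s = 0" if "s \<notin> {a..d}" for s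
        unfolding \<phi>_def using tent(3)[of s] that \<epsilon> by auto
    qed (use ab d in auto)
    have "norm (integral {a..d} (\<lambda>s. \<phi> s *\<^sub>R h s) - Y) \<le> C * \<epsilon> * D"
    proof -
      have i: "(\<lambda>s. \<phi> s *\<^sub>R h s) integrable_on {a..d}" "(\<lambda>s. T s *\<^sub>R h s) integrable_on {a..d}"
        by (intro set_lebesgue_integral_eq_integral(1) absolutely_integrable_continuous_scaleR
            \<phi>_cont T_cont h)+
      have "integral {a..d} (\<lambda>s. \<phi> s *\<^sub>R h s) - Y = integral {a..d} (\<lambda>s. \<phi> s *\<^sub>R h s - T s *\<^sub>R h s)"
        unfolding Y_def using i by (simp add: Henstock_Kurzweil_Integration.integral_diff)
      also have "norm \<dots> \<le> integral {a..d} (\<lambda>s. C * \<epsilon> * norm (h s))"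
      proof (rule integral_norm_bound_integral)
        show "(\<lambda>s. \<phi> s *\<^sub>R h s - T s *\<^sub>R h s) integrable_on {a..d}"
          using i by (rule integrable_diff)
        show "(\<lambda>s. C * \<epsilon> * norm (h s)) integrable_on {a..d}"
          using h unfolding absolutely_integrable_on_def by (intro integrable_on_mult_right) blast
        fix s
        define u v w where "u = R (s - a) - max (s - a) 0" and "v = R (s - b) - max (s - b) 0"
          and "w = R (s - c) - max (s - c) 0"
        have uvw: "\<bar>u\<bar> \<le> \<epsilon>" "\<bar>v\<bar> \<le> \<epsilon>" "\<bar>w\<bar> \<le> \<epsilon>"
          unfolding u_def v_def w_def by (rule R'(2))+
        have "\<phi> s - T s = \<alpha> * u - v + \<beta> * w"
          by (simp add: \<phi>_def T_def u_def v_def w_def algebra_simps)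
        also have "\<bar>\<dots>\<bar> \<le> \<bar>\<alpha> * u\<bar> + \<bar>v\<bar> + \<bar>\<beta> * w\<bar>"
          by linarith
        also have "\<dots> \<le> \<bar>\<alpha>\<bar> * \<epsilon> + \<epsilon> + \<bar>\<beta>\<bar> * \<epsilon>"
          unfolding abs_mult by (intro add_mono mult_left_mono uvw) auto
        finally have "\<bar>\<phi> s - T s\<bar> \<le> C * \<epsilon>"
          by (simp add: C_def algebra_simps)
        then show "norm (\<phi> s *\<^sub>R h s - T s *\<^sub>R h s) \<le> C * \<epsilon> * norm (h s)"
          by (simp flip: scaleR_diff_left add: mult_right_mono)
      qed
      finally show ?thesis by (simp add: D_def)
    qed
    also have "\<dots> \<le> C * \<delta> * D"
      using C D \<epsilon> by (intro mult_right_mono mult_left_mono) auto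
    finally have 1: "norm (\<alpha> *\<^sub>R J a - J b + \<beta> *\<^sub>R J c - Y) \<le> C * \<delta> * D"
      using eq L Rt by simp
    have "(\<alpha> *\<^sub>R J a - J b + \<beta> *\<^sub>R J c) - X = \<alpha> *\<^sub>R (J a - F a) - (J b - F b) + \<beta> *\<^sub>R (J c - F c)"
      by (simp add: X_def algebra_simps)
    also have "norm \<dots> \<le> norm (\<alpha> *\<^sub>R (J a - F a)) + norm (J b - F b) + norm (\<beta> *\<^sub>R (J c - F c))"
      by (meson norm_triangle_ineq norm_triangle_ineq4 add_right_mono order_trans)
    also have "\<dots> \<le> \<bar>\<alpha>\<bar> * \<delta> + \<delta> + \<bar>\<beta>\<bar> * \<delta>"
      using bump(2) by (auto intro!: add_mono mult_left_mono)
    finally have 2: "norm ((\<alpha> *\<^sub>R J a - J b + \<beta> *\<^sub>R J c) - X) \<le> C * \<delta>"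
      by (simp add: C_def algebra_simps)
    show ?thesis
      using norm_triangle_ineq4[of "\<alpha> *\<^sub>R J a - J b + \<beta> *\<^sub>R J c - Y" "\<alpha> *\<^sub>R J a - J b + \<beta> *\<^sub>R J c - X"] 1 2
      by simp
  qed
  have "norm (X - Y) \<le> e" if "e > 0" for e
  proof -
    have p: "C + C * D > 0" using C D by (simp add: add_pos_nonneg)
    then have "e / (C + C * D) > 0" using that by simp
    from key[OF this] have "norm (X - Y) \<le> (C + C * D) * (e / (C + C * D))"
      by (simp only: distrib_right mult_ac)
    then show ?thesis
      using p by simp
  qed
  then have "norm (X - Y) \<le> 0"
    using field_le_epsilon[of "norm (X - Y)" 0] by simp
  then have "X = Y"
    by simp
  then show ?thesis
    unfolding X_def Y_def T_def unfolding tent_integral[OF h ab(2,3) less_imp_le[OF d(1)] \<alpha>\<beta>] .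
qed


section \<open>Regularity from a weak second derivative\<close>

text \<open>Formally this is differentiation under the integral sign, with vanishing boundary contribution because
  of the weight \<open>r - b\<close>. As \<open>h\<close> is only integrable, the difference quotient is estimated by hand: the
  error is at most \<open>2 \<bar>y - x\<bar>\<close> times the integral of \<open>norm h\<close> between the two points.\<close>

lemma weighted_tail_has_derivative:
  fixes h :: "real \<Rightarrow> 'a::euclidean_space"
  assumes h: "h absolutely_integrable_on {a..c}" and x: "a < x" "x < c"
  shows "((\<lambda>b. integral {b..c} (\<lambda>r. (r - b) *\<^sub>R h r)) has_vector_derivative
           - integral {x..c} h) (at x)"
proof -
  define Q where "Q b = integral {b..c} (\<lambda>r. (r - b) *\<^sub>R h r)" for b
  define N where "N b = integral {a..b} (\<lambda>r. norm (h r))" for b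
  have hi: "h absolutely_integrable_on {s..t}" if "a \<le> s" "t \<le> c" for s t
    using absolutely_integrable_on_subinterval[OF h] that by simp
  have hI: "h integrable_on {s..t}" "(\<lambda>r. norm (h r)) integrable_on {s..t}" if "a \<le> s" "t \<le> c" for s t
    using hi[OF that] unfolding absolutely_integrable_on_def by blast+
  have wI: "(\<lambda>r. (r - b) *\<^sub>R h r) integrable_on {s..t}" if "a \<le> s" "t \<le> c" for b s t
    by (intro set_lebesgue_integral_eq_integral(1) absolutely_integrable_continuous_scaleR hi that)
      (auto intro!: continuous_intros)
  have Q_shift: "Q s - Q t - (t - s) *\<^sub>R integral {t..c} h = integral {s..t} (\<lambda>r. (r - s) *\<^sub>R h r)"
    if st: "a \<le> s" "s \<le> t" "t \<le> c" for s t
  proof -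
    have "Q s = integral {s..t} (\<lambda>r. (r - s) *\<^sub>R h r) + integral {t..c} (\<lambda>r. (r - s) *\<^sub>R h r)"
      unfolding Q_def using st
      by (intro Henstock_Kurzweil_Integration.integral_combine[symmetric] wI) auto
    also have "integral {t..c} (\<lambda>r. (r - s) *\<^sub>R h r) =
        integral {t..c} (\<lambda>r. (r - t) *\<^sub>R h r + (t - s) *\<^sub>R h r)"
      by (simp flip: scaleR_add_left)
    also have "\<dots> = Q t + (t - s) *\<^sub>R integral {t..c} h"
      unfolding Q_def using st
      by (subst Henstock_Kurzweil_Integration.integral_add) (auto intro!: wI hI integrable_cmul)
    finally show ?thesis by simp
  qed
  have small: "norm (integral {s..t} (\<lambda>r. (r - s) *\<^sub>R h r)) \<le> (t - s) * (N t - N s)"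
    "norm (integral {s..t} h) \<le> N t - N s"
    if st: "a \<le> s" "s \<le> t" "t \<le> c" for s t
  proof -
    have N: "N t - N s = integral {s..t} (\<lambda>r. norm (h r))"
      unfolding N_def using st
      by (subst Henstock_Kurzweil_Integration.integral_combine[of a s t, symmetric]) (auto intro!: hI)
    have "norm (integral {s..t} (\<lambda>r. (r - s) *\<^sub>R h r)) \<le> integral {s..t} (\<lambda>r. (t - s) * norm (h r))"
    proof (rule integral_norm_bound_integral)
      show "(\<lambda>r. (t - s) * norm (h r)) integrable_on {s..t}"
        using st by (intro integrable_on_mult_right hI) auto
      show "norm ((r - s) *\<^sub>R h r) \<le> (t - s) * norm (h r)" if "r \<in> {s..t}" for r
        using that by (auto intro!: mult_right_mono)
    qed (use st in \<open>auto intro!: wI\<close>)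
    then show "norm (integral {s..t} (\<lambda>r. (r - s) *\<^sub>R h r)) \<le> (t - s) * (N t - N s)"
      by (simp add: N)
    show "norm (integral {s..t} h) \<le> N t - N s"
      unfolding N using st by (intro integral_norm_bound_integral hI) auto
  qed
  have bound: "norm (Q y - Q x - (y - x) *\<^sub>R - integral {x..c} h) \<le> 2 * \<bar>y - x\<bar> * \<bar>N y - N x\<bar>"
    if y: "a \<le> y" "y \<le> c" for y
  proof (cases "x \<le> y")
    case True
    have *: "integral {x..c} h = integral {x..y} h + integral {y..c} h"
      using True x y by (intro Henstock_Kurzweil_Integration.integral_combine[symmetric] hI) auto
    have "Q y - Q x - (y - x) *\<^sub>R - integral {x..c} h =
        (y - x) *\<^sub>R integral {x..y} h - integral {x..y} (\<lambda>r. (r - x) *\<^sub>R h r)"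
      unfolding * using Q_shift[of x y] True x y by (simp add: algebra_simps)
    also have "norm \<dots> \<le> norm ((y - x) *\<^sub>R integral {x..y} h)
        + norm (integral {x..y} (\<lambda>r. (r - x) *\<^sub>R h r))"
      by (rule norm_triangle_ineq4)
    also have "\<dots> \<le> (y - x) * (N y - N x) + (y - x) * (N y - N x)"
    proof (rule add_mono)
      show "norm (integral {x..y} (\<lambda>r. (r - x) *\<^sub>R h r)) \<le> (y - x) * (N y - N x)"
        using small(1)[of x y] True x y by simp
      show "norm ((y - x) *\<^sub>R integral {x..y} h) \<le> (y - x) * (N y - N x)"
        using mult_left_mono[OF small(2)[of x y], of "y - x"] True x y by simp
    qed
    also have "\<dots> \<le> 2 * \<bar>y - x\<bar> * \<bar>N y - N x\<bar>"
      by (metis (no_types) abs_ge_self abs_mult mult.assoc mult_2 add_mono)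
    finally show ?thesis .
  next
    case False
    have "Q y - Q x - (y - x) *\<^sub>R - integral {x..c} h = integral {y..x} (\<lambda>r. (r - y) *\<^sub>R h r)"
      using Q_shift[of y x] False x y by (simp add: algebra_simps)
    also have "norm \<dots> \<le> (x - y) * (N x - N y)"
      using small(1)[of y x] False x y by simp
    also have "\<dots> \<le> \<bar>y - x\<bar> * \<bar>N y - N x\<bar>"
      by (metis (no_types) abs_ge_self abs_mult abs_minus_commute)
    also have "\<dots> \<le> 2 * \<bar>y - x\<bar> * \<bar>N y - N x\<bar>"
      by simp
    finally show ?thesis .
  qed
  have "isCont N x"
  proof -
    have "continuous_on {a..c} N"
      unfolding N_def by (rule indefinite_integral_continuous_1) (rule hI, auto)
    then show ?thesis
      using x continuous_on_interior[of "{a..c}" N x] by simp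
  qed
  then have "((\<lambda>y. 2 * \<bar>N y - N x\<bar>) \<longlongrightarrow> 2 * \<bar>N x - N x\<bar>) (at x)"
    unfolding isCont_def by (intro tendsto_intros)
  then have lim: "((\<lambda>y. 2 * \<bar>N y - N x\<bar>) \<longlongrightarrow> 0) (at x)" by simp
  have "(Q has_vector_derivative - integral {x..c} h) (at x)"
    unfolding has_vector_derivative_def
  proof (rule has_derivativeI_sandwich[OF _ _ _ lim])
    show "min (x - a) (c - x) > 0" using x by simp
    show "bounded_linear (\<lambda>z. z *\<^sub>R - integral {x..c} h)"
      by (rule bounded_linear_scaleR_left)
    fix y assume y: "y \<noteq> x" "dist y x < min (x - a) (c - x)"
    then have "a \<le> y" "y \<le> c" by (auto simp: dist_real_def)
    from bound[OF this] y(1)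
    show "norm (Q y - Q x - (y - x) *\<^sub>R - integral {x..c} h) / norm (y - x) \<le> 2 * \<bar>N y - N x\<bar>"
      by (simp add: divide_le_eq mult_ac)
  qed
  then show ?thesis
    unfolding Q_def .
qed

text \<open>With \<open>a\<close> and \<open>c\<close> fixed and \<open>b\<close> variable, the three-point formula writes \<open>F\<close> on \<open>(a, c)\<close> as an affine
  function plus a weighted tail of \<open>h\<close>, and this can be differentiated.\<close>

lemma weak_second_derivative_imp_C1:
  fixes f h :: "real \<Rightarrow> 'a::euclidean_space"
  assumes weak: "weak_derivative 2 L f h"
    and lim: "\<And>t. 0 < t \<Longrightarrow> t < L \<Longrightarrow> (f \<longlongrightarrow> F t) (at_right t)"
  obtains D where "\<And>t. 0 < t \<Longrightarrow> t < L \<Longrightarrow> (F has_vector_derivative D t) (at t)"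
    and "\<And>s t. 0 < s \<Longrightarrow> s \<le> t \<Longrightarrow> t < L \<Longrightarrow> D t - D s = integral {s..t} h"
proof -
  have hi: "h absolutely_integrable_on {s..t}" if "0 < s" "t < L" for s t
  proof -
    have "compact {s..t}" "{s..t} \<subseteq> {0<..<L}" using that by auto
    then show ?thesis
      using weak unfolding weak_derivative_def locally_integrable_def by blast
  qed
  have hI: "h integrable_on {s..t}" if "0 < s" "t < L" for s t
    using hi[OF that] unfolding absolutely_integrable_on_def by blast
  have local: "\<exists>A. \<forall>t\<in>{a<..<c}. (F has_vector_derivative A - integral {t..c} h) (at t)"
    if ac: "0 < a" "a < c" "c < L" for a c
  proof -
    define Z where "Z = F a - integral {a..c} (\<lambda>r. (r - a) *\<^sub>R h r)"
    define m where "m = inverse (c - a)"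
    have m: "m * (c - a) = 1" using ac by (simp add: m_def)
    define G where "G b = ((c - b) * m) *\<^sub>R Z + ((b - a) * m) *\<^sub>R F c
        + integral {b..c} (\<lambda>r. (r - b) *\<^sub>R h r)" for b
    have FG: "F b = G b" if b: "a < b" "b < c" for b
    proof -
      have s: "(c - b) * m + (b - a) * m = 1" "(c - b) * m * a + (b - a) * m * c = b"
        using m by algebra+
      have "((c - b) * m) *\<^sub>R F a - F b + ((b - a) * m) *\<^sub>R F c =
          ((c - b) * m) *\<^sub>R integral {a..c} (\<lambda>r. (r - a) *\<^sub>R h r) - integral {b..c} (\<lambda>r. (r - b) *\<^sub>R h r)"
        by (rule three_point_formula[OF weak _ ac(1) b ac(3) s]) (fact lim)
      moreover have "x - y + z = p - q \<Longrightarrow> y = x - p + z + q" for x y z p q :: 'a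
        by (simp add: algebra_simps)
      ultimately show ?thesis
        unfolding G_def Z_def scaleR_diff_right by blast
    qed
    have "(G has_vector_derivative ((- m) *\<^sub>R Z + m *\<^sub>R F c) - integral {t..c} h) (at t)"
      if t: "t \<in> {a<..<c}" for t
    proof -
      have "((\<lambda>b. integral {b..c} (\<lambda>r. (r - b) *\<^sub>R h r)) has_vector_derivative - integral {t..c} h) (at t)"
        using t ac hi by (intro weighted_tail_has_derivative[where a = a]) auto
      moreover have "((\<lambda>b. ((c - b) * m) *\<^sub>R Z) has_vector_derivative (- m) *\<^sub>R Z) (at t)"
        "((\<lambda>b. ((b - a) * m) *\<^sub>R F c) has_vector_derivative m *\<^sub>R F c) (at t)"
        by (auto intro!: derivative_eq_intros)
      ultimately have "(G has_vector_derivative ((- m) *\<^sub>R Z + m *\<^sub>R F c) + - integral {t..c} h) (at t)"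
        unfolding G_def by (intro has_vector_derivative_add)
      then show ?thesis by simp
    qed
    then have "(F has_vector_derivative ((- m) *\<^sub>R Z + m *\<^sub>R F c) - integral {t..c} h) (at t)"
      if t: "t \<in> {a<..<c}" for t
      using has_vector_derivative_transform_within_open[of G _ t "{a<..<c}" F] t FG by simp
    then show ?thesis by blast
  qed
  define D where "D t = vector_derivative F (at t)" for t
  show thesis
  proof
    fix t assume t: "0 < t" "t < L"
    obtain A where "\<forall>u\<in>{t/2<..<(t+L)/2}. (F has_vector_derivative A - integral {u..(t+L)/2} h) (at u)"
      using local[of "t/2" "(t+L)/2"] t by auto
    then have "(F has_vector_derivative A - integral {t..(t+L)/2} h) (at t)"
      using t by auto
    then show "(F has_vector_derivative D t) (at t)"
      unfolding D_def by (simp add: vector_derivative_at)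
  next
    fix s t assume st: "0 < s" "s \<le> t" "t < L"
    define c where "c = (t + L) / 2"
    have c: "t < c" "c < L" using st by (auto simp: c_def)
    obtain A where A: "\<forall>u\<in>{s/2<..<c}. (F has_vector_derivative A - integral {u..c} h) (at u)"
      using local[of "s/2" c] st c by auto
    have "D s = A - integral {s..c} h" "D t = A - integral {t..c} h"
      unfolding D_def using A st c by (auto intro!: vector_derivative_at)
    moreover have "integral {s..c} h = integral {s..t} h + integral {t..c} h"
      using st c by (intro Henstock_Kurzweil_Integration.integral_combine[symmetric] hI) auto
    ultimately show "D t - D s = integral {s..t} h" by simp
  qed
qed

text \<open>Lebesgue's differentiation theorem, applied to the restrictions of \<open>h\<close> to an exhausting sequence of
  compact intervals, extended by zero; countably many exceptional sets are negligible together.\<close>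

lemma right_Lebesgue_points:
  fixes h :: "real \<Rightarrow> 'a::euclidean_space"
  assumes h: "locally_integrable L h"
  obtains N where "negligible N"
    and "\<And>x. x \<in> {0<..<L} - N \<Longrightarrow> ((\<lambda>d. integral {x..x+d} h /\<^sub>R d) \<longlongrightarrow> h x) (at_right 0)"
proof -
  define K where "K n = {1 / real (Suc n) .. L - 1 / real (Suc n)}" for n
  define hn where "hn n x = (if x \<in> K n then h x else 0)" for n x
  have "\<exists>N. negligible N \<and> (\<forall>x e. x \<notin> N \<longrightarrow> 0 < e \<longrightarrow> (\<exists>d>0. \<forall>r. 0 < r \<and> r < d \<longrightarrow>
      norm (integral {x..x+r} (hn n) /\<^sub>R r - hn n x) < e))" for n
  proof -
    have "K n \<subseteq> {0<..<L}"
    proof -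
      define q where "q = 1 / real (Suc n)"
      have "q > 0" by (simp add: q_def)
      then show ?thesis
        unfolding K_def q_def[symmetric] by auto
    qed
    moreover have "compact (K n)" by (simp add: K_def)
    ultimately have "h absolutely_integrable_on K n"
      using h unfolding locally_integrable_def by blast
    then have "hn n absolutely_integrable_on UNIV"
      unfolding hn_def[abs_def] using absolutely_integrable_restrict_UNIV by blast
    then have "hn n integrable_on cbox a b" for a b
      using integrable_on_subcbox absolutely_integrable_on_def by blast
    then obtain N where "negligible N" and
      "\<And>x e. \<lbrakk>x \<notin> N; 0 < e\<rbrakk> \<Longrightarrow> \<exists>d>0. \<forall>r. 0 < r \<and> r < d \<longrightarrow>
         norm(integral (cbox x (x + r *\<^sub>R One)) (hn n) /\<^sub>R r ^ DIM(real) - hn n x) < e"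
      by (rule integrable_ccontinuous_explicit) blast
    then show ?thesis
      by (intro exI[of _ N]) (simp add: Basis_real_def)
  qed
  then obtain N where N: "\<And>n. negligible (N n)" and
    L: "\<And>n x e. x \<notin> N n \<Longrightarrow> 0 < e \<Longrightarrow> \<exists>d>0. \<forall>r. 0 < r \<and> r < d \<longrightarrow>
      norm (integral {x..x+r} (hn n) /\<^sub>R r - hn n x) < e"
    by metis
  show thesis
  proof
    show "negligible (\<Union>n. N n)"
      by (rule negligible_Union_nat) (rule N)
    fix x assume x: "x \<in> {0<..<L} - (\<Union>n. N n)"
    obtain n where n: "1 / real (Suc n) < min x (L - x)"
      using nat_approx_posE[of "min x (L - x)"] x by auto
    define u where "u = L - 1 / real (Suc n) - x"
    have u: "u > 0" using n by (simp add: u_def)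
    have eq: "integral {x..x+r} (hn n) = integral {x..x+r} h" if "r < u" for r
      using that n by (intro integral_cong) (auto simp: hn_def K_def u_def)
    have eqx: "hn n x = h x"
      using n by (auto simp: hn_def K_def)
    show "((\<lambda>d. integral {x..x+d} h /\<^sub>R d) \<longlongrightarrow> h x) (at_right 0)"
    proof (rule tendstoI)
      fix e :: real assume "e > 0"
      then obtain d where d: "d > 0" "\<And>r. 0 < r \<Longrightarrow> r < d \<Longrightarrow>
          norm (integral {x..x+r} (hn n) /\<^sub>R r - hn n x) < e"
        using L[of x n e] x by auto
      have "dist (integral {x..x+r} h /\<^sub>R r) (h x) < e" if "0 < r" "r < min d u" for r
        using d(2)[of r] eq[of r] that by (simp add: eqx dist_norm)
      then show "\<forall>\<^sub>F r in at_right 0. dist (integral {x..x+r} h /\<^sub>R r) (h x) < e"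
        unfolding eventually_at_right_field using d(1) u by (intro exI[of _ "min d u"]) auto
    qed
  qed
qed

lemma weak_second_derivative_unique:
  fixes f h1 h2 :: "real \<Rightarrow> 'a::euclidean_space"
  assumes weak: "weak_derivative 2 L f h1" "weak_derivative 2 L f h2"
    and f: "continuous_on {0<..<L} f"
  obtains N where "negligible N" "\<And>x. x \<in> {0<..<L} - N \<Longrightarrow> h1 x = h2 x"
proof -
  have lim: "(f \<longlongrightarrow> f t) (at_right t)" if "0 < t" "t < L" for t
    using f that by (simp add: continuous_on_eq_continuous_at isCont_def filterlim_at_split)
  obtain D1 where D1: "\<And>t. 0 < t \<Longrightarrow> t < L \<Longrightarrow> (f has_vector_derivative D1 t) (at t)"
     "\<And>s t. 0 < s \<Longrightarrow> s \<le> t \<Longrightarrow> t < L \<Longrightarrow> D1 t - D1 s = integral {s..t} h1"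
    by (rule weak_second_derivative_imp_C1[where F = f, OF weak(1)]) (erule (1) lim, rule that)
  obtain D2 where D2: "\<And>t. 0 < t \<Longrightarrow> t < L \<Longrightarrow> (f has_vector_derivative D2 t) (at t)"
     "\<And>s t. 0 < s \<Longrightarrow> s \<le> t \<Longrightarrow> t < L \<Longrightarrow> D2 t - D2 s = integral {s..t} h2"
    by (rule weak_second_derivative_imp_C1[where F = f, OF weak(2)]) (erule (1) lim, rule that)
  have "D1 t = D2 t" if "0 < t" "t < L" for t
    using D1(1)[OF that] D2(1)[OF that] vector_derivative_unique_at by blast
  then have eq: "integral {s..t} h1 = integral {s..t} h2" if "0 < s" "s \<le> t" "t < L" for s t
    using D1(2)[OF that] D2(2)[OF that] that by simp
  obtain N1 where N1: "negligible N1"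
     "\<And>x. x \<in> {0<..<L} - N1 \<Longrightarrow> ((\<lambda>d. integral {x..x+d} h1 /\<^sub>R d) \<longlongrightarrow> h1 x) (at_right 0)"
    using right_Lebesgue_points weak(1) unfolding weak_derivative_def by metis
  obtain N2 where N2: "negligible N2"
     "\<And>x. x \<in> {0<..<L} - N2 \<Longrightarrow> ((\<lambda>d. integral {x..x+d} h2 /\<^sub>R d) \<longlongrightarrow> h2 x) (at_right 0)"
    using right_Lebesgue_points weak(2) unfolding weak_derivative_def by metis
  show thesis
  proof
    show "negligible (N1 \<union> N2)" using N1 N2 by simp
    fix x assume x: "x \<in> {0<..<L} - (N1 \<union> N2)"
    have "\<forall>\<^sub>F d in at_right 0. integral {x..x+d} h1 /\<^sub>R d = integral {x..x+d} h2 /\<^sub>R d"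
      unfolding eventually_at_right_field using x eq[of x]
      by (intro exI[of _ "L - x"]) auto
    then have "((\<lambda>d. integral {x..x+d} h2 /\<^sub>R d) \<longlongrightarrow> h1 x) (at_right 0)"
      by (rule tendsto_cong[THEN iffD1]) (use N1(2) x in blast)
    moreover have "((\<lambda>d. integral {x..x+d} h2 /\<^sub>R d) \<longlongrightarrow> h2 x) (at_right 0)"
      using N2(2) x by blast
    ultimately show "h1 x = h2 x"
      by (rule tendsto_unique[OF trivial_limit_at_right_real])
  qed
qed

text \<open>At a right Lebesgue point of \<open>h\<close> the unit vector field is differentiable from the right with
  derivative \<open>h x\<close>, and \<open>(T(x+d) - T x) \<bullet> (T(x+d) + T x) = 0\<close>.\<close>

lemma derivative_of_unit_vector_orthogonal:
  fixes T h :: "real \<Rightarrow> 'a::euclidean_space"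
  assumes h: "locally_integrable L h" and T: "continuous_on {0<..<L} T"
    and diff: "\<And>s t. 0 < s \<Longrightarrow> s \<le> t \<Longrightarrow> t < L \<Longrightarrow> T t - T s = integral {s..t} h"
    and unit: "\<And>s. 0 < s \<Longrightarrow> s < L \<Longrightarrow> norm (T s) = 1"
  obtains N where "negligible N" "\<And>x. x \<in> {0<..<L} - N \<Longrightarrow> inner (T x) (h x) = 0"
proof -
  obtain N where N: "negligible N"
     "\<And>x. x \<in> {0<..<L} - N \<Longrightarrow> ((\<lambda>d. integral {x..x+d} h /\<^sub>R d) \<longlongrightarrow> h x) (at_right 0)"
    using right_Lebesgue_points[OF h] by metis
  show thesis
  proof
    show "negligible N" by (rule N)
    fix x assume x: "x \<in> {0<..<L} - N"
    have "isCont T x"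
      using T x by (simp add: continuous_on_eq_continuous_at)
    then have "((\<lambda>d. T (x + d)) \<longlongrightarrow> T x) (at 0)"
      unfolding isCont_def by (rule LIM_offset_zero)
    then have "((\<lambda>d. T (x + d)) \<longlongrightarrow> T x) (at_right 0)"
      by (simp add: filterlim_at_split)
    then have lim: "((\<lambda>d. inner (T (x + d) + T x) (integral {x..x+d} h /\<^sub>R d)) \<longlongrightarrow>
        inner (T x + T x) (h x)) (at_right 0)"
      by (intro tendsto_intros N(2) x)
    have "\<forall>\<^sub>F d in at_right 0. inner (T (x + d) + T x) (integral {x..x+d} h /\<^sub>R d) = 0"
      unfolding eventually_at_right_field
    proof (intro exI[of _ "L - x"] conjI allI impI)
      show "0 < L - x" using x by simp
      fix d assume d: "0 < d" "d < L - x"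
      have "inner (T (x + d) + T x) (T (x + d) - T x) = (norm (T (x + d)))\<^sup>2 - (norm (T x))\<^sup>2"
        by (simp add: inner_diff_right inner_add_left power2_norm_eq_inner
            inner_commute[of "T x" "T (x + d)"])
      then show "inner (T (x + d) + T x) (integral {x..x+d} h /\<^sub>R d) = 0"
        using diff[of x "x + d"] unit[of x] unit[of "x + d"] x d by simp
    qed
    then have "((\<lambda>d. inner (T (x + d) + T x) (integral {x..x+d} h /\<^sub>R d)) \<longlongrightarrow> 0) (at_right 0)"
      by (rule tendsto_eventually)
    then have "inner (T x + T x) (h x) = 0"
      by (rule tendsto_unique[OF trivial_limit_at_right_real lim])
    then show "inner (T x) (h x) = 0"
      by (simp add: inner_add_left)
  qed
qed

text \<open>Integrability of \<open>h\<close> up to the end points lets the derivative be extended continuously; continuity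
  of \<open>\<gamma>\<close> then makes this extension the one-sided derivative at the end points.\<close>

lemma C1_up_to_the_boundary:
  fixes \<gamma> h :: "real \<Rightarrow> 'a::euclidean_space"
  assumes L: "L > 0" and \<gamma>: "continuous_on {0..L} \<gamma>" and weak: "weak_derivative 2 L \<gamma> h"
    and h: "h integrable_on {0..L}"
  obtains T where "continuous_on {0..L} T"
    and "\<And>s. s \<in> {0..L} \<Longrightarrow> (\<gamma> has_vector_derivative T s) (at s within {0..L})"
    and "\<And>s t. 0 \<le> s \<Longrightarrow> s \<le> t \<Longrightarrow> t \<le> L \<Longrightarrow> T t - T s = integral {s..t} h"
proof -
  have cont: "isCont \<gamma> t" if "0 < t" "t < L" for t
    using \<gamma> that continuous_on_interior[of "{0..L}" \<gamma> t] by simp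
  then have lim: "(\<gamma> \<longlongrightarrow> \<gamma> t) (at_right t)" if "0 < t" "t < L" for t
    using that by (simp add: isCont_def filterlim_at_split)
  obtain D where D: "\<And>t. 0 < t \<Longrightarrow> t < L \<Longrightarrow> (\<gamma> has_vector_derivative D t) (at t)"
     "\<And>s t. 0 < s \<Longrightarrow> s \<le> t \<Longrightarrow> t < L \<Longrightarrow> D t - D s = integral {s..t} h"
    by (rule weak_second_derivative_imp_C1[where F = \<gamma>, OF weak]) (erule (1) lim, rule that)
  define T where "T s = D (L/2) - integral {0..L/2} h + integral {0..s} h" for s
  have hI: "h integrable_on {s..t}" if "0 \<le> s" "t \<le> L" for s t
    by (rule integrable_on_subinterval[OF h]) (use that in auto)
  have diff: "T t - T s = integral {s..t} h" if "0 \<le> s" "s \<le> t" "t \<le> L" for s t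
    unfolding T_def using that Henstock_Kurzweil_Integration.integral_combine[of 0 s t h] hI[of 0 t]
    by (simp add: algebra_simps)
  have TD: "T s = D s" if s: "0 < s" "s < L" for s
  proof -
    have "T (L/2) = D (L/2)" by (simp add: T_def)
    then show ?thesis
      using diff[of s "L/2"] D(2)[of s "L/2"] diff[of "L/2" s] D(2)[of "L/2" s] s L
      by (cases "s \<le> L/2") (auto simp: algebra_simps)
  qed
  have cT: "continuous_on {0..L} T"
    unfolding T_def by (intro continuous_intros indefinite_integral_continuous_1 h)
  have \<gamma>_int: "\<gamma> t = \<gamma> 0 + integral {0..t} T" if t: "t \<in> {0..L}" for t
  proof -
    have "(T has_integral \<gamma> t - \<gamma> 0) {0..t}"
    proof (rule fundamental_theorem_of_calculus_interior)
      show "continuous_on {0..t} \<gamma>"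
        using \<gamma> t by (auto intro: continuous_on_subset)
      show "(\<gamma> has_vector_derivative T x) (at x)" if "x \<in> {0<..<t}" for x
        using D(1)[of x] TD[of x] that t by simp
    qed (use t in simp)
    then show ?thesis
      by (simp add: integral_unique)
  qed
  show thesis
  proof
    fix s assume s: "s \<in> {0..L}"
    have "((\<lambda>t. \<gamma> 0 + integral {0..t} T) has_vector_derivative 0 + T s) (at s within {0..L})"
      by (intro has_vector_derivative_add integral_has_vector_derivative cT s) auto
    then show "(\<gamma> has_vector_derivative T s) (at s within {0..L})"
      using has_vector_derivative_transform[OF s \<gamma>_int] by simp
  qed (use cT diff in auto)
qed


section \<open>Picone's inequality for functions of finite energy\<close>

text \<open>The error \<open>\<epsilon> (g t - g s)\<close> is additive, so it sums to \<open>\<epsilon> (g \<beta> - g \<alpha>)\<close> over any partition.\<close>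

lemma nondecreasing_if_locally_almost:
  fixes f g :: "real \<Rightarrow> real"
  assumes "\<alpha> \<le> \<beta>"
    and local: "\<And>\<epsilon>. \<epsilon> > 0 \<Longrightarrow> \<exists>\<delta>>0. \<forall>s t. \<alpha> \<le> s \<longrightarrow> s < t \<longrightarrow> t \<le> \<beta> \<longrightarrow> t - s < \<delta> \<longrightarrow>
        f s \<le> f t + \<epsilon> * (g t - g s)"
  shows "f \<alpha> \<le> f \<beta>"
proof (cases "\<alpha> = \<beta>")
  case False
  then have ab: "\<alpha> < \<beta>" using assms(1) by simp
  have key: "f \<alpha> \<le> f \<beta> + \<epsilon> * (g \<beta> - g \<alpha>)" if \<epsilon>: "\<epsilon> > 0" for \<epsilon>
  proof -
    obtain \<delta> where \<delta>: "\<delta> > 0" and loc: "\<And>s t. \<alpha> \<le> s \<Longrightarrow> s < t \<Longrightarrow> t \<le> \<beta> \<Longrightarrow> t - s < \<delta> \<Longrightarrow>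
        f s \<le> f t + \<epsilon> * (g t - g s)"
      using local[OF \<epsilon>] by blast
    obtain n where n: "(\<beta> - \<alpha>) / \<delta> < real (Suc n)"
      using reals_Archimedean2 by (metis less_trans lessI of_nat_less_iff)
    define w where "w = (\<beta> - \<alpha>) / real (Suc n)"
    have w: "w > 0" "w < \<delta>" "\<alpha> + real (Suc n) * w = \<beta>"
    proof -
      show "w > 0" using ab by (simp add: w_def)
      show "\<alpha> + real (Suc n) * w = \<beta>" by (simp add: w_def del: of_nat_Suc)
      show "w < \<delta>" using n \<delta> by (simp add: w_def field_simps del: of_nat_Suc)
    qed
    have "i \<le> Suc n \<longrightarrow> f \<alpha> \<le> f (\<alpha> + real i * w) + \<epsilon> * (g (\<alpha> + real i * w) - g \<alpha>)" for i
    proof (induction i)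
      case (Suc i)
      show ?case
      proof
        assume i: "Suc i \<le> Suc n"
        have "real (Suc i) * w \<le> real (Suc n) * w"
          using i w by (intro mult_right_mono) auto
        then have "\<alpha> + real (Suc i) * w \<le> \<beta>" using w by linarith
        moreover have "\<alpha> + real (Suc i) * w = \<alpha> + real i * w + w"
          by (simp add: algebra_simps)
        moreover have "\<alpha> \<le> \<alpha> + real i * w" using w by simp
        ultimately have "f (\<alpha> + real i * w) \<le> f (\<alpha> + real (Suc i) * w)
            + \<epsilon> * (g (\<alpha> + real (Suc i) * w) - g (\<alpha> + real i * w))"
          using w by (intro loc) auto
        moreover have "f \<alpha> \<le> f (\<alpha> + real i * w) + \<epsilon> * (g (\<alpha> + real i * w) - g \<alpha>)"
          using Suc.IH i by simp
        ultimately show "f \<alpha> \<le> f (\<alpha> + real (Suc i) * w) + \<epsilon> * (g (\<alpha> + real (Suc i) * w) - g \<alpha>)"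
          unfolding right_diff_distrib by linarith
      qed
    qed simp
    from this[of "Suc n"] show ?thesis
      using w by simp
  qed
  show ?thesis
  proof (rule field_le_epsilon)
    fix e :: real assume e: "e > 0"
    define C where "C = \<bar>g \<beta> - g \<alpha>\<bar> + 1"
    have C: "C > 0" "g \<beta> - g \<alpha> \<le> C" unfolding C_def by linarith+
    have "f \<alpha> \<le> f \<beta> + (e / C) * (g \<beta> - g \<alpha>)"
      using C e by (intro key) simp
    also have "(e / C) * (g \<beta> - g \<alpha>) \<le> (e / C) * C"
      using C e by (intro mult_left_mono) auto
    finally show "f \<alpha> \<le> f \<beta> + e" using C by simp
  qed
qed simp

text \<open>For the linear function \<open>p\<close> from \<open>a\<close> to \<open>b\<close>, Picone's identity bounds the increment of \<open>p\<^sup>2 q\<close> by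
  \<open>\<integral> p'\<^sup>2 - r p\<^sup>2\<close>; here \<open>q\<close> solves the Riccati equation \<open>q' = -r - q\<^sup>2\<close>, as \<open>u'/u\<close> does when
  \<open>u'' = -r u\<close>. The term \<open>r p\<^sup>2\<close> is replaced by \<open>r \<psi>\<^sup>2\<close> at the cost of \<open>e\<close> per unit length.\<close>

lemma Picone_linear_piece:
  fixes q r \<psi> :: "real \<Rightarrow> real"
  assumes st: "s < t"
    and q: "\<And>x. x \<in> {s..t} \<Longrightarrow> (q has_real_derivative - r x - (q x)\<^sup>2) (at x within {s..t})"
    and cont: "continuous_on {s..t} (\<lambda>x. r x * (\<psi> x)\<^sup>2)"
    and close: "\<And>x. x \<in> {s..t} \<Longrightarrow>
      r x * (\<psi> x)\<^sup>2 \<le> r x * (a + (b - a) / (t - s) * (x - s))\<^sup>2 + e"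
  shows "b\<^sup>2 * q t - a\<^sup>2 * q s \<le> (b - a)\<^sup>2 / (t - s) - integral {s..t} (\<lambda>x. r x * (\<psi> x)\<^sup>2) + e * (t - s)"
proof -
  define m where "m = (b - a) / (t - s)"
  define p where "p x = a + m * (x - s)" for x
  have "((\<lambda>x. 2 * p x * m * q x + (p x)\<^sup>2 * (- r x - (q x)\<^sup>2)) has_integral (p t)\<^sup>2 * q t - (p s)\<^sup>2 * q s) {s..t}"
  proof (rule fundamental_theorem_of_calculus)
    fix x assume x: "x \<in> {s..t}"
    have "(p has_real_derivative m) (at x within {s..t})"
      unfolding p_def by (auto intro!: derivative_eq_intros)
    then have "((\<lambda>x. (p x)\<^sup>2 * q x) has_real_derivative
        2 * p x * m * q x + (p x)\<^sup>2 * (- r x - (q x)\<^sup>2)) (at x within {s..t})"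
      by (auto intro!: derivative_eq_intros q[OF x])
    then show "((\<lambda>x. (p x)\<^sup>2 * q x) has_vector_derivative
        2 * p x * m * q x + (p x)\<^sup>2 * (- r x - (q x)\<^sup>2)) (at x within {s..t})"
      by (simp add: has_real_derivative_iff_has_vector_derivative)
  qed (use st in simp)
  moreover have "((\<lambda>x. m\<^sup>2 + e - r x * (\<psi> x)\<^sup>2) has_integral
      (m\<^sup>2 + e) * (t - s) - integral {s..t} (\<lambda>x. r x * (\<psi> x)\<^sup>2)) {s..t}"
    using has_integral_const_real[of "m\<^sup>2 + e" s t] st cont
    by (intro has_integral_diff integrable_integral integrable_continuous_real) (auto simp: mult.commute)
  moreover have "2 * p x * m * q x + (p x)\<^sup>2 * (- r x - (q x)\<^sup>2) \<le> m\<^sup>2 + e - r x * (\<psi> x)\<^sup>2"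
    if x: "x \<in> {s..t}" for x
  proof -
    (* Picone's identity for the slope m. *)
    have "2 * p x * m * q x + (p x)\<^sup>2 * (- r x - (q x)\<^sup>2) = m\<^sup>2 - (m - p x * q x)\<^sup>2 - r x * (p x)\<^sup>2"
      by (simp add: power2_eq_square algebra_simps)
    then show ?thesis
      using close[OF x] zero_le_power2[of "m - p x * q x"] unfolding p_def m_def by linarith
  qed
  ultimately have "(p t)\<^sup>2 * q t - (p s)\<^sup>2 * q s \<le>
      (m\<^sup>2 + e) * (t - s) - integral {s..t} (\<lambda>x. r x * (\<psi> x)\<^sup>2)"
    by (rule has_integral_le)
  moreover have "p t = b" "p s = a" using st by (auto simp: p_def m_def)
  moreover have "m\<^sup>2 * (t - s) = (b - a)\<^sup>2 / (t - s)"
    using st by (simp add: m_def power_divide power2_eq_square)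
  ultimately show ?thesis
    by (simp add: algebra_simps)
qed

text \<open>A derivative-free way to say \<open>\<psi>'\<^sup>2 \<le> M'\<close>: the Cauchy-Schwarz inequality for increments. The factor
  \<open>1 + \<epsilon>\<close> on short intervals makes it insensitive to the difference between chords and arcs of the
  unit circle.\<close>

definition energy_dominated :: "real \<Rightarrow> real \<Rightarrow> (real \<Rightarrow> real) \<Rightarrow> (real \<Rightarrow> real) \<Rightarrow> bool" where
  "energy_dominated a b \<psi> M \<longleftrightarrow> (\<forall>\<epsilon>>0. \<exists>\<delta>>0. \<forall>s t. a \<le> s \<longrightarrow> s < t \<longrightarrow> t \<le> b \<longrightarrow> t - s < \<delta> \<longrightarrow>
      (\<psi> t - \<psi> s)\<^sup>2 \<le> (1 + \<epsilon>) * (t - s) * (M t - M s))"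

text \<open>The integrated form of \<open>(\<psi>\<^sup>2 q)' + r \<psi>\<^sup>2 \<le> \<psi>'\<^sup>2\<close>. On a short interval \<open>\<psi>\<close> is compared with its
  linear interpolation, and the local errors are negligible after summation.\<close>

lemma Picone_inequality:
  fixes q r \<psi> M :: "real \<Rightarrow> real"
  assumes ab: "\<alpha> \<le> \<beta>"
    and q: "\<And>x. x \<in> {\<alpha>..\<beta>} \<Longrightarrow> (q has_real_derivative - r x - (q x)\<^sup>2) (at x)"
    and r: "continuous_on {\<alpha>..\<beta>} r" and \<psi>: "continuous_on {\<alpha>..\<beta>} \<psi>"
    and dom: "energy_dominated \<alpha> \<beta> \<psi> M"
  shows "(\<psi> \<beta>)\<^sup>2 * q \<beta> - (\<psi> \<alpha>)\<^sup>2 * q \<alpha> + integral {\<alpha>..\<beta>} (\<lambda>x. r x * (\<psi> x)\<^sup>2) \<le> M \<beta> - M \<alpha>"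
proof -
  define J where "J x = M x - (\<psi> x)\<^sup>2 * q x - integral {\<alpha>..x} (\<lambda>x. r x * (\<psi> x)\<^sup>2)" for x
  have contr: "continuous_on {\<alpha>..\<beta>} (\<lambda>x. r x * (\<psi> x)\<^sup>2)"
    by (intro continuous_intros r \<psi>)
  obtain B where B: "B > 0" "\<And>x. x \<in> {\<alpha>..\<beta>} \<Longrightarrow> \<bar>\<psi> x\<bar> \<le> B"
    using compact_imp_bounded[OF compact_continuous_image[OF \<psi>]] bounded_pos by (auto simp: bounded_pos)
  obtain C where C: "C > 0" "\<And>x. x \<in> {\<alpha>..\<beta>} \<Longrightarrow> \<bar>r x\<bar> \<le> C"
    using compact_imp_bounded[OF compact_continuous_image[OF r]] bounded_pos by (auto simp: bounded_pos)
  have unif: "uniformly_continuous_on {\<alpha>..\<beta>} \<psi>"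
    using \<psi> by (intro compact_uniformly_continuous) auto
  have "J \<alpha> \<le> J \<beta>"
  (* M absorbs the factor 1 + epsilon of energy domination, the identity the interpolation error. *)
  proof (rule nondecreasing_if_locally_almost[OF ab, where g = "\<lambda>x. M x + x"])
    fix \<epsilon> :: real assume \<epsilon>: "\<epsilon> > 0"
    obtain \<delta>1 where \<delta>1: "\<delta>1 > 0" "\<And>s t. \<alpha> \<le> s \<Longrightarrow> s < t \<Longrightarrow> t \<le> \<beta> \<Longrightarrow> t - s < \<delta>1 \<Longrightarrow>
      (\<psi> t - \<psi> s)\<^sup>2 \<le> (1 + \<epsilon>) * (t - s) * (M t - M s)"
      using dom \<epsilon> unfolding energy_dominated_def by blast
    (* Both |psi| and the interpolation are at most B and they differ by at most 2 eta, so r psi^2 changes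
       by at most C (2 B) (2 eta). *)
    define \<eta> where "\<eta> = \<epsilon> / (4 * B * C)"
    have \<eta>: "\<eta> > 0" using \<epsilon> B C by (simp add: \<eta>_def)
    obtain \<delta>2 where \<delta>2: "\<delta>2 > 0" "\<And>x y. x \<in> {\<alpha>..\<beta>} \<Longrightarrow> y \<in> {\<alpha>..\<beta>} \<Longrightarrow> dist y x < \<delta>2 \<Longrightarrow> dist (\<psi> y) (\<psi> x) < \<eta>"
      using unif \<eta> unfolding uniformly_continuous_on_def by blast
    show "\<exists>\<delta>>0. \<forall>s t. \<alpha> \<le> s \<longrightarrow> s < t \<longrightarrow> t \<le> \<beta> \<longrightarrow> t - s < \<delta> \<longrightarrow>
        J s \<le> J t + \<epsilon> * (M t + t - (M s + s))"
    proof (intro exI[of _ "min \<delta>1 \<delta>2"] conjI allI impI)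
      show "min \<delta>1 \<delta>2 > 0" using \<delta>1 \<delta>2 by simp
      fix s t assume st: "\<alpha> \<le> s" "s < t" "t \<le> \<beta>" "t - s < min \<delta>1 \<delta>2"
      define a b where "a = \<psi> s" and "b = \<psi> t"
      have ab: "\<bar>a\<bar> \<le> B" "\<bar>b\<bar> \<le> B" "\<bar>b - a\<bar> < \<eta>"
        using B(2)[of s] B(2)[of t] \<delta>2(2)[of s t] st by (auto simp: a_def b_def dist_real_def)
      have "b\<^sup>2 * q t - a\<^sup>2 * q s \<le> (b - a)\<^sup>2 / (t - s) - integral {s..t} (\<lambda>x. r x * (\<psi> x)\<^sup>2) + \<epsilon> * (t - s)"
      proof (rule Picone_linear_piece[OF st(2)])
        fix x assume x: "x \<in> {s..t}"
        then have x': "x \<in> {\<alpha>..\<beta>}" using st by auto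
        show "(q has_real_derivative - r x - (q x)\<^sup>2) (at x within {s..t})"
          using q[OF x'] by (rule has_field_derivative_at_within)
        define l where "l = (x - s) / (t - s)"
        define p where "p = a + (b - a) / (t - s) * (x - s)"
        have l: "0 \<le> l" "l \<le> 1" using x st by (auto simp: l_def)
        have p: "p = a + l * (b - a)" by (simp add: p_def l_def)
        define w where "w = l * (b - a)"
        have "\<bar>w\<bar> \<le> 1 * \<bar>b - a\<bar>"
          unfolding w_def abs_mult using l by (intro mult_right_mono) auto
        moreover have "\<bar>\<psi> x - a\<bar> < \<eta>"
          using \<delta>2(2)[of s x] x x' st by (auto simp: a_def dist_real_def)
        ultimately have 1: "\<bar>\<psi> x - p\<bar> \<le> 2 * \<eta>"
          using ab(3) p[folded w_def] abs_triangle_ineq4[of "\<psi> x - a" w] by simp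
        have "p = (1 - l) * a + l * b" using p by (simp add: algebra_simps)
        moreover have "\<bar>(1 - l) * a\<bar> \<le> (1 - l) * B" "\<bar>l * b\<bar> \<le> l * B"
          unfolding abs_mult using l ab by (auto intro!: mult_left_mono)
        moreover have "(1 - l) * B + l * B = B" by (simp add: algebra_simps)
        ultimately have "\<bar>p\<bar> \<le> B" by linarith
        then have 2: "\<bar>\<psi> x + p\<bar> \<le> 2 * B" using B(2)[OF x'] by linarith
        have "r x * (\<psi> x)\<^sup>2 - r x * p\<^sup>2 = r x * ((\<psi> x + p) * (\<psi> x - p))"
          by (simp add: power2_eq_square algebra_simps)
        also have "\<dots> \<le> \<bar>r x\<bar> * (\<bar>\<psi> x + p\<bar> * \<bar>\<psi> x - p\<bar>)"
          by (metis abs_ge_self abs_mult)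
        also have "\<dots> \<le> C * ((2 * B) * (2 * \<eta>))"
          using C(2)[OF x'] 1 2 B C by (intro mult_mono) auto
        also have "\<dots> = \<epsilon>" using B C by (simp add: \<eta>_def)
        finally show "r x * (\<psi> x)\<^sup>2 \<le> r x * (a + (b - a) / (t - s) * (x - s))\<^sup>2 + \<epsilon>"
          unfolding p_def by linarith
      next
        show "continuous_on {s..t} (\<lambda>x. r x * (\<psi> x)\<^sup>2)"
          by (rule continuous_on_subset[OF contr]) (use st in auto)
      qed
      moreover have "(b - a)\<^sup>2 / (t - s) \<le> (1 + \<epsilon>) * (M t - M s)"
        using \<delta>1(2)[of s t] st by (simp add: a_def b_def divide_le_eq mult_ac)
      moreover have "integral {\<alpha>..t} (\<lambda>x. r x * (\<psi> x)\<^sup>2) = integral {\<alpha>..s} (\<lambda>x. r x * (\<psi> x)\<^sup>2)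
          + integral {s..t} (\<lambda>x. r x * (\<psi> x)\<^sup>2)"
        using st by (intro Henstock_Kurzweil_Integration.integral_combine[symmetric]
          integrable_continuous_real continuous_on_subset[OF contr]) auto
      ultimately show "J s \<le> J t + \<epsilon> * (M t + t - (M s + s))"
        unfolding J_def a_def b_def by (simp add: algebra_simps)
    qed
  qed
  then show ?thesis
    by (simp add: J_def)
qed

text \<open>The numerator of the derivative of \<open>sin z / z\<close> is \<open>z cos z - sin z\<close>, which vanishes at the origin and
  has derivative \<open>- z sin z < 0\<close> on \<open>(0, \<pi>)\<close>.\<close>

lemma sin_over_id_strict_decreasing:
  fixes x y :: real
  assumes "0 < x" "x < y" "y \<le> pi"
  shows "sin y * x < sin x * y"
proof -
  have pos: "z * cos z - sin z < 0" if z: "0 < z" "z \<le> pi" for z :: real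
  proof -
    have "(\<lambda>z. z * cos z - sin z) z < (\<lambda>z. z * cos z - sin z) (0::real)"
    proof (rule DERIV_neg_imp_decreasing_open[OF z(1)])
      fix w assume w: "0 < w" "w < z"
      have "((\<lambda>z. z * cos z - sin z) has_real_derivative - (w * sin w)) (at w)"
        by (auto intro!: derivative_eq_intros)
      moreover have "w * sin w > 0" using w z sin_gt_zero by simp
      ultimately show "\<exists>D. ((\<lambda>z. z * cos z - sin z) has_real_derivative D) (at w) \<and> D < 0"
        by (intro exI[of _ "- (w * sin w)"]) simp
    qed (auto intro!: continuous_intros)
    then show ?thesis by simp
  qed
  have "(\<lambda>z. sin z / z) y < (\<lambda>z. sin z / z) x"
  proof (rule DERIV_neg_imp_decreasing[OF assms(2)])
    fix z assume z: "x \<le> z" "z \<le> y"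
    then have "((\<lambda>z. sin z / z) has_real_derivative (cos z * z - sin z) / (z * z)) (at z)"
      using assms by (auto intro!: derivative_eq_intros)
    moreover have "(cos z * z - sin z) / (z * z) < 0"
      using pos[of z] z assms by (intro divide_neg_pos) (auto simp: mult.commute)
    ultimately show "\<exists>D. ((\<lambda>z. sin z / z) has_real_derivative D) (at z) \<and> D < 0" by blast
  qed
  then show ?thesis
    using assms by (simp add: field_simps)
qed

text \<open>In the variable \<open>x\<^sup>2\<close> the right-hand side compares the graph of \<open>cos (sqrt t)\<close> with its tangent line at
  \<open>u\<^sup>2\<close>, whose slope is \<open>- sin u / (2u)\<close>. The difference decreases before \<open>u\<close> and increases after it
  because \<open>sin x / x\<close> decreases.\<close>

lemma cos_sqrt_strictly_convex:
  fixes u x :: real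
  assumes u: "0 < u" "u \<le> pi" and x: "0 \<le> x" "x \<le> pi" "x \<noteq> u"
  shows "cos u < cos x + sin u / u / 2 * (x\<^sup>2 - u\<^sup>2)"
proof -
  define k where "k = sin u / u"
  define f where "f y = cos y + k / 2 * y\<^sup>2" for y
  have d: "(f has_real_derivative k * y - sin y) (at y)" for y
    unfolding f_def by (auto intro!: derivative_eq_intros)
  have cont: "continuous_on S f" for S
    unfolding f_def by (intro continuous_intros)
  have "f u < f x"
  proof (cases "x < u")
    case True
    show ?thesis
    proof (rule DERIV_neg_imp_decreasing_open[OF True _ cont])
      fix y assume y: "x < y" "y < u"
      have "k * y - sin y < 0"
        using sin_over_id_strict_decreasing[of y u] y x u by (simp add: k_def field_simps)
      then show "\<exists>D. (f has_real_derivative D) (at y) \<and> D < 0" using d by blast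
    qed
  next
    case False
    then have "u < x" using x by simp
    then show ?thesis
    proof (rule DERIV_pos_imp_increasing_open[OF _ _ cont])
      fix y assume y: "u < y" "y < x"
      have "k * y - sin y > 0"
        using sin_over_id_strict_decreasing[of u y] y x u by (simp add: k_def field_simps)
      then show "\<exists>D. (f has_real_derivative D) (at y) \<and> D > 0" using d by blast
    qed
  qed
  then show ?thesis
    by (simp add: f_def k_def algebra_simps)
qed


section \<open>The pendulum equation and the boundary terms\<close>

lemma increment_le_if_one_sided_limits:
  fixes G :: "real \<Rightarrow> real"
  assumes "0 < \<alpha>" "\<alpha> \<le> \<beta>" "\<beta> < L"
    and mono: "\<And>s t. 0 < s \<Longrightarrow> s \<le> t \<Longrightarrow> t < L \<Longrightarrow> G s \<le> G t"
    and l: "(G \<longlongrightarrow> e0) (at_right 0)" and r: "(G \<longlongrightarrow> e1) (at_left L)"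
  shows "G \<beta> - G \<alpha> \<le> e1 - e0"
proof -
  have "e0 \<le> G \<alpha>"
    by (rule tendsto_upperbound[OF l _ trivial_limit_at_right_real])
      (use assms in \<open>auto simp: eventually_at_right_field intro!: exI[of _ \<alpha>] mono\<close>)
  moreover have "G \<beta> \<le> e1"
    by (rule tendsto_lowerbound[OF r _ trivial_limit_at_left_real])
      (use assms in \<open>auto simp: eventually_at_left_field intro!: exI[of _ \<beta>] mono\<close>)
  ultimately show ?thesis by linarith
qed

text \<open>Derivatives are required in the open interval only; at the end points continuity of the angle \<open>u\<close> and
  the velocity \<open>v\<close> is enough. The last clause excludes the equilibrium \<open>u = 0\<close>, for which \<open>u'/u\<close> is
  meaningless.\<close>

definition pendulum :: "real \<Rightarrow> real \<Rightarrow> (real \<Rightarrow> real) \<Rightarrow> (real \<Rightarrow> real) \<Rightarrow> bool" where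
  "pendulum L c u v \<longleftrightarrow> L > 0 \<and> c > 0 \<and> continuous_on {0..L} u \<and> continuous_on {0..L} v \<and>
    (\<forall>x\<in>{0<..<L}. (u has_real_derivative v x) (at x) \<and> (v has_real_derivative - c * sin (u x)) (at x)) \<and>
    (\<forall>x\<in>{0..L}. 0 \<le> u x \<and> u x \<le> pi) \<and> (\<exists>x\<in>{0..L}. u x \<noteq> 0)"

text \<open>Reversal of time, which reduces statements about the right end point to the left one.\<close>

lemma pendulum_reflect:
  assumes "pendulum L c u v"
  shows "pendulum L c (\<lambda>x. u (L - x)) (\<lambda>x. - v (L - x))"
proof -
  have c: "continuous_on {0..L} (\<lambda>x. f (L - x))" if "continuous_on {0..L} f" for f :: "real \<Rightarrow> real"
    by (rule continuous_on_compose2[OF that]) (auto intro!: continuous_intros)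
  have d: "((\<lambda>x. f (L - x)) has_real_derivative - D) (at x)"
    if "(f has_real_derivative D) (at (L - x))" for f :: "real \<Rightarrow> real" and D x
  proof -
    have "((\<lambda>x. L - x) has_real_derivative -1) (at x)"
      by (auto intro!: derivative_eq_intros)
    from DERIV_chain2[OF that this] show ?thesis by simp
  qed
  obtain x0 where x0: "x0 \<in> {0..L}" "u x0 \<noteq> 0"
    using assms unfolding pendulum_def by blast
  show ?thesis
    unfolding pendulum_def
  proof (intro conjI ballI)
    show "continuous_on {0..L} (\<lambda>x. u (L - x))" "continuous_on {0..L} (\<lambda>x. - v (L - x))"
      using assms unfolding pendulum_def by (auto intro!: c continuous_intros)
    fix x assume x: "x \<in> {0<..<L}"
    then have x': "L - x \<in> {0<..<L}" by auto
    show "((\<lambda>x. u (L - x)) has_real_derivative - v (L - x)) (at x)"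
      using assms x' unfolding pendulum_def by (blast intro: d)
    have "((\<lambda>x. v (L - x)) has_real_derivative - (- c * sin (u (L - x)))) (at x)"
      using assms x' unfolding pendulum_def by (blast intro: d)
    from DERIV_minus[OF this]
    show "((\<lambda>x. - v (L - x)) has_real_derivative - c * sin (u (L - x))) (at x)" by simp
  next
    show "\<exists>x\<in>{0..L}. u (L - x) \<noteq> 0"
      using x0 by (intro bexI[of _ "L - x0"]) auto
  qed (use assms in \<open>auto simp: pendulum_def\<close>)
qed

context
  fixes L c :: real and u v :: "real \<Rightarrow> real"
  assumes pendulum: "pendulum L c u v"
begin

lemma pendulum_facts:
  "L > 0" "c > 0" "continuous_on {0..L} u" "continuous_on {0..L} v"
  "\<And>x. 0 < x \<Longrightarrow> x < L \<Longrightarrow> (u has_real_derivative v x) (at x)"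
  "\<And>x. 0 < x \<Longrightarrow> x < L \<Longrightarrow> (v has_real_derivative - c * sin (u x)) (at x)"
  "\<And>x. 0 \<le> x \<Longrightarrow> x \<le> L \<Longrightarrow> 0 \<le> u x" "\<And>x. 0 \<le> x \<Longrightarrow> x \<le> L \<Longrightarrow> u x \<le> pi"
  using pendulum unfolding pendulum_def by auto

text \<open>Since \<open>u\<close> takes values in \<open>[0, \<pi>]\<close>, the acceleration \<open>- c sin u\<close> is nonpositive, so \<open>u\<close> is
  concave.\<close>

lemma velocity_antimono:
  assumes "0 \<le> x" "x \<le> y" "y \<le> L"
  shows "v y \<le> v x"
proof (rule DERIV_nonpos_imp_decreasing_open[OF assms(2)])
  fix z assume z: "x < z" "z < y"
  have "c * sin (u z) \<ge> 0"
    using pendulum_facts(2) pendulum_facts(7,8)[of z] assms z by (auto intro!: mult_nonneg_nonneg sin_ge_zero)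
  then show "\<exists>D. (v has_real_derivative D) (at z) \<and> D \<le> 0"
    using pendulum_facts(6)[of z] assms z by (intro exI[of _ "- c * sin (u z)"]) auto
next
  show "continuous_on {x..y} v"
    by (rule continuous_on_subset[OF pendulum_facts(4)]) (use assms in auto)
qed

lemma no_increase_if_velocity_nonpos:
  assumes "0 \<le> x" "x \<le> y" "y \<le> L" "v x \<le> 0"
  shows "u y \<le> u x"
proof (rule DERIV_nonpos_imp_decreasing_open[OF assms(2)])
  fix z assume z: "x < z" "z < y"
  have "v z \<le> 0" using velocity_antimono[of x z] assms z by simp
  then show "\<exists>D. (u has_real_derivative D) (at z) \<and> D \<le> 0"
    using pendulum_facts(5)[of z] assms z by (intro exI[of _ "v z"]) auto
next
  show "continuous_on {x..y} u"
    by (rule continuous_on_subset[OF pendulum_facts(3)]) (use assms in auto)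
qed

lemma no_decrease_if_velocity_nonneg:
  assumes "0 \<le> x" "x \<le> y" "y \<le> L" "v y \<ge> 0"
  shows "u x \<le> u y"
proof (rule DERIV_nonneg_imp_increasing_open[OF assms(2)])
  fix z assume z: "x < z" "z < y"
  have "v z \<ge> 0" using velocity_antimono[of z y] assms z by simp
  then show "\<exists>D. (u has_real_derivative D) (at z) \<and> D \<ge> 0"
    using pendulum_facts(5)[of z] assms z by (intro exI[of _ "v z"]) auto
next
  show "continuous_on {x..y} u"
    by (rule continuous_on_subset[OF pendulum_facts(3)]) (use assms in auto)
qed

text \<open>A concave nonnegative function that vanishes at an interior point vanishes identically.\<close>

lemma pendulum_pos:
  assumes x: "0 < x" "x < L"
  shows "u x > 0"
proof (rule ccontr)
  assume "\<not> u x > 0"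
  then have u0: "u x = 0" using pendulum_facts(7)[of x] x by simp
  have "v x = 0"
  proof (rule DERIV_local_min[OF pendulum_facts(5)[OF x]])
    show "min x (L - x) > 0" using x by simp
    show "\<forall>y. \<bar>x - y\<bar> < min x (L - x) \<longrightarrow> u x \<le> u y"
      using u0 pendulum_facts(7) by (auto simp: abs_if split: if_splits)
  qed
  then have "u y \<le> 0" if "0 \<le> y" "y \<le> L" for y
    using no_increase_if_velocity_nonpos[of x y] no_decrease_if_velocity_nonneg[of y x] u0 x that
    by (cases "x \<le> y") auto
  then have "u y = 0" if "y \<in> {0..L}" for y
    using pendulum_facts(7)[of y] that by force
  then show False
    using pendulum unfolding pendulum_def by blast
qed

lemma initial_velocity_pos:
  assumes "u 0 = 0"
  shows "v 0 > 0"
proof (rule ccontr)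
  assume "\<not> v 0 > 0"
  then have "u (L/2) \<le> u 0"
    using pendulum_facts(1) by (intro no_increase_if_velocity_nonpos) auto
  then show False
    using assms pendulum_pos[of "L/2"] pendulum_facts(1) by simp
qed

text \<open>If \<open>u 0 > 0\<close> this is continuity. If \<open>u 0 = 0\<close>, then \<open>u x\<close> grows at least linearly, while finite
  energy gives \<open>\<psi>(x)\<^sup>2 = o(x)\<close>.\<close>

lemma Picone_boundary_term_left:
  fixes \<psi> M :: "real \<Rightarrow> real"
  assumes \<psi>: "continuous_on {0..L} \<psi>" and M: "continuous_on {0..L} M"
    and dom: "energy_dominated 0 L \<psi> M" and eq: "\<psi> 0 = u 0"
  shows "((\<lambda>x. (\<psi> x)\<^sup>2 * (v x / u x) - u x * v x) \<longlongrightarrow> 0) (at_right 0)"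
proof -
  have lim: "(f \<longlongrightarrow> f 0) (at_right 0)" if "continuous_on {0..L} f" for f :: "real \<Rightarrow> real"
  proof -
    have "(f \<longlongrightarrow> f 0) (at 0 within {0..L})"
      using that pendulum_facts(1) unfolding continuous_on_def by simp
    then show ?thesis
      using pendulum_facts(1) by (simp add: at_within_Icc_at_right)
  qed
  note lims = lim[OF \<psi>] lim[OF M] lim[OF pendulum_facts(3)] lim[OF pendulum_facts(4)]
  show ?thesis
  proof (cases "u 0 = 0")
    case False
    have "((\<lambda>x. (\<psi> x)\<^sup>2 * (v x / u x) - u x * v x) \<longlongrightarrow> (\<psi> 0)\<^sup>2 * (v 0 / u 0) - u 0 * v 0) (at_right 0)"
      by (intro tendsto_intros lims False)
    then show ?thesis
      using False eq by (simp add: power2_eq_square)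
  next
    case True
    have v0: "v 0 > 0" by (rule initial_velocity_pos[OF True])
    obtain \<delta> where \<delta>: "\<delta> > 0" "\<And>s t. 0 \<le> s \<Longrightarrow> s < t \<Longrightarrow> t \<le> L \<Longrightarrow> t - s < \<delta> \<Longrightarrow>
        (\<psi> t - \<psi> s)\<^sup>2 \<le> (1 + 1) * (t - s) * (M t - M s)"
      using dom unfolding energy_dominated_def by (meson zero_less_one)
    have "\<forall>\<^sub>F x in at_right 0. v x > v 0 / 2"
      by (rule order_tendstoD(1)[OF lims(4)]) (use v0 in simp)
    then obtain d where d: "d > 0" "\<And>x. 0 < x \<Longrightarrow> x < d \<Longrightarrow> v x > v 0 / 2"
      by (auto simp: eventually_at_right_field)
    define e where "e = min (min d \<delta>) L"
    have e: "e > 0" "e \<le> d" "e \<le> \<delta>" "e \<le> L"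
      using d \<delta> pendulum_facts(1) by (auto simp: e_def)
    have ulow: "u x \<ge> x * (v 0 / 2)" if x: "0 < x" "x < e" for x
    proof -
      have "(\<lambda>x. u x - x * (v 0 / 2)) 0 \<le> (\<lambda>x. u x - x * (v 0 / 2)) x"
      proof (rule DERIV_nonneg_imp_increasing_open[where f = "\<lambda>x. u x - x * (v 0 / 2)" and a = 0 and b = x])
        fix z assume z: "0 < z" "z < x"
        have "((\<lambda>x. u x - x * (v 0 / 2)) has_real_derivative v z - v 0 / 2) (at z)"
          using pendulum_facts(5)[of z] z x e by (auto intro!: derivative_eq_intros)
        then show "\<exists>D. ((\<lambda>x. u x - x * (v 0 / 2)) has_real_derivative D) (at z) \<and> D \<ge> 0"
          using d(2)[of z] z x e by (intro exI[of _ "v z - v 0 / 2"]) auto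
      next
        show "continuous_on {0..x} (\<lambda>x. u x - x * (v 0 / 2))"
          by (intro continuous_intros continuous_on_subset[OF pendulum_facts(3)]) (use x e in auto)
      qed (use x in simp)
      then show ?thesis using True by simp
    qed
    (* The choice epsilon = 1 gives psi(x)^2 <= 2 x (M x - M 0), and u(x) >= x v(0) / 2. *)
    have bound: "norm ((\<psi> x)\<^sup>2 * (v x / u x)) \<le> 4 / v 0 * (M x - M 0) * \<bar>v x\<bar>"
      if x: "0 < x" "x < e" for x
    proof -
      have ux: "u x > 0" using pendulum_pos[of x] x e by simp
      have 1: "(\<psi> x)\<^sup>2 \<le> 2 * x * (M x - M 0)"
        using \<delta>(2)[of 0 x] x e eq True by simp
      have Mx: "M x - M 0 \<ge> 0"
      proof (rule ccontr)
        assume "\<not> M x - M 0 \<ge> 0"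
        then have "2 * x * (M x - M 0) < 0" using x by (intro mult_pos_neg) auto
        then show False using 1 zero_le_power2[of "\<psi> x"] by linarith
      qed
      have "(\<psi> x)\<^sup>2 / u x \<le> (2 * x * (M x - M 0)) / (x * (v 0 / 2))"
        using 1 ulow[OF x] x v0 Mx by (intro frac_le) auto
      also have "\<dots> = 4 / v 0 * (M x - M 0)"
        using x v0 by (simp add: field_simps)
      finally have "(\<psi> x)\<^sup>2 / u x * \<bar>v x\<bar> \<le> 4 / v 0 * (M x - M 0) * \<bar>v x\<bar>"
        by (intro mult_right_mono) auto
      then show ?thesis
        using ux by (simp add: abs_mult)
    qed
    have "((\<lambda>x. 4 / v 0 * (M x - M 0) * \<bar>v x\<bar>) \<longlongrightarrow> 4 / v 0 * (M 0 - M 0) * \<bar>v 0\<bar>) (at_right 0)"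
      by (intro tendsto_intros lims)
    then have "((\<lambda>x. 4 / v 0 * (M x - M 0) * \<bar>v x\<bar>) \<longlongrightarrow> 0) (at_right 0)" by simp
    then have "((\<lambda>x. (\<psi> x)\<^sup>2 * (v x / u x)) \<longlongrightarrow> 0) (at_right 0)"
      by (rule Lim_null_comparison[rotated])
        (use e bound in \<open>auto simp: eventually_at_right_field intro!: exI[of _ e]\<close>)
    moreover have "((\<lambda>x. u x * v x) \<longlongrightarrow> u 0 * v 0) (at_right 0)"
      by (intro tendsto_intros lims)
    ultimately have "((\<lambda>x. (\<psi> x)\<^sup>2 * (v x / u x) - u x * v x) \<longlongrightarrow> 0 - u 0 * v 0) (at_right 0)"
      by (rule tendsto_diff)
    then show ?thesis using True by simp
  qed
qed

end

lemma Picone_boundary_term_right: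
  fixes \<psi> M :: "real \<Rightarrow> real"
  assumes p: "pendulum L c u v" and \<psi>: "continuous_on {0..L} \<psi>" and M: "continuous_on {0..L} M"
    and dom: "energy_dominated 0 L \<psi> M" and eq: "\<psi> L = u L"
  shows "((\<lambda>x. (\<psi> x)\<^sup>2 * (v x / u x) - u x * v x) \<longlongrightarrow> 0) (at_left L)"
proof -
  have c: "continuous_on {0..L} (\<lambda>x. f (L - x))" if "continuous_on {0..L} f" for f :: "real \<Rightarrow> real"
    by (rule continuous_on_compose2[OF that]) (auto intro!: continuous_intros)
  have "((\<lambda>x. (\<psi> (L - x))\<^sup>2 * (- v (L - x) / u (L - x)) - u (L - x) * - v (L - x)) \<longlongrightarrow> 0) (at_right 0)"
  proof (rule Picone_boundary_term_left[OF pendulum_reflect[OF p]])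
    show "continuous_on {0..L} (\<lambda>x. \<psi> (L - x))" "continuous_on {0..L} (\<lambda>x. - M (L - x))"
      by (intro c \<psi> M continuous_intros)+
    show "energy_dominated 0 L (\<lambda>x. \<psi> (L - x)) (\<lambda>x. - M (L - x))"
      unfolding energy_dominated_def
    proof (intro allI impI)
      fix \<epsilon> :: real assume "\<epsilon> > 0"
      then obtain \<delta> where \<delta>: "\<delta> > 0" "\<And>s t. 0 \<le> s \<Longrightarrow> s < t \<Longrightarrow> t \<le> L \<Longrightarrow> t - s < \<delta> \<Longrightarrow>
        (\<psi> t - \<psi> s)\<^sup>2 \<le> (1 + \<epsilon>) * (t - s) * (M t - M s)"
        using dom unfolding energy_dominated_def by meson
      show "\<exists>\<delta>>0. \<forall>s t. 0 \<le> s \<longrightarrow> s < t \<longrightarrow> t \<le> L \<longrightarrow> t - s < \<delta> \<longrightarrow>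
        (\<psi> (L - t) - \<psi> (L - s))\<^sup>2 \<le> (1 + \<epsilon>) * (t - s) * (- M (L - t) - - M (L - s))"
      proof (intro exI[of _ \<delta>] conjI allI impI)
        fix s t assume "0 \<le> s" "s < t" "t \<le> L" "t - s < \<delta>"
        then show "(\<psi> (L - t) - \<psi> (L - s))\<^sup>2 \<le> (1 + \<epsilon>) * (t - s) * (- M (L - t) - - M (L - s))"
          using \<delta>(2)[of "L - t" "L - s"] by (simp add: power2_commute)
      qed (rule \<delta>)
    qed
  qed (use eq in simp)
  then have "((\<lambda>x. - ((\<psi> (L - x))\<^sup>2 * (v (L - x) / u (L - x)) - u (L - x) * v (L - x))) \<longlongrightarrow> - 0) (at_right 0)"
    by simp
  then have "((\<lambda>x. (\<psi> (L - x))\<^sup>2 * (v (L - x) / u (L - x)) - u (L - x) * v (L - x)) \<longlongrightarrow> 0) (at_right 0)"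
    by (simp only: tendsto_minus_cancel_left[symmetric] minus_zero)
  then show ?thesis
    using filterlim_at_left_to_right[of "\<lambda>x. (\<psi> x)\<^sup>2 * (v x / u x) - u x * v x" "nhds 0" L]
    by (simp add: filterlim_at_right_to_0[of _ _ "- L"] algebra_simps)
qed


section \<open>Minimality of the pendulum solution\<close>

text \<open>Minimality of \<open>u\<close> for \<open>\<integral> \<psi>'\<^sup>2 + 2c cos \<psi>\<close>, with \<open>M\<close> as a bound for the kinetic part. The defect is
  at least the integral of the nonnegative function \<open>gap\<close>, the distance of the convex potential from its
  tangent line, and this vanishes only where \<open>\<psi> = u\<close>.\<close>

lemma pendulum_minimises:
  fixes \<psi> M :: "real \<Rightarrow> real"
  assumes p: "pendulum L c u v" and \<psi>: "continuous_on {0..L} \<psi>" and M: "continuous_on {0..L} M"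
    and dom: "energy_dominated 0 L \<psi> M"
    and range: "\<And>x. x \<in> {0..L} \<Longrightarrow> 0 \<le> \<psi> x \<and> \<psi> x \<le> pi"
    and eq0: "\<psi> 0 = u 0" and eqL: "\<psi> L = u L"
  shows "integral {0..L} (\<lambda>x. (v x)\<^sup>2) + 2 * c * integral {0..L} (\<lambda>x. cos (u x))
      \<le> M L - M 0 + 2 * c * integral {0..L} (\<lambda>x. cos (\<psi> x))" (is ?le)
    and "integral {0..L} (\<lambda>x. (v x)\<^sup>2) + 2 * c * integral {0..L} (\<lambda>x. cos (u x))
      = M L - M 0 + 2 * c * integral {0..L} (\<lambda>x. cos (\<psi> x)) \<Longrightarrow> x \<in> {0..L} \<Longrightarrow> \<psi> x = u x"
proof -
  note pf = pendulum_facts[OF p]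
  have upos: "u x > 0" if "0 < x" "x < L" for x
    using pendulum_pos[OF p] that by blast
  define w where "w x = 2 * c * cos (\<psi> x) - (v x)\<^sup>2 - 2 * c * cos (u x)" for x
  define E where "E x = M x + integral {0..x} w" for x
  define B where "B x = (\<psi> x)\<^sup>2 * (v x / u x) - u x * v x" for x
  define G where "G x = E x - B x" for x
  define r where "r x = c * sin (u x) / u x" for x
  define gap where "gap x = 2 * c * (cos (\<psi> x) + sin (u x) / u x / 2 * ((\<psi> x)\<^sup>2 - (u x)\<^sup>2) - cos (u x))" for x
  have cw: "continuous_on {0..L} w"
    unfolding w_def by (intro continuous_intros \<psi> pf)
  have cE: "continuous_on {0..L} E"
    unfolding E_def by (intro continuous_intros M indefinite_integral_continuous_1 integrable_continuous_real cw)
  have gap_nonneg: "gap x \<ge> 0" and gap_0: "gap x = 0 \<Longrightarrow> \<psi> x = u x" if x: "0 < x" "x < L" for x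
  proof -
    have "gap x > 0" if "\<psi> x \<noteq> u x"
      using cos_sqrt_strictly_convex[of "u x" "\<psi> x"] upos[OF x] pf(8)[of x] range[of x] x pf(2) that
      by (simp add: gap_def)
    moreover have "gap x = 0" if "\<psi> x = u x" using that by (simp add: gap_def)
    ultimately show "gap x \<ge> 0" "gap x = 0 \<Longrightarrow> \<psi> x = u x"
      by (cases "\<psi> x = u x"; force)+
  qed
  have sub: "continuous_on {\<alpha>..\<beta>} f" if "continuous_on {0..L} f" "0 < \<alpha>" "\<beta> < L" for f :: "real \<Rightarrow> real" and \<alpha> \<beta>
    by (rule continuous_on_subset[OF that(1)]) (use that in auto)
  have c_r: "continuous_on {\<alpha>..\<beta>} r" and c_gap: "continuous_on {\<alpha>..\<beta>} gap" if "0 < \<alpha>" "\<beta> < L" for \<alpha> \<beta>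
  proof -
    have ne: "\<forall>x\<in>{\<alpha>..\<beta>}. u x \<noteq> 0"
    proof
      fix x assume "x \<in> {\<alpha>..\<beta>}"
      then have "0 < x" "x < L" using that by auto
      from upos[OF this] show "u x \<noteq> 0" by simp
    qed
    note cu = sub[OF pf(3) that] and c\<psi> = sub[OF \<psi> that]
    show "continuous_on {\<alpha>..\<beta>} r"
      unfolding r_def by (intro continuous_intros cu ne)
    show "continuous_on {\<alpha>..\<beta>} gap"
      unfolding gap_def by (intro continuous_intros cu c\<psi> ne) simp
  qed
  (* Picone's inequality for psi, and its case of equality psi = u in the form of integration by parts for
     u v, subtracted from each other. *)
  have incr: "G \<beta> - G \<alpha> \<ge> integral {\<alpha>..\<beta>} gap" if ab: "0 < \<alpha>" "\<alpha> \<le> \<beta>" "\<beta> < L" for \<alpha> \<beta>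
  proof -
    have "(\<psi> \<beta>)\<^sup>2 * (v \<beta> / u \<beta>) - (\<psi> \<alpha>)\<^sup>2 * (v \<alpha> / u \<alpha>) + integral {\<alpha>..\<beta>} (\<lambda>x. r x * (\<psi> x)\<^sup>2) \<le> M \<beta> - M \<alpha>"
    proof (rule Picone_inequality[where q = "\<lambda>x. v x / u x", OF ab(2) _ c_r[OF ab(1,3)] sub[OF \<psi> ab(1,3)]])
      fix x assume "x \<in> {\<alpha>..\<beta>}"
      then have x: "0 < x" "x < L" using ab by auto
      have "((\<lambda>x. v x / u x) has_real_derivative ((- c * sin (u x)) * u x - v x * v x) / (u x * u x)) (at x)"
        by (rule DERIV_divide[OF pf(6)[OF x] pf(5)[OF x]]) (use upos[OF x] in simp)
      also have "((- c * sin (u x)) * u x - v x * v x) / (u x * u x) = - r x - (v x / u x)\<^sup>2"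
        using upos[OF x] by (simp add: r_def field_simps power2_eq_square)
      finally show "((\<lambda>x. v x / u x) has_real_derivative - r x - (v x / u x)\<^sup>2) (at x)" .
    next
      show "energy_dominated \<alpha> \<beta> \<psi> M"
        unfolding energy_dominated_def
      proof (intro allI impI)
        fix \<epsilon> :: real assume "\<epsilon> > 0"
        then obtain \<delta> where \<delta>: "\<delta> > 0" "\<And>s t. 0 \<le> s \<Longrightarrow> s < t \<Longrightarrow> t \<le> L \<Longrightarrow> t - s < \<delta> \<Longrightarrow>
          (\<psi> t - \<psi> s)\<^sup>2 \<le> (1 + \<epsilon>) * (t - s) * (M t - M s)"
          using dom unfolding energy_dominated_def by meson
        show "\<exists>\<delta>>0. \<forall>s t. \<alpha> \<le> s \<longrightarrow> s < t \<longrightarrow> t \<le> \<beta> \<longrightarrow> t - s < \<delta> \<longrightarrow>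
          (\<psi> t - \<psi> s)\<^sup>2 \<le> (1 + \<epsilon>) * (t - s) * (M t - M s)"
          using \<delta> ab by (intro exI[of _ \<delta>]) auto
      qed
    qed
    moreover have "((\<lambda>x. (v x)\<^sup>2 - c * u x * sin (u x)) has_integral u \<beta> * v \<beta> - u \<alpha> * v \<alpha>) {\<alpha>..\<beta>}"
    proof (rule fundamental_theorem_of_calculus[OF ab(2)])
      fix x assume "x \<in> {\<alpha>..\<beta>}"
      then have x: "0 < x" "x < L" using ab by auto
      have "((\<lambda>x. u x * v x) has_real_derivative v x * v x + (- c * sin (u x)) * u x) (at x)"
        by (rule DERIV_mult[OF pf(5)[OF x] pf(6)[OF x]])
      also have "v x * v x + (- c * sin (u x)) * u x = (v x)\<^sup>2 - c * u x * sin (u x)"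
        by (simp add: power2_eq_square)
      finally have "((\<lambda>x. u x * v x) has_real_derivative (v x)\<^sup>2 - c * u x * sin (u x)) (at x within {\<alpha>..\<beta>})"
        by (rule has_field_derivative_at_within)
      then show "((\<lambda>x. u x * v x) has_vector_derivative (v x)\<^sup>2 - c * u x * sin (u x)) (at x within {\<alpha>..\<beta>})"
        by (simp only: has_real_derivative_iff_has_vector_derivative)
    qed
    then have "((\<lambda>x. w x + r x * (\<psi> x)\<^sup>2 + ((v x)\<^sup>2 - c * u x * sin (u x))) has_integral
        integral {\<alpha>..\<beta>} w + integral {\<alpha>..\<beta>} (\<lambda>x. r x * (\<psi> x)\<^sup>2) + (u \<beta> * v \<beta> - u \<alpha> * v \<alpha>)) {\<alpha>..\<beta>}"
      by (intro has_integral_add integrable_integral integrable_continuous_real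
          continuous_on_mult continuous_on_power sub[OF cw ab(1,3)] sub[OF \<psi> ab(1,3)] c_r[OF ab(1,3)])
    then have "(gap has_integral
        integral {\<alpha>..\<beta>} w + integral {\<alpha>..\<beta>} (\<lambda>x. r x * (\<psi> x)\<^sup>2) + (u \<beta> * v \<beta> - u \<alpha> * v \<alpha>)) {\<alpha>..\<beta>}"
    proof (rule has_integral_eq[rotated])
      fix x assume "x \<in> {\<alpha>..\<beta>}"
      then have "u x > 0" using ab upos by auto
      then show "w x + r x * (\<psi> x)\<^sup>2 + ((v x)\<^sup>2 - c * u x * sin (u x)) = gap x"
        by (simp add: w_def r_def gap_def field_simps power2_eq_square)
    qed
    then have "integral {\<alpha>..\<beta>} gap =
        integral {\<alpha>..\<beta>} w + integral {\<alpha>..\<beta>} (\<lambda>x. r x * (\<psi> x)\<^sup>2) + (u \<beta> * v \<beta> - u \<alpha> * v \<alpha>)"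
      by (rule integral_unique)
    moreover have "integral {0..\<beta>} w = integral {0..\<alpha>} w + integral {\<alpha>..\<beta>} w"
      using ab by (intro Henstock_Kurzweil_Integration.integral_combine[symmetric]
          integrable_continuous_real continuous_on_subset[OF cw]) auto
    ultimately show ?thesis
      unfolding G_def E_def B_def by linarith
  qed
  have int_gap: "integral {\<alpha>..\<beta>} gap \<ge> 0" if "0 < \<alpha>" "\<beta> < L" for \<alpha> \<beta>
    using that c_gap[OF that] gap_nonneg
    by (intro Henstock_Kurzweil_Integration.integral_nonneg integrable_continuous_real) auto
  have "(E \<longlongrightarrow> E 0) (at 0 within {0..L})" "(E \<longlongrightarrow> E L) (at L within {0..L})"
    using cE pf(1) unfolding continuous_on_def by auto
  then have limE: "(E \<longlongrightarrow> E 0) (at_right 0)" "(E \<longlongrightarrow> E L) (at_left L)"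
    using pf(1) by (auto simp: at_within_Icc_at_right at_within_Icc_at_left)
  (* The boundary term B tends to zero at both ends, so the increments of G exhaust those of E. *)
  have limG: "(G \<longlongrightarrow> E 0) (at_right 0)" "(G \<longlongrightarrow> E L) (at_left L)"
    using tendsto_diff[OF limE(1) Picone_boundary_term_left[OF p \<psi> M dom eq0]]
      tendsto_diff[OF limE(2) Picone_boundary_term_right[OF p \<psi> M dom eqL]]
    unfolding G_def B_def by simp_all
  have main: "integral {\<alpha>..\<beta>} gap \<le> E L - E 0" if ab: "0 < \<alpha>" "\<alpha> \<le> \<beta>" "\<beta> < L" for \<alpha> \<beta>
  proof -
    have "G s \<le> G t" if "0 < s" "s \<le> t" "t < L" for s t
      using incr[OF that] int_gap[OF that(1,3)] by simp
    from increment_le_if_one_sided_limits[OF ab this limG] show ?thesis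
      using incr[OF ab] by simp
  qed
  have "(w has_integral 2 * c * integral {0..L} (\<lambda>x. cos (\<psi> x)) - integral {0..L} (\<lambda>x. (v x)\<^sup>2)
      - 2 * c * integral {0..L} (\<lambda>x. cos (u x))) {0..L}"
    unfolding w_def
    by (intro has_integral_diff has_integral_mult_right integrable_integral integrable_continuous_real
        continuous_on_cos continuous_on_power pf \<psi>)
  then have EL: "E L - E 0 = M L - M 0 + 2 * c * integral {0..L} (\<lambda>x. cos (\<psi> x))
      - integral {0..L} (\<lambda>x. (v x)\<^sup>2) - 2 * c * integral {0..L} (\<lambda>x. cos (u x))"
    by (simp add: E_def integral_unique)
  have "E L - E 0 \<ge> 0"
    using main[of "L/2" "L/2"] pf(1) by simp
  then show ?le using EL by simp
  show "\<psi> x = u x" if eq: "integral {0..L} (\<lambda>x. (v x)\<^sup>2) + 2 * c * integral {0..L} (\<lambda>x. cos (u x))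
      = M L - M 0 + 2 * c * integral {0..L} (\<lambda>x. cos (\<psi> x))" and x: "x \<in> {0..L}"
  proof -
    consider "x = 0" | "x = L" | "0 < x" "x < L" using x by force
    then show ?thesis
    proof cases
      case 3
      define \<alpha> where "\<alpha> = x / 2"
      define \<beta> where "\<beta> = (x + L) / 2"
      have ab: "0 < \<alpha>" "\<alpha> \<le> x" "x < \<beta>" "\<beta> < L" "\<alpha> < \<beta>" using 3 by (auto simp: \<alpha>_def \<beta>_def)
      have "integral {\<alpha>..\<beta>} gap = 0"
        using main[of \<alpha> \<beta>] int_gap[of \<alpha> \<beta>] ab EL eq by simp
      then have "\<forall>y\<in>{\<alpha>..\<beta>}. gap y = 0"
        using integral_eq_0_iff[OF c_gap[OF ab(1,4)] ab(5)] gap_nonneg ab by auto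
      then show ?thesis
        using gap_0[OF 3] ab by auto
    qed (use eq0 eqL in auto)
  qed
qed


section \<open>Plane arc-length curves and their energy\<close>

text \<open>The counterclockwise rotation by \<open>\<pi>/2\<close>.\<close>

definition rot :: "real^2 \<Rightarrow> real^2" where
  "rot v = vector [- (v $ 2), v $ 1]"

lemma rot_component [simp]: "rot v $ 1 = - (v $ 2)" "rot v $ 2 = v $ 1"
  by (simp_all add: rot_def)

lemma normal_vec_eq_rot: "normal_vec L \<gamma> s = rot (tangent L \<gamma> s)"
  by (simp add: normal_vec_def rot_def)

lemma inner_R2: "inner v w = v $ 1 * w $ 1 + v $ 2 * w $ 2" for v w :: "real^2"
  by (simp add: inner_vec_def sum_2)

lemma bounded_linear_rot: "bounded_linear rot"
  by (rule linear_conv_bounded_linear[THEN iffD1], rule linearI)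
    (simp_all add: vec_eq_iff forall_2)

lemma norm_rot [simp]: "norm (rot v) = norm v"
  by (simp add: norm_eq_sqrt_inner inner_R2 add.commute)

lemma rot_rot [simp]: "rot (rot v) = - v"
  by (simp add: vec_eq_iff forall_2)

lemma orthonormal_expansion:
  assumes "norm v = 1"
  shows "x = inner x v *\<^sub>R v + inner x (rot v) *\<^sub>R rot v"
proof -
  have "v $ 1 * v $ 1 + v $ 2 * v $ 2 = 1"
    using assms by (simp add: norm_eq_sqrt_inner inner_R2)
  then show ?thesis
    unfolding vec_eq_iff forall_2 inner_R2 vector_add_component vector_scaleR_component
      rot_component real_scaleR_def
    by algebra
qed

lemma inner_orthonormal:
  assumes "norm e = 1"
  shows "inner x y = inner e x * inner e y + inner e (rot x) * inner e (rot y)"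
proof -
  have "e $ 1 * e $ 1 + e $ 2 * e $ 2 = 1"
    using assms by (simp add: norm_eq_sqrt_inner inner_R2)
  then show ?thesis
    unfolding inner_R2 rot_component by algebra
qed

lemma test_function_deriv:
  assumes "\<phi> \<in> test_functions L"
  shows "deriv \<phi> \<in> test_functions L"
proof -
  have sm: "smooth \<phi>"
    using assms by (simp add: test_functions_def smooth_def)
  obtain K where K: "compact K" "K \<subseteq> {0<..<L}" "\<And>s. s \<notin> K \<Longrightarrow> \<phi> s = 0"
    using assms unfolding test_functions_def by blast
  have "deriv \<phi> s = 0" if s: "s \<notin> K" for s
  proof -
    have "open (- K)" using K(1) compact_imp_closed by auto
    then have "\<forall>\<^sub>F x in nhds s. \<phi> x = 0"
      using eventually_nhds_in_open[of "- K" s] s K(3) by (auto elim!: eventually_mono)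
    from deriv_cong_ev[OF this refl] show ?thesis by simp
  qed
  moreover have "smooth (deriv \<phi>)" by (rule smooth_deriv[OF sm])
  ultimately show ?thesis
    unfolding test_functions_def smooth_def using K by blast
qed

lemma test_function_higher_deriv:
  "\<phi> \<in> test_functions L \<Longrightarrow> (deriv ^^ n) \<phi> \<in> test_functions L"
  by (induction n) (simp_all add: test_function_deriv)

lemma test_function_integrable:
  fixes h :: "real \<Rightarrow> 'a::euclidean_space"
  assumes \<phi>: "\<phi> \<in> test_functions L" and h: "locally_integrable L h"
  shows "(\<lambda>s. \<phi> s *\<^sub>R h s) absolutely_integrable_on {0<..<L}"
proof -
  obtain K where K: "compact K" "K \<subseteq> {0<..<L}" "\<And>s. s \<notin> K \<Longrightarrow> \<phi> s = 0"
    using \<phi> unfolding test_functions_def by blast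
  have "smooth \<phi>" using \<phi> by (simp add: test_functions_def smooth_def)
  then have c: "continuous_on K \<phi>"
    using smooth_isCont continuous_at_imp_continuous_on by blast
  have Km: "K \<in> sets lebesgue"
    using K(1) lmeasurable_compact by blast
  have "(\<lambda>s. \<phi> s *\<^sub>R h s) absolutely_integrable_on K"
  proof (rule absolutely_integrable_bounded_measurable_product[where h = scaleR])
    show "bilinear (\<lambda>x (y::'a). x *\<^sub>R y)"
      by (simp add: bilinear_conv_bounded_bilinear bounded_bilinear_scaleR)
    show "\<phi> \<in> borel_measurable (lebesgue_on K)"
      by (rule continuous_imp_measurable_on_sets_lebesgue[OF c Km])
    show "bounded (\<phi> ` K)"
      using c K(1) compact_continuous_image compact_imp_bounded by blast
    show "h absolutely_integrable_on K"
      using h K(1,2) unfolding locally_integrable_def by blast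
  qed (rule Km)
  then show ?thesis
    by (rule absolutely_integrable_on_superset) (use K in auto)
qed

lemma locally_integrable_spike:
  assumes "locally_integrable L f" "negligible N" "\<And>s. s \<in> {0<..<L} - N \<Longrightarrow> g s = f s"
  shows "locally_integrable L g"
  unfolding locally_integrable_def
proof (intro allI impI)
  fix K assume K: "compact K \<and> K \<subseteq> {0<..<L}"
  then have "f absolutely_integrable_on K"
    using assms(1) unfolding locally_integrable_def by blast
  then show "g absolutely_integrable_on K"
    by (rule absolutely_integrable_spike[OF _ assms(2)]) (use assms(3) K in auto)
qed

lemma LINT_spike:
  fixes f g :: "real \<Rightarrow> 'a::euclidean_space"
  assumes f: "f absolutely_integrable_on {0<..<L}"
    and N: "negligible N" "\<And>s. s \<in> {0<..<L} - N \<Longrightarrow> g s = f s"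
  shows "(LINT s:{0<..<L}|lebesgue. g s) = (LINT s:{0<..<L}|lebesgue. f s)"
proof -
  have g: "g absolutely_integrable_on {0<..<L}"
    by (rule absolutely_integrable_spike[OF f N])
  have "integral {0<..<L} f = integral {0<..<L} g"
    by (rule integral_spike[OF N(1)]) (use N(2) in auto)
  then show ?thesis
    by (simp only: set_lebesgue_integral_eq_integral(2)[OF f] set_lebesgue_integral_eq_integral(2)[OF g])
qed

lemma weak_derivative_spike:
  fixes f g h1 h2 :: "real \<Rightarrow> 'a::euclidean_space"
  assumes weak: "weak_derivative n L f h1" and N: "negligible N"
    and eq: "\<And>s. s \<in> {0<..<L} - N \<Longrightarrow> g s = f s" "\<And>s. s \<in> {0<..<L} - N \<Longrightarrow> h2 s = h1 s"
  shows "weak_derivative n L g h2"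
proof -
  have li: "locally_integrable L f" "locally_integrable L h1"
    using weak by (simp_all add: weak_derivative_def)
  show ?thesis
    unfolding weak_derivative_def
  proof (intro conjI ballI)
    show "locally_integrable L g" "locally_integrable L h2"
      using locally_integrable_spike[OF li(1) N] locally_integrable_spike[OF li(2) N] eq by blast+
    fix \<phi> assume \<phi>: "\<phi> \<in> test_functions L"
    have "(LINT s:{0<..<L}|lebesgue. (deriv ^^ n) \<phi> s *\<^sub>R g s) = (LINT s:{0<..<L}|lebesgue. (deriv ^^ n) \<phi> s *\<^sub>R f s)"
      by (rule LINT_spike[OF test_function_integrable[OF test_function_higher_deriv[OF \<phi>] li(1)] N])
        (simp add: eq)
    moreover have "(LINT s:{0<..<L}|lebesgue. \<phi> s *\<^sub>R h2 s) = (LINT s:{0<..<L}|lebesgue. \<phi> s *\<^sub>R h1 s)"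
      by (rule LINT_spike[OF test_function_integrable[OF \<phi> li(2)] N]) (simp add: eq)
    ultimately show "(LINT s:{0<..<L}|lebesgue. (deriv ^^ n) \<phi> s *\<^sub>R g s) =
        (-1) ^ n *\<^sub>R (LINT s:{0<..<L}|lebesgue. \<phi> s *\<^sub>R h2 s)"
      using weak \<phi> unfolding weak_derivative_def by simp
  qed
qed

text \<open>The interval has finite length and \<open>x \<le> 1 + x\<^sup>2\<close>.\<close>

lemma square_integrable_imp_integrable:
  fixes h :: "real \<Rightarrow> 'a::euclidean_space"
  assumes "square_integrable L h"
  shows "h absolutely_integrable_on {0<..<L}"
proof (rule measurable_bounded_by_integrable_imp_absolutely_integrable)
  show "h \<in> borel_measurable (lebesgue_on {0<..<L})"
    using assms by (simp add: square_integrable_def)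
  have "(\<lambda>s. (norm (h s))\<^sup>2) integrable_on {0<..<L}"
    using assms unfolding square_integrable_def absolutely_integrable_on_def by blast
  moreover have "(\<lambda>s. 1::real) integrable_on {0<..<L}"
    using integrable_on_const[of "{0<..<L}" "1::real"] by simp
  ultimately show "(\<lambda>s. 1 + (norm (h s))\<^sup>2) integrable_on {0<..<L}"
    by (intro integrable_add)
  show "norm (h s) \<le> 1 + (norm (h s))\<^sup>2" if "s \<in> {0<..<L}" for s
  proof -
    have "0 \<le> (norm (h s) - 1)\<^sup>2 + norm (h s)" by simp
    then show ?thesis by (simp add: power2_eq_square algebra_simps)
  qed
qed simp

text \<open>What the competitors and the elastica have in common. The weak second derivative \<open>h\<close> is orthogonal to the
  tangent, hence a multiple of the normal, so a signed curvature exists. By uniqueness of the weak second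
  derivative, whichever representative the definition of the energy selects has square \<open>(norm h)\<^sup>2\<close> almost
  everywhere.\<close>

lemma W22_arc_regularity:
  assumes L: "L > 0" and \<gamma>: "\<gamma> \<in> W22_arc L"
  obtains h where "weak_derivative 2 L \<gamma> h"
    and "continuous_on {0..L} (tangent L \<gamma>)"
    and "\<And>s. s \<in> {0..L} \<Longrightarrow> norm (tangent L \<gamma> s) = 1"
    and "\<And>s. s \<in> {0..L} \<Longrightarrow> (\<gamma> has_vector_derivative tangent L \<gamma> s) (at s within {0..L})"
    and "\<And>s t. 0 \<le> s \<Longrightarrow> s \<le> t \<Longrightarrow> t \<le> L \<Longrightarrow> tangent L \<gamma> t - tangent L \<gamma> s = integral {s..t} h"
    and "h integrable_on {0..L}" "(\<lambda>s. (norm (h s))\<^sup>2) integrable_on {0..L}"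
    and "bending_energy L \<gamma> = integral {0..L} (\<lambda>s. (norm (h s))\<^sup>2)"
proof -
  have c\<gamma>: "continuous_on {0..L} \<gamma>" and "\<exists>h. weak_derivative 2 L \<gamma> h \<and> square_integrable L h"
    and unit: "\<And>s. s \<in> {0..L} \<Longrightarrow> norm (tangent L \<gamma> s) = 1"
    using \<gamma> unfolding W22_arc_def W22_def by auto
  then obtain h where weak: "weak_derivative 2 L \<gamma> h" and sq: "square_integrable L h" by blast
  have "h absolutely_integrable_on {0..L}"
    using square_integrable_imp_integrable[OF sq] absolutely_integrable_on_Icc_iff_Ioo by blast
  then have hI: "h integrable_on {0..L}"
    unfolding absolutely_integrable_on_def by blast
  have sqI: "(\<lambda>s. (norm (h s))\<^sup>2) absolutely_integrable_on {0<..<L}"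
    using sq by (simp add: square_integrable_def)
  have sqI': "(\<lambda>s. (norm (h s))\<^sup>2) integrable_on {0..L}"
    using sqI absolutely_integrable_on_Icc_iff_Ioo unfolding absolutely_integrable_on_def
    by (metis integrable_on_Icc_iff_Ioo)
  obtain T where T: "continuous_on {0..L} T"
    "\<And>s. s \<in> {0..L} \<Longrightarrow> (\<gamma> has_vector_derivative T s) (at s within {0..L})"
    "\<And>s t. 0 \<le> s \<Longrightarrow> s \<le> t \<Longrightarrow> t \<le> L \<Longrightarrow> T t - T s = integral {s..t} h"
    by (rule C1_up_to_the_boundary[OF L c\<gamma> weak hI]) (rule that)
  have eqT: "tangent L \<gamma> s = T s" if "s \<in> {0..L}" for s
    unfolding tangent_def using vector_derivative_within_cbox[OF L _ T(2)[OF that, folded cbox_interval]] that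
    by simp
  have li: "locally_integrable L h" using weak by (simp add: weak_derivative_def)
  obtain N where N: "negligible N" "\<And>s. s \<in> {0<..<L} - N \<Longrightarrow> inner (T s) (h s) = 0"
  proof (rule derivative_of_unit_vector_orthogonal[OF li])
    show "continuous_on {0<..<L} T" by (rule continuous_on_subset[OF T(1)]) auto
    show "norm (T s) = 1" if "0 < s" "s < L" for s using unit[of s] eqT[of s] that by simp
  qed (use T(3) that in auto)
  have "inner (h s) (normal_vec L \<gamma> s) *\<^sub>R normal_vec L \<gamma> s = h s" if s: "s \<in> {0<..<L} - N" for s
    using orthonormal_expansion[of "T s" "h s"] N(2)[OF s] unit[of s] eqT[of s] s
    by (simp add: normal_vec_eq_rot inner_commute)
  then have "signed_curvature L \<gamma> (\<lambda>s. inner (h s) (normal_vec L \<gamma> s))"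
    unfolding signed_curvature_def by (intro weak_derivative_spike[OF weak N(1)]) auto
  then have "signed_curvature L \<gamma> (SOME k. signed_curvature L \<gamma> k)"
    by (rule someI[of "signed_curvature L \<gamma>"])
  then obtain k where k: "signed_curvature L \<gamma> k" "k = (SOME k. signed_curvature L \<gamma> k)" by blast
  have c\<gamma>': "continuous_on {0<..<L} \<gamma>"
    by (rule continuous_on_subset[OF c\<gamma>]) auto
  obtain N' where N': "negligible N'" "\<And>s. s \<in> {0<..<L} - N' \<Longrightarrow> k s *\<^sub>R normal_vec L \<gamma> s = h s"
    by (rule weak_second_derivative_unique[OF k(1)[unfolded signed_curvature_def] weak c\<gamma>']) (rule that)
  have "(k s)\<^sup>2 = (norm (h s))\<^sup>2" if s: "s \<in> {0<..<L} - N'" for s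
    using N'(2)[OF s, symmetric] unit[of s] s by (simp add: normal_vec_eq_rot)
  then have "bending_energy L \<gamma> = (LINT s:{0<..<L}|lebesgue. (norm (h s))\<^sup>2)"
    unfolding bending_energy_def k(2)[symmetric] by (intro LINT_spike[OF sqI N'(1)]) simp
  also have "\<dots> = integral {0..L} (\<lambda>s. (norm (h s))\<^sup>2)"
    using set_lebesgue_integral_eq_integral(2)[OF sqI] by (simp add: integral_open_interval_real)
  finally have "bending_energy L \<gamma> = integral {0..L} (\<lambda>s. (norm (h s))\<^sup>2)" .
  moreover have "continuous_on {0..L} (tangent L \<gamma>)"
    using T(1) eqT continuous_on_cong by metis
  ultimately show thesis
    using that[OF weak] unit T(2,3) eqT hI sqI' by simp
qed

text \<open>The variance of \<open>h\<close>, that is, the integral of \<open>(norm (h - m))\<^sup>2\<close> with \<open>m\<close> the mean of \<open>h\<close>, is nonnegative.\<close>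

lemma integral_Cauchy_Schwarz:
  fixes h :: "real \<Rightarrow> 'a::euclidean_space"
  assumes "a < b" and h: "h integrable_on {a..b}" and h2: "(\<lambda>s. (norm (h s))\<^sup>2) integrable_on {a..b}"
  shows "(norm (integral {a..b} h))\<^sup>2 \<le> (b - a) * integral {a..b} (\<lambda>s. (norm (h s))\<^sup>2)"
proof -
  define I where "I = integral {a..b} h"
  define m where "m = I /\<^sub>R (b - a)"
  have "((\<lambda>s. inner m (h s)) has_integral inner m I) {a..b}"
    using has_integral_linear[OF integrable_integral[OF h] bounded_linear_inner_right[of m]]
    by (simp add: o_def I_def)
  then have "((\<lambda>s. (norm (h s))\<^sup>2 - 2 * inner m (h s) + (norm m)\<^sup>2) has_integral
      integral {a..b} (\<lambda>s. (norm (h s))\<^sup>2) - 2 * inner m I + (b - a) * (norm m)\<^sup>2) {a..b}"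
    using has_integral_const_real[of "(norm m)\<^sup>2" a b] assms(1)
    by (intro has_integral_add has_integral_diff has_integral_mult_right integrable_integral h2) simp_all
  then have "0 \<le> integral {a..b} (\<lambda>s. (norm (h s))\<^sup>2) - 2 * inner m I + (b - a) * (norm m)\<^sup>2"
  proof (rule has_integral_nonneg)
    fix s
    have "(norm (h s))\<^sup>2 - 2 * inner m (h s) + (norm m)\<^sup>2 = (norm (h s - m))\<^sup>2"
      by (simp add: power2_norm_eq_inner inner_diff_left inner_diff_right inner_commute)
    then show "0 \<le> (norm (h s))\<^sup>2 - 2 * inner m (h s) + (norm m)\<^sup>2" by simp
  qed
  moreover have "inner m I = (norm I)\<^sup>2 / (b - a)"
    by (simp add: m_def power2_norm_eq_inner divide_inverse mult.commute)
  moreover have "(b - a) * (norm m)\<^sup>2 = (norm I)\<^sup>2 / (b - a)"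
    using assms(1) by (simp add: m_def power_mult_distrib power2_eq_square divide_inverse)
  ultimately have "(norm I)\<^sup>2 / (b - a) \<le> integral {a..b} (\<lambda>s. (norm (h s))\<^sup>2)"
    by simp
  then show ?thesis
    using assms(1) by (simp add: I_def divide_le_eq mult.commute)
qed

text \<open>The chord of an arc of length \<open>d\<close> on the unit circle has squared length \<open>2 - 2 cos d = (2 sin (d/2))\<^sup>2\<close>,
  and \<open>sin x / x\<close> tends to one.\<close>

lemma chord_controls_angle:
  fixes \<epsilon> :: real
  assumes "\<epsilon> > 0"
  obtains \<eta> where "\<eta> > 0" "\<And>d. \<bar>d\<bar> < \<eta> \<Longrightarrow> d\<^sup>2 \<le> (1 + \<epsilon>) * (2 - 2 * cos d)"
proof -
  have "((\<lambda>x::real. sin x / x) \<longlongrightarrow> 1) (at 0)"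
    using DERIV_sin[of "0::real"] by (simp add: DERIV_def)
  then have "((\<lambda>x::real. (1 + \<epsilon>) * (sin x / x)\<^sup>2) \<longlongrightarrow> (1 + \<epsilon>) * 1\<^sup>2) (at 0)"
    by (intro tendsto_intros)
  then have "\<forall>\<^sub>F x in at 0. (1 + \<epsilon>) * (sin x / x)\<^sup>2 > 1"
    by (rule order_tendstoD(1)) (use assms in simp)
  then obtain d0 where d0: "d0 > 0" "\<And>x. x \<noteq> 0 \<Longrightarrow> \<bar>x\<bar> < d0 \<Longrightarrow> (1 + \<epsilon>) * (sin x / x)\<^sup>2 > 1"
    unfolding eventually_at by (auto simp: dist_real_def)
  show thesis
  proof
    show "2 * d0 > 0" using d0 by simp
    fix d :: real assume d: "\<bar>d\<bar> < 2 * d0"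
    show "d\<^sup>2 \<le> (1 + \<epsilon>) * (2 - 2 * cos d)"
    proof (cases "d = 0")
      case False
      define x where "x = d / 2"
      have x: "x \<noteq> 0" "\<bar>x\<bar> < d0" "d = 2 * x" using False d by (auto simp: x_def)
      have "x\<^sup>2 \<le> (1 + \<epsilon>) * (sin x)\<^sup>2"
        using d0(2)[OF x(1,2)] x(1) by (simp add: power_divide field_simps)
      moreover have "2 - 2 * cos d = 4 * (sin x)\<^sup>2"
        unfolding x(3) cos_double_sin by simp
      ultimately show ?thesis
        using x(3) by (simp add: power_mult_distrib)
    qed simp
  qed
qed

text \<open>Two unit vectors at angles \<open>\<psi>\<^sub>1\<close>, \<open>\<psi>\<^sub>2 \<in> [0, \<pi>]\<close> from \<open>e\<close> have inner product at most \<open>cos (\<psi>\<^sub>1 - \<psi>\<^sub>2)\<close>, with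
  equality if they lie on the same side of \<open>e\<close>. So the chord between them is at least that of an arc of length
  \<open>\<bar>\<psi>\<^sub>1 - \<psi>\<^sub>2\<bar>\<close>, and the chord is bounded by the Cauchy-Schwarz inequality.\<close>

lemma tangent_angle_energy_dominated:
  fixes T h :: "real \<Rightarrow> real^2"
  assumes T: "continuous_on {0..L} T" "\<And>s. s \<in> {0..L} \<Longrightarrow> norm (T s) = 1"
    and diff: "\<And>s t. 0 \<le> s \<Longrightarrow> s \<le> t \<Longrightarrow> t \<le> L \<Longrightarrow> T t - T s = integral {s..t} h"
    and h: "h integrable_on {0..L}" "(\<lambda>s. (norm (h s))\<^sup>2) integrable_on {0..L}"
    and e: "norm e = 1"
  shows "continuous_on {0..L} (\<lambda>s. arccos (inner e (T s)))"
    and "energy_dominated 0 L (\<lambda>s. arccos (inner e (T s))) (\<lambda>s. integral {0..s} (\<lambda>s. (norm (h s))\<^sup>2))"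
proof -
  define \<psi> where "\<psi> s = arccos (inner e (T s))" for s
  define M where "M s = integral {0..s} (\<lambda>s. (norm (h s))\<^sup>2)" for s
  have range: "-1 \<le> inner e (T s)" "inner e (T s) \<le> 1" if "s \<in> {0..L}" for s
    using Cauchy_Schwarz_ineq2[of e "T s"] e T(2)[OF that] by auto
  have "continuous_on {0..L} \<psi>"
    unfolding \<psi>_def using range by (intro continuous_on_arccos continuous_intros T(1)) auto
  then show c: "continuous_on {0..L} (\<lambda>s. arccos (inner e (T s)))"
    unfolding \<psi>_def .
  have sin_\<psi>: "\<bar>inner e (rot (T s))\<bar> = sin (\<psi> s)" and cos_\<psi>: "inner e (T s) = cos (\<psi> s)"
    if s: "s \<in> {0..L}" for s
  proof -
    have "(inner e (rot (T s)))\<^sup>2 = 1 - (inner e (T s))\<^sup>2"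
      using inner_orthonormal[OF e, of "T s" "T s"] T(2)[OF s]
      by (simp add: power2_eq_square norm_eq_sqrt_inner)
    then show "\<bar>inner e (rot (T s))\<bar> = sin (\<psi> s)"
      unfolding \<psi>_def using range[OF s] by (simp add: sin_arccos flip: real_sqrt_abs)
    show "inner e (T s) = cos (\<psi> s)"
      unfolding \<psi>_def using range[OF s] by simp
  qed
  have chord: "2 - 2 * cos (\<psi> t - \<psi> s) \<le> (norm (T t - T s))\<^sup>2" if st: "s \<in> {0..L}" "t \<in> {0..L}" for s t
  proof -
    have "inner e (rot (T t)) * inner e (rot (T s)) \<le> \<bar>inner e (rot (T t))\<bar> * \<bar>inner e (rot (T s))\<bar>"
      by (metis abs_ge_self abs_mult)
    then have "inner (T t) (T s) \<le> cos (\<psi> t) * cos (\<psi> s) + sin (\<psi> t) * sin (\<psi> s)"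
      unfolding inner_orthonormal[OF e, of "T t" "T s"] using sin_\<psi> cos_\<psi> st by simp
    moreover have "inner (T s) (T s) = 1" "inner (T t) (T t) = 1"
      using T(2)[OF st(1)] T(2)[OF st(2)] by (simp_all flip: power2_norm_eq_inner)
    then have "(norm (T t - T s))\<^sup>2 = 2 - 2 * inner (T t) (T s)"
      by (simp add: power2_norm_eq_inner inner_diff_left inner_diff_right inner_commute)
    ultimately show ?thesis by (simp add: cos_diff)
  qed
  have chord': "(norm (T t - T s))\<^sup>2 \<le> (t - s) * (M t - M s)" if st: "0 \<le> s" "s < t" "t \<le> L" for s t
  proof -
    have i: "h integrable_on {s..t}" "(\<lambda>s. (norm (h s))\<^sup>2) integrable_on {s..t}" "(\<lambda>s. (norm (h s))\<^sup>2) integrable_on {0..t}"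
      using st by (auto intro: integrable_on_subinterval[OF h(1)] integrable_on_subinterval[OF h(2)])
    have "M t = M s + integral {s..t} (\<lambda>s. (norm (h s))\<^sup>2)"
      unfolding M_def using st i by (intro Henstock_Kurzweil_Integration.integral_combine[symmetric]) auto
    then show ?thesis
      using integral_Cauchy_Schwarz[OF st(2) i(1,2)] diff[of s t] st by simp
  qed
  have "uniformly_continuous_on {0..L} \<psi>"
    using c unfolding \<psi>_def by (intro compact_uniformly_continuous) auto
  then have unif: "\<exists>\<delta>>0. \<forall>x\<in>{0..L}. \<forall>y\<in>{0..L}. dist y x < \<delta> \<longrightarrow> dist (\<psi> y) (\<psi> x) < \<eta>" if "\<eta> > 0" for \<eta>
    using that unfolding uniformly_continuous_on_def by blast
  have "energy_dominated 0 L \<psi> M"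
    unfolding energy_dominated_def
  proof (intro allI impI)
    fix \<epsilon> :: real assume \<epsilon>: "\<epsilon> > 0"
    obtain \<eta> where \<eta>: "\<eta> > 0" "\<And>d. \<bar>d\<bar> < \<eta> \<Longrightarrow> d\<^sup>2 \<le> (1 + \<epsilon>) * (2 - 2 * cos d)"
      using chord_controls_angle[OF \<epsilon>] by blast
    obtain \<delta> where \<delta>: "\<delta> > 0" "\<forall>x\<in>{0..L}. \<forall>y\<in>{0..L}. dist y x < \<delta> \<longrightarrow> dist (\<psi> y) (\<psi> x) < \<eta>"
      using unif[OF \<eta>(1)] by blast
    show "\<exists>\<delta>>0. \<forall>s t. 0 \<le> s \<longrightarrow> s < t \<longrightarrow> t \<le> L \<longrightarrow> t - s < \<delta> \<longrightarrow>
        (\<psi> t - \<psi> s)\<^sup>2 \<le> (1 + \<epsilon>) * (t - s) * (M t - M s)"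
    proof (intro exI[of _ \<delta>] conjI allI impI)
      fix s t assume st: "0 \<le> s" "s < t" "t \<le> L" "t - s < \<delta>"
      then have "\<bar>\<psi> t - \<psi> s\<bar> < \<eta>"
        using \<delta>(2)[rule_format, of s t] by (simp add: dist_real_def)
      then have "(\<psi> t - \<psi> s)\<^sup>2 \<le> (1 + \<epsilon>) * (2 - 2 * cos (\<psi> t - \<psi> s))"
        by (rule \<eta>(2))
      also have "\<dots> \<le> (1 + \<epsilon>) * ((t - s) * (M t - M s))"
        using chord[of s t] chord'[of s t] st \<epsilon> by (intro mult_left_mono) auto
      finally show "(\<psi> t - \<psi> s)\<^sup>2 \<le> (1 + \<epsilon>) * (t - s) * (M t - M s)"
        by (simp only: mult.assoc)
    qed (rule \<delta>)
  qed
  then show "energy_dominated 0 L (\<lambda>s. arccos (inner e (T s))) (\<lambda>s. integral {0..s} (\<lambda>s. (norm (h s))\<^sup>2))"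
    unfolding \<psi>_def M_def .
qed


section \<open>Smoothness of a monotone curvature\<close>

lemma mono_has_right_limit:
  fixes k :: "real \<Rightarrow> real"
  assumes k: "mono_on {0<..<L} k" and t: "0 < t" "t < L"
  obtains l where "(k \<longlongrightarrow> l) (at_right t)" "k t \<le> l" "\<And>s. t < s \<Longrightarrow> s < L \<Longrightarrow> l \<le> k s"
proof -
  define l where "l = Inf (k ` {t<..<L})"
  have ne: "k ` {t<..<L} \<noteq> {}" using t by simp
  have low: "k t \<le> k s" if "s \<in> {t<..<L}" for s
    using mono_onD[OF k, of t s] that t by simp
  then have bdd: "bdd_below (k ` {t<..<L})" by (intro bdd_belowI2[where m = "k t"])
  have le: "l \<le> k s" if "t < s" "s < L" for s
    unfolding l_def using that by (intro cInf_lower bdd) auto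
  have ge: "k t \<le> l"
    unfolding l_def using low by (intro cInf_greatest ne) auto
  have "(k \<longlongrightarrow> l) (at_right t)"
  proof (rule order_tendstoI)
    fix a assume "a < l"
    then show "\<forall>\<^sub>F s in at_right t. a < k s"
      using le t unfolding eventually_at_right_field by (intro exI[of _ L]) force
  next
    fix a assume "l < a"
    then obtain s0 where s0: "s0 \<in> {t<..<L}" "k s0 < a"
      unfolding l_def using cInf_lessD[OF ne] by blast
    have "k s < a" if "t < s" "s < s0" for s
      using mono_onD[OF k, of s s0] that s0 t by simp
    then show "\<forall>\<^sub>F s in at_right t. k s < a"
      unfolding eventually_at_right_field using s0 by (intro exI[of _ s0]) auto
  qed
  then show thesis using that ge le by blast
qed

text \<open>A monotone function lies between its one-sided limits, and these coincide if the right limits form a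
  continuous function.\<close>

lemma mono_eq_continuous_right_limit:
  fixes k F :: "real \<Rightarrow> real"
  assumes k: "mono_on {0<..<L} k"
    and lim: "\<And>t. 0 < t \<Longrightarrow> t < L \<Longrightarrow> (k \<longlongrightarrow> F t) (at_right t)"
    and F: "\<And>t. 0 < t \<Longrightarrow> t < L \<Longrightarrow> isCont F t" and t: "0 < t" "t < L"
  shows "k t = F t"
proof (rule antisym)
  have F_between: "k s \<le> F s" "\<And>r. s < r \<Longrightarrow> r < L \<Longrightarrow> F s \<le> k r" if s: "0 < s" "s < L" for s
  proof -
    obtain l where l: "(k \<longlongrightarrow> l) (at_right s)" "k s \<le> l" "\<And>r. s < r \<Longrightarrow> r < L \<Longrightarrow> l \<le> k r"
      using mono_has_right_limit[OF k s] by blast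
    have "F s = l"
      by (rule tendsto_unique[OF trivial_limit_at_right_real lim[OF s] l(1)])
    then show "k s \<le> F s" "\<And>r. s < r \<Longrightarrow> r < L \<Longrightarrow> F s \<le> k r" using l by auto
  qed
  show "k t \<le> F t" by (rule F_between(1)[OF t])
  have "(F \<longlongrightarrow> F t) (at_left t)"
    using F[OF t] by (simp add: isCont_def filterlim_at_split)
  then show "F t \<le> k t"
  proof (rule tendsto_upperbound[OF _ _ trivial_limit_at_left_real])
    show "\<forall>\<^sub>F s in at_left t. F s \<le> k t"
      unfolding eventually_at_left_field using F_between(2) t by (intro exI[of _ 0]) auto
  qed
qed

lemma primitive_of_continuous_has_derivative:
  fixes D g :: "real \<Rightarrow> 'a::euclidean_space"
  assumes g: "continuous_on {0<..<L} g"
    and D: "\<And>s t. 0 < s \<Longrightarrow> s \<le> t \<Longrightarrow> t < L \<Longrightarrow> D t - D s = integral {s..t} g"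
    and t: "0 < t" "t < L"
  shows "(D has_vector_derivative g t) (at t)"
proof -
  define a where "a = t / 2"
  define b where "b = (t + L) / 2"
  have ab: "0 < a" "a < t" "t < b" "b < L" using t by (auto simp: a_def b_def)
  have "continuous_on {a..b} g"
    by (rule continuous_on_subset[OF g]) (use ab in auto)
  then have "((\<lambda>u. integral {a..u} g) has_vector_derivative g t) (at t within {a..b})"
    using ab by (intro integral_has_vector_derivative) auto
  then have "((\<lambda>u. integral {a..u} g) has_vector_derivative g t) (at t)"
    using ab at_within_interior[of t "{a..b}"] by simp
  then have "((\<lambda>u. D a + integral {a..u} g) has_vector_derivative 0 + g t) (at t)"
    by (intro has_vector_derivative_add has_vector_derivative_const)
  then have "((\<lambda>u. D a + integral {a..u} g) has_vector_derivative g t) (at t)"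
    by (simp only: add_0)
  then show ?thesis
  proof (rule has_vector_derivative_transform_within_open)
    show "open {a<..<b}" "t \<in> {a<..<b}" using ab by auto
    show "D a + integral {a..y} g = D y" if "y \<in> {a<..<b}" for y
      using D[of a y] that ab by (simp add: algebra_simps)
  qed
qed

text \<open>Both terms of the equation are integrable separately, because a test function times a locally integrable
  function is integrable; so the integral splits, and one can solve for \<open>k''\<close>.\<close>

lemma elastica_equation_imp_weak_derivative:
  assumes "elastica_equation L lam k"
  shows "weak_derivative 2 L k (\<lambda>s. - (k s ^ 3 - lam * k s) / 2)"
proof -
  define g where "g s = k s ^ 3 - lam * k s" for s
  have k: "locally_integrable L k" and k3: "locally_integrable L (\<lambda>s. k s ^ 3)"
    and eq: "\<And>\<phi>. \<phi> \<in> test_functions L \<Longrightarrow> (LINT s:{0<..<L}|lebesgue.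
           2 * k s * (deriv ^^ 2) \<phi> s + (k s ^ 3 - lam * k s) * \<phi> s) = 0"
    using assms unfolding elastica_equation_def by auto
  have g: "locally_integrable L (\<lambda>s. - g s / 2)"
    unfolding locally_integrable_def
  proof (intro allI impI)
    fix K assume "compact K \<and> K \<subseteq> {0<..<L}"
    then have "(\<lambda>s. k s ^ 3) absolutely_integrable_on K" "k absolutely_integrable_on K"
      using k k3 unfolding locally_integrable_def by blast+
    then have "(\<lambda>s. (-1/2) *\<^sub>R (k s ^ 3 - lam *\<^sub>R k s)) absolutely_integrable_on K"
      by (intro absolutely_integrable_scaleR_left set_integral_diff(1))
    moreover have "(\<lambda>s. (-1/2) *\<^sub>R (k s ^ 3 - lam *\<^sub>R k s)) = (\<lambda>s. - g s / 2)"
      by (simp add: g_def fun_eq_iff field_simps)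
    ultimately show "(\<lambda>s. - g s / 2) absolutely_integrable_on K"
      by (simp only:)
  qed
  have "weak_derivative 2 L k (\<lambda>s. - g s / 2)"
    unfolding weak_derivative_def
  proof (intro conjI ballI k g)
    fix \<phi> assume \<phi>: "\<phi> \<in> test_functions L"
    have i1: "(\<lambda>s. (deriv ^^ 2) \<phi> s *\<^sub>R k s) absolutely_integrable_on {0<..<L}"
      by (rule test_function_integrable[OF test_function_higher_deriv[OF \<phi>] k])
    have i2: "(\<lambda>s. \<phi> s *\<^sub>R (- g s / 2)) absolutely_integrable_on {0<..<L}"
      by (rule test_function_integrable[OF \<phi> g])
    have "2 * k s * (deriv ^^ 2) \<phi> s + (k s ^ 3 - lam * k s) * \<phi> s =
        2 *\<^sub>R ((deriv ^^ 2) \<phi> s *\<^sub>R k s - \<phi> s *\<^sub>R (- g s / 2))" for s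
      by (simp add: g_def field_simps)
    then have "(LINT s:{0<..<L}|lebesgue. 2 *\<^sub>R ((deriv ^^ 2) \<phi> s *\<^sub>R k s - \<phi> s *\<^sub>R (- g s / 2))) = 0"
      using eq[OF \<phi>] by (simp only:)
    then have "2 *\<^sub>R ((LINT s:{0<..<L}|lebesgue. (deriv ^^ 2) \<phi> s *\<^sub>R k s)
        - (LINT s:{0<..<L}|lebesgue. \<phi> s *\<^sub>R (- g s / 2))) = 0"
      by (simp only: set_integral_scaleR_right set_integral_diff(2)[OF i1 i2])
    then show "(LINT s:{0<..<L}|lebesgue. (deriv ^^ 2) \<phi> s *\<^sub>R k s) =
        (- 1) ^ 2 *\<^sub>R (LINT s:{0<..<L}|lebesgue. \<phi> s *\<^sub>R (- g s / 2))"
      by simp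
  qed
  then show ?thesis by (simp add: g_def)
qed

text \<open>A monotone \<open>k\<close> has right limits, to which the regularity result applies although \<open>k\<close> is not yet known to
  be continuous. The resulting \<open>C\<^sup>1\<close> function agrees with \<open>k\<close> at every point of the open interval, not just
  almost everywhere, and one more integration of the equation gives \<open>k''\<close>.\<close>

lemma monotone_elastica_curvature_C2:
  fixes k :: "real \<Rightarrow> real"
  assumes weak: "weak_derivative 2 L k (\<lambda>s. - (k s ^ 3 - lam * k s) / 2)"
    and mono: "mono_on {0<..<L} k \<or> antimono_on {0<..<L} k"
  obtains k' where "\<And>t. 0 < t \<Longrightarrow> t < L \<Longrightarrow> (k has_real_derivative k' t) (at t)"
    and "\<And>t. 0 < t \<Longrightarrow> t < L \<Longrightarrow> (k' has_real_derivative - (k t ^ 3 - lam * k t) / 2) (at t)"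
proof -
  obtain \<sigma> :: real where \<sigma>: "\<sigma> * \<sigma> = 1" "mono_on {0<..<L} (\<lambda>s. \<sigma> * k s)"
  proof (cases "mono_on {0<..<L} k")
    case False
    then have "antimono_on {0<..<L} k" using mono by simp
    then have "mono_on {0<..<L} (\<lambda>s. -1 * k s)"
      by (auto simp: monotone_on_def)
    with that[of "-1"] show ?thesis by simp
  qed (use that[of 1] in simp)
  have "\<exists>l. ((\<lambda>s. \<sigma> * k s) \<longlongrightarrow> l) (at_right t)" if "0 < t" "t < L" for t
    using mono_has_right_limit[OF \<sigma>(2) that] by blast
  then obtain F0 where F0: "\<And>t. 0 < t \<Longrightarrow> t < L \<Longrightarrow> ((\<lambda>s. \<sigma> * k s) \<longlongrightarrow> F0 t) (at_right t)"
    by metis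
  define F where "F t = \<sigma> * F0 t" for t
  have k_\<sigma>: "k s = \<sigma> * (\<sigma> * k s)" for s using \<sigma>(1) by (simp flip: mult.assoc)
  have F: "(k \<longlongrightarrow> F t) (at_right t)" if "0 < t" "t < L" for t
  proof -
    have "((\<lambda>s. \<sigma> * (\<sigma> * k s)) \<longlongrightarrow> \<sigma> * F0 t) (at_right t)"
      by (intro tendsto_mult tendsto_const F0 that)
    then show ?thesis by (simp only: F_def k_\<sigma>[symmetric])
  qed
  obtain D where D: "\<And>t. 0 < t \<Longrightarrow> t < L \<Longrightarrow> (F has_vector_derivative D t) (at t)"
     "\<And>s t. 0 < s \<Longrightarrow> s \<le> t \<Longrightarrow> t < L \<Longrightarrow> D t - D s = integral {s..t} (\<lambda>s. - (k s ^ 3 - lam * k s) / 2)"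
    by (rule weak_second_derivative_imp_C1[where F = F, OF weak]) (erule (1) F, rule that)
  have contF: "isCont F t" if "0 < t" "t < L" for t
    using D(1)[OF that] has_vector_derivative_continuous by blast
  have kF: "k t = F t" if t: "0 < t" "t < L" for t
  proof -
    have F0_eq: "F0 s = \<sigma> * F s" for s using \<sigma>(1) by (simp add: F_def flip: mult.assoc)
    have "\<sigma> * k t = F0 t"
    proof (rule mono_eq_continuous_right_limit[OF \<sigma>(2) _ _ t])
      show "isCont F0 t" if "0 < t" "t < L" for t
        using contF[OF that] unfolding F0_eq[abs_def] by (intro continuous_intros)
    qed (rule F0)
    then show ?thesis using k_\<sigma>[of t] by (simp add: F_def)
  qed
  have kD: "(k has_real_derivative D t) (at t)" if t: "0 < t" "t < L" for t
    unfolding has_real_derivative_iff_has_vector_derivative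
    by (rule has_vector_derivative_transform_within_open[OF D(1)[OF t], of "{0<..<L}"]) (use t kF in auto)
  have ck: "continuous_on {0<..<L} k"
    using DERIV_isCont[OF kD] by (auto intro!: continuous_at_imp_continuous_on)
  show thesis
  proof (rule that[OF kD])
    fix t assume t: "0 < t" "t < L"
    have "(D has_vector_derivative - (k t ^ 3 - lam * k t) / 2) (at t)"
      by (rule primitive_of_continuous_has_derivative[OF _ D(2) t]) (intro continuous_intros ck; simp)
    then show "(D has_real_derivative - (k t ^ 3 - lam * k t) / 2) (at t)"
      by (simp only: has_real_derivative_iff_has_vector_derivative)
  qed
qed


section \<open>From elastica to pendulum, and the minimality theorem\<close>

text \<open>A unit vector \<open>(X, Y)\<close> rotating with angular velocity \<open>- K\<close> in the closed upper half plane. Its angle is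
  obtained by integrating \<open>- K\<close>; it cannot leave \<open>[0, \<pi>]\<close> without passing through angles of negative sine.\<close>

lemma angle_lift:
  fixes X Y K :: "real \<Rightarrow> real"
  assumes L: "L > 0" and K: "continuous_on {0..L} K" and c: "continuous_on {0..L} X" "continuous_on {0..L} Y"
    and d: "\<And>s. 0 < s \<Longrightarrow> s < L \<Longrightarrow> (X has_real_derivative K s * Y s) (at s)"
           "\<And>s. 0 < s \<Longrightarrow> s < L \<Longrightarrow> (Y has_real_derivative - K s * X s) (at s)"
    and unit: "\<And>s. s \<in> {0..L} \<Longrightarrow> (X s)\<^sup>2 + (Y s)\<^sup>2 = 1" and Y: "\<And>s. s \<in> {0..L} \<Longrightarrow> Y s \<ge> 0"
  obtains u where "continuous_on {0..L} u" "\<And>s. 0 < s \<Longrightarrow> s < L \<Longrightarrow> (u has_real_derivative - K s) (at s)"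
    "\<And>s. s \<in> {0..L} \<Longrightarrow> X s = cos (u s)" "\<And>s. s \<in> {0..L} \<Longrightarrow> Y s = sin (u s)"
    "\<And>s. s \<in> {0..L} \<Longrightarrow> 0 \<le> u s \<and> u s \<le> pi"
proof -
  define u where "u s = arccos (X 0) - integral {0..s} K" for s
  have cu: "continuous_on {0..L} u"
    unfolding u_def by (intro continuous_intros indefinite_integral_continuous_1 integrable_continuous_real K)
  have du: "(u has_real_derivative - K s) (at s)" if s: "0 < s" "s < L" for s
  proof -
    have "((\<lambda>s. integral {0..s} K) has_real_derivative K s) (at s within {0..L})"
      using s by (intro integral_has_real_derivative K) auto
    then have "((\<lambda>s. integral {0..s} K) has_real_derivative K s) (at s)"
      using s at_within_interior[of s "{0..L}"] by simp
    then show ?thesis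
      unfolding u_def by (auto intro!: derivative_eq_intros)
  qed
  (* The inner product of (X, Y) with (cos u, sin u), which both rotate at the same speed. *)
  define Z where "Z s = X s * cos (u s) + Y s * sin (u s)" for s
  have cZ: "continuous_on {0..L} Z"
    unfolding Z_def by (intro continuous_intros cu c)
  have "(X 0)\<^sup>2 + (Y 0)\<^sup>2 = 1" using unit[of 0] L by simp
  then have "(X 0)\<^sup>2 \<le> 1" using zero_le_power2[of "Y 0"] by linarith
  then have X1: "\<bar>X 0\<bar> \<le> 1"
    by (simp add: abs_square_le_1)
  then have u0: "cos (u 0) = X 0" "0 \<le> u 0" "u 0 \<le> pi"
    by (auto simp: u_def arccos_lbound arccos_ubound abs_le_iff)
  have "sin (u 0) = Y 0"
  proof -
    have "(sin (u 0))\<^sup>2 = (Y 0)\<^sup>2"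
      using unit[of 0] L sin_cos_squared_add[of "u 0"] u0(1) by simp
    then show ?thesis
      using Y[of 0] L u0 sin_ge_zero[of "u 0"] by (simp add: power2_eq_iff_nonneg)
  qed
  then have Z0: "Z 0 = 1"
    using unit[of 0] L u0 by (simp add: Z_def power2_eq_square)
  have Z1: "Z s = 1" if s: "s \<in> {0..L}" for s
  proof (cases "s = 0")
    case False
    have "Z s = Z 0"
    proof (rule DERIV_isconst_end[where f = Z])
      show "0 < s" using False s by simp
      show "continuous_on {0..s} Z" by (rule continuous_on_subset[OF cZ]) (use s in auto)
      fix x assume x: "0 < x" "x < s"
      then have x': "0 < x" "x < L" using s by auto
      have "(Z has_real_derivative (K x * Y x) * cos (u x) + (- sin (u x) * - K x) * X x
          + ((- K x * X x) * sin (u x) + (cos (u x) * - K x) * Y x)) (at x)"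
        unfolding Z_def
        by (intro DERIV_add DERIV_mult d x' DERIV_chain2[OF DERIV_cos du[OF x']] DERIV_chain2[OF DERIV_sin du[OF x']])
      then show "(Z has_real_derivative 0) (at x)"
        by (simp add: algebra_simps)
    qed
    then show ?thesis using Z0 by simp
  qed (simp add: Z0)
  have XY: "X s = cos (u s)" "Y s = sin (u s)" if s: "s \<in> {0..L}" for s
  proof -
    have "(X s - cos (u s))\<^sup>2 + (Y s - sin (u s))\<^sup>2 =
        ((X s)\<^sup>2 + (Y s)\<^sup>2) + ((sin (u s))\<^sup>2 + (cos (u s))\<^sup>2) - 2 * Z s"
      by (simp add: Z_def power2_eq_square algebra_simps)
    also have "\<dots> = 0"
      unfolding unit[OF s] Z1[OF s] sin_cos_squared_add by simp
    finally show "X s = cos (u s)" "Y s = sin (u s)"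
      by (simp_all add: sum_power2_eq_zero_iff)
  qed
  have urange: "0 \<le> u s \<and> u s \<le> pi" if s: "s \<in> {0..L}" for s
  proof -
    have c': "continuous_on {0..s} u" by (rule continuous_on_subset[OF cu]) (use s in auto)
    have no_neg: "sin (u x) \<ge> 0" if "x \<in> {0..s}" for x
      using XY(2)[of x] Y[of x] that s by simp
    have "u s \<le> pi"
    proof (rule ccontr)
      assume n: "\<not> u s \<le> pi"
      (* Capped at 3 pi / 2, so that the sine is still negative at y. *)
      define y where "y = min (u s) (pi + pi / 2)"
      have y: "pi < y" "y \<le> u s" "y < 2 * pi" using n pi_gt_zero by (auto simp: y_def min_def)
      obtain x where "0 \<le> x" "x \<le> s" "u x = y"
        using IVT'[of u 0 y s] u0 y s c' by auto
      then show False using no_neg[of x] sin_lt_zero[of y] y by simp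
    qed
    moreover have "u s \<ge> 0"
    proof (rule ccontr)
      assume n: "\<not> u s \<ge> 0"
      define y where "y = max (u s) (- (pi / 2))"
      have y: "- pi < y" "u s \<le> y" "y < 0" using n pi_gt_zero by (auto simp: y_def max_def)
      obtain x where "0 \<le> x" "x \<le> s" "u x = y"
        using IVT2'[of u s y 0] u0 y s c' by auto
      then show False using no_neg[of x] sin_gt_zero[of "- y"] y by simp
    qed
    ultimately show ?thesis by simp
  qed
  show thesis
    by (rule that[OF cu du XY urange])
qed

text \<open>The reduction of the elastica to a pendulum. The sign \<open>\<sigma>\<close> is \<open>1\<close> for increasing and \<open>-1\<close> for decreasing
  curvature, so that \<open>\<sigma> k\<close> increases; the velocity of the pendulum is \<open>- \<sigma> k\<close>.\<close>

lemma elastica_pendulum: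
  fixes \<gamma> T h :: "real \<Rightarrow> real^2"
  assumes T_def: "T = tangent L \<gamma>" and L: "L > 0" and el: "elastica L \<gamma>" and curv: "signed_curvature L \<gamma> k"
    and nonconst: "\<not> k constant_on {0<..<L}"
    and mono: "mono_on {0<..<L} k \<or> antimono_on {0<..<L} k"
    and weak: "weak_derivative 2 L \<gamma> h"
    and cT: "continuous_on {0..L} T"
    and unit: "\<And>s. s \<in> {0..L} \<Longrightarrow> norm (T s) = 1"
    and d\<gamma>: "\<And>s. s \<in> {0..L} \<Longrightarrow> (\<gamma> has_vector_derivative T s) (at s within {0..L})"
    and diff: "\<And>s t. 0 \<le> s \<Longrightarrow> s \<le> t \<Longrightarrow> t \<le> L \<Longrightarrow> T t - T s = integral {s..t} h"
  obtains c \<sigma> :: real and e u v where "pendulum L c u v" "norm e = 1" "\<sigma> * \<sigma> = 1"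
    "\<And>s. s \<in> {0..L} \<Longrightarrow> inner e (T s) = cos (u s)"
    "\<And>s. s \<in> {0..L} \<Longrightarrow> \<sigma> * inner e (rot (T s)) = sin (u s)"
    "integral {0..L} (\<lambda>s. (v s)\<^sup>2) = integral {0..L} (\<lambda>s. (norm (h s))\<^sup>2)"
proof -
  have c\<gamma>: "continuous_on {0..L} \<gamma>"
    using d\<gamma> by (meson continuous_on_eq_continuous_within has_vector_derivative_continuous)
  then have c\<gamma>': "continuous_on {0<..<L} \<gamma>"
    by (rule continuous_on_subset) auto
  have nv: "normal_vec L \<gamma> s = rot (T s)" for s
    by (simp add: normal_vec_eq_rot T_def)
  obtain lam k1 where k1: "signed_curvature L \<gamma> k1" "elastica_equation L lam k1"
    using el unfolding elastica_def by blast
  obtain N1 where N1: "negligible N1" "\<And>s. s \<in> {0<..<L} - N1 \<Longrightarrow> k1 s *\<^sub>R rot (T s) = k s *\<^sub>R rot (T s)"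
    by (rule weak_second_derivative_unique[OF k1(1)[unfolded signed_curvature_def]
          curv[unfolded signed_curvature_def] c\<gamma>', unfolded nv]) (rule that)
  have "k s = k1 s" if s: "s \<in> {0<..<L} - N1" for s
  proof -
    have "rot (T s) \<noteq> 0" using unit[of s] s by (metis DiffD1 atLeastAtMost_iff greaterThanLessThan_iff less_imp_le norm_rot norm_zero zero_neq_one)
    then show ?thesis using N1(2)[OF s] by simp
  qed
  then have wk: "weak_derivative 2 L k (\<lambda>s. - (k s ^ 3 - lam * k s) / 2)"
    by (intro weak_derivative_spike[OF elastica_equation_imp_weak_derivative[OF k1(2)] N1(1)]) auto
  obtain k' where k': "\<And>t. 0 < t \<Longrightarrow> t < L \<Longrightarrow> (k has_real_derivative k' t) (at t)"
    "\<And>t. 0 < t \<Longrightarrow> t < L \<Longrightarrow> (k' has_real_derivative - (k t ^ 3 - lam * k t) / 2) (at t)"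
    by (rule monotone_elastica_curvature_C2[OF wk mono]) (rule that)
  have ck: "continuous_on {0<..<L} k"
    using DERIV_isCont[OF k'(1)] by (auto intro!: continuous_at_imp_continuous_on)
  have cT': "continuous_on {0<..<L} T" by (rule continuous_on_subset[OF cT]) auto
  have crot: "continuous_on S (\<lambda>s. rot (f s))" if "continuous_on S f" for S :: "real set" and f
    using bounded_linear.continuous_on[OF bounded_linear_rot that] .
  obtain N2 where N2: "negligible N2" "\<And>s. s \<in> {0<..<L} - N2 \<Longrightarrow> h s = k s *\<^sub>R rot (T s)"
    by (rule weak_second_derivative_unique[OF weak curv[unfolded signed_curvature_def] c\<gamma>', unfolded nv]) (rule that)
  have dT: "(T has_vector_derivative k t *\<^sub>R rot (T t)) (at t)" if t: "0 < t" "t < L" for t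
  proof (rule primitive_of_continuous_has_derivative[OF _ _ t])
    show "continuous_on {0<..<L} (\<lambda>t. k t *\<^sub>R rot (T t))"
      by (intro continuous_intros ck crot cT')
    fix s t assume st: "0 < s" "s \<le> t" "t < L"
    have "integral {s..t} (\<lambda>t. k t *\<^sub>R rot (T t)) = integral {s..t} h"
      by (rule integral_spike[OF N2(1)]) (use N2(2) st in auto)
    then show "T t - T s = integral {s..t} (\<lambda>t. k t *\<^sub>R rot (T t))"
      using diff[of s t] st by simp
  qed
  have dN: "((\<lambda>s. rot (T s)) has_vector_derivative - k t *\<^sub>R T t) (at t)" if t: "0 < t" "t < L" for t
  proof -
    have "((\<lambda>s. rot (T s)) has_vector_derivative rot (k t *\<^sub>R rot (T t))) (at t)"
      by (rule bounded_linear.has_vector_derivative[OF bounded_linear_rot dT[OF t]])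
    then show ?thesis
      by (simp add: linear_cmul[OF bounded_linear.linear[OF bounded_linear_rot]])
  qed
  (* The first integral of the elastica equation. *)
  define V where "V s = ((k s)\<^sup>2 - lam) *\<^sub>R T s + (2 * k' s) *\<^sub>R rot (T s)" for s
  have dV: "(V has_vector_derivative 0) (at t)" if t: "0 < t" "t < L" for t
  proof -
    have "((\<lambda>s. (k s)\<^sup>2 - lam) has_real_derivative 2 * k t * k' t) (at t)"
      using k'(1)[OF t] by (auto intro!: derivative_eq_intros)
    moreover have "((\<lambda>s. 2 * k' s) has_real_derivative - (k t ^ 3 - lam * k t)) (at t)"
      using k'(2)[OF t] by (auto intro!: derivative_eq_intros)
    ultimately have "(V has_vector_derivative
        (((k t)\<^sup>2 - lam) *\<^sub>R (k t *\<^sub>R rot (T t)) + (2 * k t * k' t) *\<^sub>R T t) +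
        ((2 * k' t) *\<^sub>R (- k t *\<^sub>R T t) + (- (k t ^ 3 - lam * k t)) *\<^sub>R rot (T t))) (at t)"
      unfolding V_def by (intro has_vector_derivative_add has_vector_derivative_scaleR dT dN t)
    moreover have "(((k t)\<^sup>2 - lam) *\<^sub>R (k t *\<^sub>R rot (T t)) + (2 * k t * k' t) *\<^sub>R T t) +
        ((2 * k' t) *\<^sub>R (- k t *\<^sub>R T t) + (- (k t ^ 3 - lam * k t)) *\<^sub>R rot (T t)) = 0"
      by (simp add: vec_eq_iff forall_2 power2_eq_square power3_eq_cube algebra_simps)
    ultimately show ?thesis by simp
  qed
  obtain V0 where V0: "\<And>t. t \<in> {0<..<L} \<Longrightarrow> V t = V0"
    by (rule has_vector_derivative_zero_constant[of "{0<..<L}" V])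
      (use dV in \<open>auto intro: has_vector_derivative_at_within\<close>)
  have k'V: "2 * k' t = inner V0 (rot (T t))" if t: "0 < t" "t < L" for t
  proof -
    have "inner (T t) (rot (T t)) = 0" by (simp add: inner_R2)
    moreover have "inner (rot (T t)) (rot (T t)) = 1"
      using unit[of t] t by (simp flip: power2_norm_eq_inner)
    ultimately have "inner (V t) (rot (T t)) = 2 * k' t"
      by (simp add: V_def inner_add_left)
    then show ?thesis using V0[of t] t by simp
  qed
  have const_if: "False" if "\<And>t. 0 < t \<Longrightarrow> t < L \<Longrightarrow> k' t = 0"
  proof -
    have "(k has_real_derivative 0) (at t within {0<..<L})" if t: "t \<in> {0<..<L}" for t
      using k'(1)[of t] \<open>\<And>t. 0 < t \<Longrightarrow> t < L \<Longrightarrow> k' t = 0\<close>[of t] t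
      by (auto intro: has_field_derivative_at_within)
    then obtain c0 where "\<And>t. t \<in> {0<..<L} \<Longrightarrow> k t = c0"
      using has_field_derivative_zero_constant[of "{0<..<L}" k] by auto
    then show False using nonconst unfolding constant_on_def by blast
  qed
  define c where "c = norm V0 / 2"
  have c: "c > 0"
  proof (rule ccontr)
    assume "\<not> c > 0"
    then have "V0 = 0" by (simp add: c_def)
    then show False using const_if k'V by simp
  qed
  define e where "e = V0 /\<^sub>R (2 * c)"
  have e: "norm e = 1" using c by (simp add: e_def c_def)
  have k'e: "k' t = c * inner e (rot (T t))" if "0 < t" "t < L" for t
    using k'V[OF that] c by (simp add: e_def field_simps)
  obtain \<sigma> :: real where \<sigma>: "\<sigma> * \<sigma> = 1" and k'_sign: "\<And>t. 0 < t \<Longrightarrow> t < L \<Longrightarrow> \<sigma> * k' t \<ge> 0"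
  proof (cases "mono_on {0<..<L} k")
    case True
    have "k' t \<ge> 0" if "0 < t" "t < L" for t
      using mono_on_imp_deriv_nonneg[OF True k'(1)[OF that]] that by simp
    with that[of 1] show ?thesis by simp
  next
    case False
    then have "mono_on {0<..<L} (\<lambda>s. - k s)"
      using mono by (auto simp: monotone_on_def)
    from mono_on_imp_deriv_nonneg[OF this DERIV_minus[OF k'(1)]]
    have "- k' t \<ge> 0" if "0 < t" "t < L" for t
      using that by simp
    with that[of "-1"] show ?thesis by simp
  qed
  (* As k' = c e . rot T, the curvature is an affine function of the position. This continues it to the
     end points, where k itself has arbitrary values. *)
  define K where "K s = \<sigma> * (k (L/2) + c * inner e (rot (\<gamma> s - \<gamma> (L/2))))" for s
  have cK: "continuous_on {0..L} K"
    unfolding K_def by (intro continuous_intros crot c\<gamma>)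
  have dK: "(K has_real_derivative \<sigma> * (c * inner e (rot (T t)))) (at t)" if t: "0 < t" "t < L" for t
  proof -
    have "(\<gamma> has_vector_derivative T t) (at t)"
      using d\<gamma>[of t] t at_within_interior[of t "{0..L}"] by simp
    then have "((\<lambda>s. \<gamma> s - \<gamma> (L/2)) has_vector_derivative T t) (at t)"
      by (auto intro!: derivative_eq_intros)
    from bounded_linear.has_vector_derivative[OF bounded_linear_compose[OF bounded_linear_inner_right[of e] bounded_linear_rot] this]
    have "((\<lambda>s. inner e (rot (\<gamma> s - \<gamma> (L/2)))) has_real_derivative inner e (rot (T t))) (at t)"
      by (simp add: has_real_derivative_iff_has_vector_derivative o_def)
    then show ?thesis
      unfolding K_def by (auto intro!: derivative_eq_intros)
  qed
  have Kk: "K t = \<sigma> * k t" if t: "t \<in> {0<..<L}" for t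
  proof -
    have rot0: "rot 0 = 0" by (simp add: vec_eq_iff forall_2)
    have "((\<lambda>s. K s - \<sigma> * k s) has_real_derivative 0) (at x within {0<..<L})" if "x \<in> {0<..<L}" for x
    proof (rule has_field_derivative_at_within)
      have "((\<lambda>s. K s - \<sigma> * k s) has_real_derivative \<sigma> * (c * inner e (rot (T x))) - \<sigma> * k' x) (at x)"
        using dK[of x] k'(1)[of x] that by (auto intro!: derivative_eq_intros)
      then show "((\<lambda>s. K s - \<sigma> * k s) has_real_derivative 0) (at x)"
        using k'e[of x] that by simp
    qed
    then obtain c0 where c0: "\<And>x. x \<in> {0<..<L} \<Longrightarrow> K x - \<sigma> * k x = c0"
      using has_field_derivative_zero_constant[of "{0<..<L}" "\<lambda>s. K s - \<sigma> * k s"] by auto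
    have "K (L/2) - \<sigma> * k (L/2) = 0" by (simp add: K_def rot0)
    then show ?thesis using c0[OF t] c0[of "L/2"] L by simp
  qed
  define X where "X s = inner e (T s)" for s
  define Y where "Y s = \<sigma> * inner e (rot (T s))" for s
  have cXY: "continuous_on {0..L} X" "continuous_on {0..L} Y"
    unfolding X_def Y_def by (intro continuous_intros crot cT)+
  have Y_in: "Y s \<ge> 0" if "0 < s" "s < L" for s
  proof -
    have "c * Y s \<ge> 0" using k'_sign[OF that] k'e[OF that] by (simp add: Y_def mult_ac)
    then show ?thesis using c by (simp add: zero_le_mult_iff)
  qed
  have Y_nonneg: "Y s \<ge> 0" if s: "s \<in> {0..L}" for s
  proof (rule continuous_ge_on_closure[of "{0<..<L}" Y s 0])
    show "continuous_on (closure {0<..<L}) Y" using cXY L by simp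
    show "s \<in> closure {0<..<L}" using s L by simp
  qed (use Y_in in auto)
  have XY_unit: "(X s)\<^sup>2 + (Y s)\<^sup>2 = 1" if s: "s \<in> {0..L}" for s
  proof -
    have "(Y s)\<^sup>2 = (\<sigma> * \<sigma>) * (inner e (rot (T s)) * inner e (rot (T s)))"
      by (simp add: Y_def power2_eq_square mult_ac)
    then show ?thesis
      using inner_orthonormal[OF e, of "T s" "T s"] unit[OF s] \<sigma>
      by (simp add: X_def power2_eq_square norm_eq_sqrt_inner)
  qed
  have dX: "(X has_real_derivative K s * Y s) (at s)" if s: "0 < s" "s < L" for s
  proof -
    have "(X has_real_derivative inner e (k s *\<^sub>R rot (T s))) (at s)"
      unfolding X_def has_real_derivative_iff_has_vector_derivative
      by (rule bounded_linear.has_vector_derivative[OF bounded_linear_inner_right dT[OF s]])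
    moreover have "K s * Y s = (\<sigma> * \<sigma>) * (k s * inner e (rot (T s)))"
      using Kk[of s] s by (simp add: Y_def mult_ac)
    ultimately show ?thesis using \<sigma> by simp
  qed
  have dY: "(Y has_real_derivative - K s * X s) (at s)" if s: "0 < s" "s < L" for s
  proof -
    have "((\<lambda>s. inner e (rot (T s))) has_real_derivative inner e (- k s *\<^sub>R T s)) (at s)"
      unfolding has_real_derivative_iff_has_vector_derivative
      by (rule bounded_linear.has_vector_derivative[OF bounded_linear_inner_right dN[OF s]])
    then have "(Y has_real_derivative \<sigma> * inner e (- k s *\<^sub>R T s)) (at s)"
      unfolding Y_def by (rule DERIV_cmult)
    then show ?thesis using Kk[of s] s by (simp add: X_def mult_ac)
  qed
  obtain u where u: "continuous_on {0..L} u" "\<And>s. 0 < s \<Longrightarrow> s < L \<Longrightarrow> (u has_real_derivative - K s) (at s)"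
    "\<And>s. s \<in> {0..L} \<Longrightarrow> X s = cos (u s)" "\<And>s. s \<in> {0..L} \<Longrightarrow> Y s = sin (u s)"
    "\<And>s. s \<in> {0..L} \<Longrightarrow> 0 \<le> u s \<and> u s \<le> pi"
    by (rule angle_lift[OF L cK cXY]) (erule (1) dX, erule (1) dY, erule XY_unit, erule Y_nonneg, rule that)
  show thesis
  proof (rule that[of c u "\<lambda>s. - K s" e \<sigma>])
    show "pendulum L c u (\<lambda>s. - K s)"
      unfolding pendulum_def
    proof (intro conjI ballI)
      show "\<exists>x\<in>{0..L}. u x \<noteq> 0"
      proof (rule ccontr)
        assume "\<not> (\<exists>x\<in>{0..L}. u x \<noteq> 0)"
        then have "Y t = 0" if "0 < t" "t < L" for t using u(4)[of t] that by simp
        then have "inner e (rot (T t)) = 0" if "0 < t" "t < L" for t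
          using \<sigma> that by (fastforce simp: Y_def)
        then show False using const_if k'e by simp
      qed
      fix s assume "s \<in> {0<..<L}"
      then have s: "0 < s" "s < L" by auto
      show "(u has_real_derivative - K s) (at s)" by (rule u(2)[OF s])
      have "((\<lambda>s. - K s) has_real_derivative - (\<sigma> * (c * inner e (rot (T s))))) (at s)"
        by (rule DERIV_minus[OF dK[OF s]])
      moreover have "- (\<sigma> * (c * inner e (rot (T s)))) = - c * sin (u s)"
        using u(4)[of s] s by (simp add: Y_def mult.left_commute[of \<sigma> c])
      ultimately show "((\<lambda>s. - K s) has_real_derivative - c * sin (u s)) (at s)"
        by (simp only:)
    qed (use L c u(1,5) cK in \<open>auto intro: continuous_on_minus\<close>)
    show "integral {0..L} (\<lambda>s. (- K s)\<^sup>2) = integral {0..L} (\<lambda>s. (norm (h s))\<^sup>2)"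
    proof (rule integral_spike)
      show "negligible (insert 0 (insert L N2))" using N2(1) by simp
      fix s assume "s \<in> {0..L} - insert 0 (insert L N2)"
      then have s: "s \<in> {0<..<L} - N2" by auto
      have "(K s)\<^sup>2 = (\<sigma> * \<sigma>) * (k s)\<^sup>2"
        using Kk[of s] s by (simp add: power2_eq_square mult_ac)
      then show "(norm (h s))\<^sup>2 = (- K s)\<^sup>2"
        using N2(2)[OF s] unit[of s] s \<sigma> by simp
    qed
  qed (use e \<sigma> u(3,4) in \<open>auto simp: X_def Y_def\<close>)
qed

lemma has_integral_tangent_component:
  fixes \<gamma> T :: "real \<Rightarrow> real^2"
  assumes L: "L > 0" and d: "\<And>s. s \<in> {0..L} \<Longrightarrow> (\<gamma> has_vector_derivative T s) (at s within {0..L})"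
    and f: "bounded_linear f"
  shows "((\<lambda>s. f (T s)) has_integral f (\<gamma> L - \<gamma> 0)) {0..L}"
proof -
  have "(T has_integral \<gamma> L - \<gamma> 0) {0..L}"
    by (rule fundamental_theorem_of_calculus) (use L d in auto)
  from has_integral_linear[OF this f] show ?thesis by (simp add: o_def)
qed

theorem theorem1p1:
  fixes L :: real and \<gamma> :: "real \<Rightarrow> real^2" and k :: "real \<Rightarrow> real"
  assumes "L > 0"
    and "elastica L \<gamma>"
    and "signed_curvature L \<gamma> k"
    and "\<not> k constant_on {0<..<L}"
    and "mono_on {0<..<L} k \<or> antimono_on {0<..<L} k"
  shows "is_arg_min (bending_energy L) (\<lambda>c. c \<in> admissible L \<gamma>) \<gamma> \<and>
         (\<forall>c. is_arg_min (bending_energy L) (\<lambda>c. c \<in> admissible L \<gamma>) c \<longrightarrow>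
            (\<forall>s\<in>{0..L}. c s = \<gamma> s))"
proof -
  note L = assms(1)
  have \<gamma>_arc: "\<gamma> \<in> W22_arc L" using assms(2) by (simp add: elastica_def)
  then have \<gamma>_adm: "\<gamma> \<in> admissible L \<gamma>" by (simp add: admissible_def)
  define T where "T = tangent L \<gamma>"
  obtain h where h: "weak_derivative 2 L \<gamma> h" "continuous_on {0..L} T"
    "\<And>s. s \<in> {0..L} \<Longrightarrow> norm (T s) = 1"
    "\<And>s. s \<in> {0..L} \<Longrightarrow> (\<gamma> has_vector_derivative T s) (at s within {0..L})"
    "\<And>s t. 0 \<le> s \<Longrightarrow> s \<le> t \<Longrightarrow> t \<le> L \<Longrightarrow> T t - T s = integral {s..t} h"
    "bending_energy L \<gamma> = integral {0..L} (\<lambda>s. (norm (h s))\<^sup>2)"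
    by (rule W22_arc_regularity[OF L \<gamma>_arc, folded T_def]) (rule that)
  obtain c \<sigma> :: real and e u v where p: "pendulum L c u v" and e: "norm e = 1" and \<sigma>: "\<sigma> * \<sigma> = 1"
    and cos_u: "\<And>s. s \<in> {0..L} \<Longrightarrow> inner e (T s) = cos (u s)"
    and sin_u: "\<And>s. s \<in> {0..L} \<Longrightarrow> \<sigma> * inner e (rot (T s)) = sin (u s)"
    and v_int: "integral {0..L} (\<lambda>s. (v s)\<^sup>2) = integral {0..L} (\<lambda>s. (norm (h s))\<^sup>2)"
    by (rule elastica_pendulum[OF T_def assms(1-5) h(1)])
      (rule h(2), erule h(3), erule h(4), erule (2) h(5), rule that)
  note pf = pendulum_facts[OF p]
  have f1: "bounded_linear (\<lambda>x. inner e x)" by (rule bounded_linear_inner_right)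
  have f2: "bounded_linear (\<lambda>x. \<sigma> * inner e (rot x))"
    using bounded_linear_const_mult[OF bounded_linear_compose[OF f1 bounded_linear_rot]] by simp
  have int_cos: "((\<lambda>s. cos (u s)) has_integral inner e (\<gamma> L - \<gamma> 0)) {0..L}"
    by (rule has_integral_eq[OF _ has_integral_tangent_component[OF L h(4) f1]]) (use cos_u in auto)
  have int_sin: "((\<lambda>s. sin (u s)) has_integral \<sigma> * inner e (rot (\<gamma> L - \<gamma> 0))) {0..L}"
    by (rule has_integral_eq[OF _ has_integral_tangent_component[OF L h(4) f2]]) (use sin_u in auto)
  have compare: "bending_energy L \<gamma> \<le> bending_energy L d" and
    equal: "bending_energy L d \<le> bending_energy L \<gamma> \<Longrightarrow> \<forall>s\<in>{0..L}. d s = \<gamma> s"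
    if d: "d \<in> admissible L \<gamma>" for d
  proof -
    have d_arc: "d \<in> W22_arc L" and d_end: "d 0 = \<gamma> 0" "d L = \<gamma> L"
      "tangent L d 0 = T 0" "tangent L d L = T L"
      using d by (auto simp: admissible_def T_def)
    define S where "S = tangent L d"
    obtain g where g: "continuous_on {0..L} S"
      "\<And>s. s \<in> {0..L} \<Longrightarrow> norm (S s) = 1"
      "\<And>s. s \<in> {0..L} \<Longrightarrow> (d has_vector_derivative S s) (at s within {0..L})"
      "\<And>s t. 0 \<le> s \<Longrightarrow> s \<le> t \<Longrightarrow> t \<le> L \<Longrightarrow> S t - S s = integral {s..t} g"
      "g integrable_on {0..L}" "(\<lambda>s. (norm (g s))\<^sup>2) integrable_on {0..L}"
      "bending_energy L d = integral {0..L} (\<lambda>s. (norm (g s))\<^sup>2)"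
      by (rule W22_arc_regularity[OF L d_arc, folded S_def]) (rule that)
    define \<psi> where "\<psi> s = arccos (inner e (S s))" for s
    define M where "M s = integral {0..s} (\<lambda>s. (norm (g s))\<^sup>2)" for s
    have S_range: "-1 \<le> inner e (S s)" "inner e (S s) \<le> 1" if "s \<in> {0..L}" for s
      using Cauchy_Schwarz_ineq2[of e "S s"] e g(2)[OF that] by auto
    have cos_\<psi>: "cos (\<psi> s) = inner e (S s)" if "s \<in> {0..L}" for s
      using S_range[OF that] by (simp add: \<psi>_def)
    have \<psi>_dom: "continuous_on {0..L} \<psi>" "energy_dominated 0 L \<psi> M"
      unfolding \<psi>_def[abs_def] M_def[abs_def]
      by (rule tangent_angle_energy_dominated[OF g(1,2,4,5,6) e]; assumption)+
    have M_cont: "continuous_on {0..L} M"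
      unfolding M_def by (rule indefinite_integral_continuous_1[OF g(6)])
    have \<psi>_range: "0 \<le> \<psi> s \<and> \<psi> s \<le> pi" if "s \<in> {0..L}" for s
      using S_range[OF that] by (simp add: \<psi>_def arccos_lbound arccos_ubound)
    have \<psi>_ends: "\<psi> 0 = u 0" "\<psi> L = u L"
      using d_end cos_u[of 0] cos_u[of L] L pf(7,8)[of 0] pf(7,8)[of L]
      by (simp_all add: \<psi>_def S_def arccos_cos)
    have "((\<lambda>s. cos (\<psi> s)) has_integral inner e (d L - d 0)) {0..L}"
      by (rule has_integral_eq[OF _ has_integral_tangent_component[OF L g(3) f1]]) (use cos_\<psi> in auto)
    then have int_eq: "integral {0..L} (\<lambda>s. cos (\<psi> s)) = integral {0..L} (\<lambda>s. cos (u s))"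
      using int_cos d_end by (simp add: integral_unique)
    have M_diff: "M L - M 0 = bending_energy L d"
      by (simp add: M_def g(7))
    note min = pendulum_minimises[OF p \<psi>_dom(1) M_cont \<psi>_dom(2) \<psi>_range \<psi>_ends]
    show "bending_energy L \<gamma> \<le> bending_energy L d"
      using min(1) int_eq M_diff v_int h(6) by simp
    assume le: "bending_energy L d \<le> bending_energy L \<gamma>"
    have \<psi>_u: "\<psi> s = u s" if "s \<in> {0..L}" for s
      by (rule min(2)[OF _ _ that]) (use min(1) le int_eq M_diff v_int h(6) in simp_all)
    (* The component of the competitor's tangent orthogonal to e. For the elastica it equals sin u. *)
    define w where "w s = \<sigma> * inner e (rot (S s))" for s
    have w2: "(w s)\<^sup>2 = (sin (u s))\<^sup>2" if s: "s \<in> {0..L}" for s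
    proof -
      have "(w s)\<^sup>2 = (\<sigma> * \<sigma>) * (inner e (rot (S s)) * inner e (rot (S s)))"
        by (simp add: w_def power2_eq_square mult_ac)
      also have "\<dots> = 1 - (cos (u s))\<^sup>2"
        using inner_orthonormal[OF e, of "S s" "S s"] g(2)[OF s] cos_\<psi>[OF s] \<psi>_u[OF s] \<sigma>
        by (simp add: power2_eq_square norm_eq_sqrt_inner)
      finally show ?thesis by (simp add: sin_squared_eq)
    qed
    have w_le: "w s \<le> sin (u s)" if s: "s \<in> {0..L}" for s
      using w2[OF s] pf(7,8)[of s] s sin_ge_zero[of "u s"]
      by (metis abs_ge_self abs_of_nonneg atLeastAtMost_iff power2_eq_iff abs_minus_cancel)
    have cw: "continuous_on {0..L} (\<lambda>s. sin (u s) - w s)"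
      unfolding w_def
      by (intro continuous_intros pf bounded_linear.continuous_on[OF bounded_linear_rot g(1)])
    have "(w has_integral \<sigma> * inner e (rot (d L - d 0))) {0..L}"
      unfolding w_def by (rule has_integral_tangent_component[OF L g(3) f2])
    from has_integral_diff[OF int_sin this]
    have "integral {0..L} (\<lambda>s. sin (u s) - w s) = 0"
      using d_end by (simp add: integral_unique)
    then have w_eq: "w s = sin (u s)" if "s \<in> {0..L}" for s
      using integral_eq_0_iff[OF cw L] w_le that by auto
    have ST: "S s = T s" if s: "s \<in> {0..L}" for s
    proof -
      have 1: "inner (S s) e = inner (T s) e"
        using cos_\<psi>[OF s] \<psi>_u[OF s] cos_u[OF s] by (simp add: inner_commute)
      have "\<sigma> * inner e (rot (S s)) = \<sigma> * inner e (rot (T s))"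
        using w_eq[OF s] sin_u[OF s] by (simp add: w_def)
      then have "inner e (rot (S s)) = inner e (rot (T s))" using \<sigma> by auto
      then have 2: "inner (S s) (rot e) = inner (T s) (rot e)"
        by (simp add: inner_R2 algebra_simps)
      show ?thesis
        by (subst orthonormal_expansion[OF e, of "S s"], subst orthonormal_expansion[OF e, of "T s"])
          (simp only: 1 2)
    qed
    show "\<forall>s\<in>{0..L}. d s = \<gamma> s"
    proof
      fix s assume s: "s \<in> {0..L}"
      have "(S has_integral d s - d 0) {0..s}" "(T has_integral \<gamma> s - \<gamma> 0) {0..s}"
        using s by (auto intro!: fundamental_theorem_of_calculus
            has_vector_derivative_within_subset[OF g(3)] has_vector_derivative_within_subset[OF h(4)])
      moreover have "integral {0..s} S = integral {0..s} T"
        using ST s by (intro integral_cong) auto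
      ultimately have "d s - d 0 = \<gamma> s - \<gamma> 0"
        by (simp add: integral_unique)
      then show "d s = \<gamma> s" using d_end by simp
    qed
  qed
  show ?thesis
    unfolding is_arg_min_def using \<gamma>_adm compare equal by (metis linorder_not_less)
qed

end
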